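(* Let $\mathcal X,\mathcal Y$ be complex Banach spaces, $A\in\mathcal B(\mathcal X)$, $B\in\mathcal B(\mathcal Y)$, $C\in\mathcal B(\mathcal Y,\mathcal X)$, and let $M=\begin{pmatrix}A&C\\0&B\end{pmatrix}\in\mathcal B(\mathcal X\oplus\mathcal Y)$. Let $U_1,U_2\subset\mathbb C$ be disjoint open sets with $\widehat{\sigma(A)}\subset U_1$ and $\widehat{\sigma(B)}\subset U_2$, and let $\varphi:U_1\cup U_2\to\mathbb C$ be the locally constant holomorphic function with $\varphi=1$ on $U_1$ and $\varphi=-1$ on $U_2$. Let $p$ be a monic polynomial of degree $d\ge1$ with simple roots $\lambda_1,\dots,\lambda_d$ such that $$V_p(M)=\{\lambda\in\mathbb C:\ |p(\lambda)|\le\|p(M)\|\}\subset U_1\cup U_2 .$$ Let $Q=\frac1{2\pi i}\int_{\gamma_1}(\lambda-M)^{-1}\,d\lambda$, where $\gamma_1$ is a contour in $U_1$ surrounding $\sigma(A)$. Then $Q=\frac12(\varphi(M)+I)$, where $$\varphi(M)=\sum_{j=1}^d\delta_j(M)\sum_{n=0}^\infty\frac{f_j^{(n)}(0)}{n!}\,p(M)^n .$$ Here $\varphi(M)$ is given by the holomorphic functional calculus, and the polynomials $\delta_j$ and numbers $f_j^{(n)}(0)$ are those defined in the context.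
   Context: $\mathcal B(\cdot)$ denotes bounded linear operators and $\sigma(T)$ the spectrum of $T$. $\mathcal X\oplus\mathcal Y$ carries a direct-sum norm (coordinate embeddings isometric, coordinate projections contractive). For compact $K\subset\mathbb C$, $\widehat K=\{z: |p(z)|\le\sup_{K}|p|\text{ for all polynomials }p\}$. "Contour $\gamma_1$ in $U_1$ surrounding $\sigma(A)$" means a finite union of closed rectifiable curves in $U_1\setminus\sigma(A)$ with total winding number $1$ around each point of $\sigma(A)$ and $0$ around each point of $\mathbb C\setminus U_1$. $\delta_j(\lambda)=\prod_{k\ne j}\frac{\lambda-\lambda_k}{\lambda_j-\lambda_k}$ are the Lagrange polynomials at the roots of $p$. The functions $f_j$ are the components of the multicentric representation $\varphi(\lambda)=\sum_{j=1}^d\delta_j(\lambda)f_j(p(\lambda))$, with $f_j$ holomorphic near $0$; their derivatives at $0$ are computed by the following recursion. Define polynomials $b_{n,m}$ ($n,m\ge0$) by $b_{0,0}=1$, $b_{1,1}=p'$, $b_{n,0}=0$ for $n>0$, $b_{n,m}=0$ for $m>n$, and $b_{n+1,m}=b_{n,m-1}\,p'+b_{n,m}'$. Then for $n\ge0$ and $1\le j\le d$, $$(p'(\lambda_j))^nf_j^{(n)}(0)=\varphi^{(n)}(\lambda_j)-\sum_{k=1}^d\sum_{m=0}^{n-1}\binom nm\delta_k^{(n-m)}(\lambda_j)\sum_{l=0}^m b_{m,l}(\lambda_j)f_k^{(l)}(0)-\sum_{l=0}^{n-1}b_{n,l}(\lambda_j)f_j^{(l)}(0),$$ where $\varphi^{(0)}(\lambda_j)=\varphi(\lambda_j)=\pm1$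 and $\varphi^{(n)}(\lambda_j)=0$ for $n\ge1$. *)

theory Defs
  imports "HOL-Complex_Analysis.Complex_Analysis"
begin

section \<open>Complex Banach spaces and their bounded operators\<close>

class complex_normed_vector = real_normed_vector +
  fixes scaleC :: "complex \<Rightarrow> 'a \<Rightarrow> 'a"  (infixr "*\<^sub>C" 75)
  assumes scaleC_add_right: "c *\<^sub>C (x + y) = c *\<^sub>C x + c *\<^sub>C y"
    and scaleC_add_left: "(b + c) *\<^sub>C x = b *\<^sub>C x + c *\<^sub>C x"
    and scaleC_scaleC: "b *\<^sub>C c *\<^sub>C x = (b * c) *\<^sub>C x"
    and scaleC_of_real: "complex_of_real r *\<^sub>C x = r *\<^sub>R x"
    and norm_scaleC: "norm (c *\<^sub>C x) = cmod c * norm x"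

class complex_banach = complex_normed_vector + banach

instantiation prod :: (complex_normed_vector, complex_normed_vector) complex_normed_vector
begin

definition scaleC_prod :: "complex \<Rightarrow> 'a \<times> 'b \<Rightarrow> 'a \<times> 'b"
  where "scaleC_prod c z = (c *\<^sub>C fst z, c *\<^sub>C snd z)"

instance
proof
  fix b c :: complex and r :: real and x y :: "'a \<times> 'b"
  show "c *\<^sub>C (x + y) = c *\<^sub>C x + c *\<^sub>C y"
    by (simp add: scaleC_prod_def scaleC_add_right plus_prod_def)
  show "(b + c) *\<^sub>C x = b *\<^sub>C x + c *\<^sub>C x"
    by (simp add: scaleC_prod_def scaleC_add_left plus_prod_def)
  show "b *\<^sub>C c *\<^sub>C x = (b * c) *\<^sub>C x"
    by (simp add: scaleC_prod_def scaleC_scaleC)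
  show "complex_of_real r *\<^sub>C x = r *\<^sub>R x"
    by (simp add: scaleC_prod_def scaleC_of_real scaleR_prod_def)
  have "norm (c *\<^sub>C x) = sqrt ((cmod c)\<^sup>2 * ((norm (fst x))\<^sup>2 + (norm (snd x))\<^sup>2))"
    by (simp add: scaleC_prod_def norm_prod_def norm_scaleC power_mult_distrib distrib_left)
  then show "norm (c *\<^sub>C x) = cmod c * norm x"
    by (simp add: norm_prod_def real_sqrt_mult)
qed

end

instance prod :: (complex_banach, complex_banach) complex_banach ..

lemma bounded_linear_scaleC:
  "bounded_linear (\<lambda>x::'a::complex_normed_vector. c *\<^sub>C x)"
proof (rule bounded_linear_intro[where K = "cmod c"])
  fix x y :: 'a and r :: real
  show "c *\<^sub>C (x + y) = c *\<^sub>C x + c *\<^sub>C y"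
    by (rule scaleC_add_right)
  show "c *\<^sub>C r *\<^sub>R x = r *\<^sub>R c *\<^sub>C x"
    by (simp add: scaleC_scaleC mult.commute flip: scaleC_of_real)
  show "norm (c *\<^sub>C x) \<le> norm x * cmod c"
    by (simp add: norm_scaleC)
qed

instantiation blinfun :: (real_normed_vector, complex_normed_vector) complex_normed_vector
begin

lift_definition scaleC_blinfun :: "complex \<Rightarrow> ('a \<Rightarrow>\<^sub>L 'b) \<Rightarrow> ('a \<Rightarrow>\<^sub>L 'b)"
  is "\<lambda>c T x. c *\<^sub>C T x"
  by (rule bounded_linear_compose[OF bounded_linear_scaleC])

instance
proof
  fix b c :: complex and r :: real and x y :: "'a \<Rightarrow>\<^sub>L 'b"
  show "c *\<^sub>C (x + y) = c *\<^sub>C x + c *\<^sub>C y"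
    by transfer (simp add: scaleC_add_right)
  show "(b + c) *\<^sub>C x = b *\<^sub>C x + c *\<^sub>C x"
    by transfer (simp add: scaleC_add_left)
  show "b *\<^sub>C c *\<^sub>C x = (b * c) *\<^sub>C x"
    by transfer (simp add: scaleC_scaleC)
  show "complex_of_real r *\<^sub>C x = r *\<^sub>R x"
    by transfer (simp add: scaleC_of_real)
  have le: "norm (c *\<^sub>C x) \<le> cmod c * norm x" for c and x :: "'a \<Rightarrow>\<^sub>L 'b"
  proof (rule norm_blinfun_bound)
    fix v
    have "norm (blinfun_apply (c *\<^sub>C x) v) = cmod c * norm (blinfun_apply x v)"
      by (simp add: scaleC_blinfun.rep_eq norm_scaleC)
    also have "\<dots> \<le> cmod c * (norm x * norm v)"
      by (intro mult_left_mono norm_blinfun) simp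
    finally show "norm (blinfun_apply (c *\<^sub>C x) v) \<le> cmod c * norm x * norm v"
      by simp
  qed simp
  show "norm (c *\<^sub>C x) = cmod c * norm x"
  proof (cases "c = 0")
    case True
    then show ?thesis using le[of c x] by simp
  next
    case False
    have "inverse c *\<^sub>C c *\<^sub>C x = complex_of_real 1 *\<^sub>C x"
      using False by transfer (simp add: scaleC_scaleC)
    also have "\<dots> = x"
      by transfer (simp only: scaleC_of_real scaleR_one)
    finally have "norm x \<le> inverse (cmod c) * norm (c *\<^sub>C x)"
      using le[of "inverse c" "c *\<^sub>C x"] by (simp add: norm_inverse)
    then have "cmod c * norm x \<le> norm (c *\<^sub>C x)"
      using False by (simp add: field_simps)
    then show ?thesis using le[of c x] by simp
  qed
qed

end

instance blinfun :: (real_normed_vector, complex_banach) complex_banach ..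

text \<open>The library's bounded linear maps are only real-linear; the bounded operators between
  complex Banach spaces are those that are in addition complex-linear.\<close>

definition complex_linear_op ::
  "('a::complex_normed_vector \<Rightarrow>\<^sub>L 'b::complex_normed_vector) \<Rightarrow> bool"
  where "complex_linear_op T \<longleftrightarrow> (\<forall>c x. T (c *\<^sub>C x) = c *\<^sub>C T x)"

text \<open>A two-sided inverse of a complex-linear operator is automatically complex-linear.\<close>

definition op_invertible :: "('a::real_normed_vector \<Rightarrow>\<^sub>L 'a) \<Rightarrow> bool"
  where "op_invertible T \<longleftrightarrow>
    (\<exists>S. S o\<^sub>L T = id_blinfun \<and> T o\<^sub>L S = id_blinfun)"

definition op_inverse :: "('a::real_normed_vector \<Rightarrow>\<^sub>L 'a) \<Rightarrow> ('a \<Rightarrow>\<^sub>L 'a)"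
  where "op_inverse T = (THE S. S o\<^sub>L T = id_blinfun \<and> T o\<^sub>L S = id_blinfun)"

definition op_spectrum :: "('a::complex_normed_vector \<Rightarrow>\<^sub>L 'a) \<Rightarrow> complex set"
  where "op_spectrum T = {z. \<not> op_invertible (z *\<^sub>C id_blinfun - T)}"

definition resolvent :: "('a::complex_normed_vector \<Rightarrow>\<^sub>L 'a) \<Rightarrow> complex \<Rightarrow> ('a \<Rightarrow>\<^sub>L 'a)"
  where "resolvent T z = op_inverse (z *\<^sub>C id_blinfun - T)"

definition op_power :: "('a::real_normed_vector \<Rightarrow>\<^sub>L 'a) \<Rightarrow> nat \<Rightarrow> ('a \<Rightarrow>\<^sub>L 'a)"
  where "op_power T n = ((\<lambda>S. T o\<^sub>L S) ^^ n) id_blinfun"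

definition op_poly ::
  "complex poly \<Rightarrow> ('a::complex_normed_vector \<Rightarrow>\<^sub>L 'a) \<Rightarrow> ('a \<Rightarrow>\<^sub>L 'a)"
  where "op_poly q T = (\<Sum>i\<le>degree q. coeff q i *\<^sub>C op_power T i)"

section \<open>Direct sums\<close>

text \<open>The direct sum is the product space with an arbitrary norm \<open>N\<close> of the following kind.
  Such an \<open>N\<close> satisfies \<open>max (norm x) (norm y) \<le> N (x, y) \<le> norm x + norm y\<close>, so it is
  equivalent to the library norm of the product type: bounded operators, spectra and convergence
  are the same for both. Only the value of the operator norm depends on \<open>N\<close>; for it
  \<open>op_norm N\<close> has to be used.\<close>

definition direct_sum_norm ::
  "('a::complex_normed_vector \<times> 'b::complex_normed_vector \<Rightarrow> real) \<Rightarrow> bool"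
  where "direct_sum_norm N \<longleftrightarrow>
    (\<forall>z w. N (z + w) \<le> N z + N w) \<and>
    (\<forall>c z. N (c *\<^sub>C z) = cmod c * N z) \<and>
    (\<forall>z. N z = 0 \<longleftrightarrow> z = 0) \<and>
    (\<forall>x. N (x, 0) = norm x) \<and> (\<forall>y. N (0, y) = norm y) \<and>
    (\<forall>x y. norm x \<le> N (x, y)) \<and> (\<forall>x y. norm y \<le> N (x, y))"

definition op_norm :: "('a::real_normed_vector \<Rightarrow> real) \<Rightarrow> ('a \<Rightarrow>\<^sub>L 'a) \<Rightarrow> real"
  where "op_norm N T = (SUP z. N (T z) / N z)"

definition upper_triangular_op ::
  "('a::real_normed_vector \<Rightarrow>\<^sub>L 'a) \<Rightarrow> ('b::real_normed_vector \<Rightarrow>\<^sub>L 'a) \<Rightarrow> ('b \<Rightarrow>\<^sub>L 'b)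
    \<Rightarrow> (('a \<times> 'b) \<Rightarrow>\<^sub>L ('a \<times> 'b))"
  where "upper_triangular_op A C B = Blinfun (\<lambda>(x, y). (A x + C y, B y))"

lemma upper_triangular_op_apply: "upper_triangular_op A C B (x, y) = (A x + C y, B y)"
proof -
  have "bounded_linear (\<lambda>(x, y). (A x + C y, B y))"
    unfolding split_def by (intro bounded_linear_intros)
  then show ?thesis
    by (simp add: upper_triangular_op_def bounded_linear_Blinfun_apply)
qed

section \<open>Polynomially convex hull\<close>

text \<open>The supremum is taken in the extended reals, so that the hull of the empty set (the spectrum
  of an operator on the zero space) is empty.\<close>

definition polynomial_hull :: "complex set \<Rightarrow> complex set"
  where "polynomial_hull K =
    {z. \<forall>q. ereal (cmod (poly q z)) \<le> (SUP w\<in>K. ereal (cmod (poly q w)))}"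

section \<open>Contours and integrals of operator-valued functions\<close>

text \<open>The library's contour integral is restricted to complex-valued functions and piecewise
  continuously differentiable paths. Along a rectifiable curve \<open>g\<close> on \<open>[0, 1]\<close> the integral is
  the Riemann-Stieltjes integral, the limit of the sums
  \<open>(g(t\<^sub>i\<^sub>+\<^sub>1) - g(t\<^sub>i)) *\<^sub>C F(g(s\<^sub>i))\<close> as the mesh tends to \<open>0\<close>.\<close>

definition rectifiable_closed_curve :: "(real \<Rightarrow> complex) \<Rightarrow> bool"
  where "rectifiable_closed_curve g \<longleftrightarrow>
    path g \<and> pathfinish g = pathstart g \<and>
    (\<exists>L. \<forall>D. D division_of {0..1} \<longrightarrow> (\<Sum>k\<in>D. dist (g (Inf k)) (g (Sup k))) \<le> L)"

definition has_curve_integral ::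
  "(complex \<Rightarrow> 'a::complex_normed_vector) \<Rightarrow> 'a \<Rightarrow> (real \<Rightarrow> complex) \<Rightarrow> bool"
  where "has_curve_integral F I g \<longleftrightarrow>
    (\<forall>e>0. \<exists>\<delta>>0. \<forall>D. D tagged_division_of {0..1} \<and> (\<lambda>t. ball t \<delta>) fine D \<longrightarrow>
      norm ((\<Sum>(t, k)\<in>D. (g (Sup k) - g (Inf k)) *\<^sub>C F (g t)) - I) < e)"

definition curve_integral ::
  "(real \<Rightarrow> complex) \<Rightarrow> (complex \<Rightarrow> 'a::complex_normed_vector) \<Rightarrow> 'a"
  where "curve_integral g F = (THE I. has_curve_integral F I g)"

text \<open>A contour, as a finite union of curves, is a list, so that a curve may occur repeatedly.\<close>

definition surrounding_contour ::
  "(real \<Rightarrow> complex) list \<Rightarrow> complex set \<Rightarrow> complex set \<Rightarrow> bool"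
  where "surrounding_contour \<Gamma> K U \<longleftrightarrow>
    (\<forall>g\<in>set \<Gamma>. rectifiable_closed_curve g \<and> path_image g \<subseteq> U - K) \<and>
    (\<forall>z\<in>K. (\<Sum>g\<leftarrow>\<Gamma>. winding_number g z) = 1) \<and>
    (\<forall>z\<in>- U. (\<Sum>g\<leftarrow>\<Gamma>. winding_number g z) = 0)"

definition contour_sum_integral ::
  "(real \<Rightarrow> complex) list \<Rightarrow> (complex \<Rightarrow> 'a::complex_normed_vector) \<Rightarrow> 'a"
  where "contour_sum_integral \<Gamma> F = (\<Sum>g\<leftarrow>\<Gamma>. curve_integral g F)"

definition calculus_integral ::
  "(real \<Rightarrow> complex) list \<Rightarrow> (complex \<Rightarrow> complex) \<Rightarrow>
    ('a::complex_normed_vector \<Rightarrow>\<^sub>L 'a) \<Rightarrow> ('a \<Rightarrow>\<^sub>L 'a)"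
  where "calculus_integral \<Gamma> h T =
    (1 / (2 * complex_of_real pi * \<i>)) *\<^sub>C contour_sum_integral \<Gamma> (\<lambda>z. h z *\<^sub>C resolvent T z)"

section \<open>Multicentric representation\<close>

definition lagrange_poly :: "nat \<Rightarrow> (nat \<Rightarrow> complex) \<Rightarrow> nat \<Rightarrow> complex poly"
  where "lagrange_poly d lam j =
    (\<Prod>k\<in>{1..d} - {j}. smult (1 / (lam j - lam k)) [:- lam k, 1:])"

text \<open>The components are determined by this near \<open>0\<close>: for \<open>w\<close> near \<open>0\<close>
  the equations at the \<open>d\<close> roots of \<open>p - w\<close> form a regular linear system for the values at
  \<open>w\<close>.\<close>

definition multicentric_components ::
  "complex poly \<Rightarrow> nat \<Rightarrow> (nat \<Rightarrow> complex) \<Rightarrow> (complex \<Rightarrow> complex) \<Rightarrow>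
    (nat \<Rightarrow> complex \<Rightarrow> complex) \<Rightarrow> bool"
  where "multicentric_components p d lam \<phi> f \<longleftrightarrow>
    (\<forall>j\<in>{1..d}. f j analytic_on {0}) \<and>
    (\<forall>i\<in>{1..d}. \<forall>\<^sub>F z in nhds (lam i).
      \<phi> z = (\<Sum>j=1..d. poly (lagrange_poly d lam j) z * f j (poly p z)))"

text \<open>The values \<open>b\<^sub>1\<^sub>,\<^sub>1 = p'\<close> and \<open>b\<^sub>n\<^sub>,\<^sub>m = 0\<close> for \<open>m > n\<close> follow from these equations.\<close>

fun chain_poly :: "complex poly \<Rightarrow> nat \<Rightarrow> nat \<Rightarrow> complex poly" where
  "chain_poly p 0 0 = 1"
| "chain_poly p 0 (Suc m) = 0"
| "chain_poly p (Suc n) 0 = 0"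
| "chain_poly p (Suc n) (Suc m) = chain_poly p n m * pderiv p + pderiv (chain_poly p n (Suc m))"

text \<open>\<open>multicentric_deriv p d lam \<phi> n j\<close> is the \<open>n\<close>-th derivative at \<open>0\<close> of the
  \<open>j\<close>-th component for a function \<open>\<phi>\<close> that is locally constant at the roots; hence only its
  zeroth derivatives contribute.\<close>

fun multicentric_deriv ::
  "complex poly \<Rightarrow> nat \<Rightarrow> (nat \<Rightarrow> complex) \<Rightarrow> (complex \<Rightarrow> complex) \<Rightarrow> nat \<Rightarrow> nat \<Rightarrow> complex"
  where "multicentric_deriv p d lam \<phi> n j =
    ((if n = 0 then \<phi> (lam j) else 0)
      - (\<Sum>k=1..d. \<Sum>m<n. of_nat (n choose m)
          * poly ((pderiv ^^ (n - m)) (lagrange_poly d lam k)) (lam j)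
          * (\<Sum>l\<le>m. poly (chain_poly p m l) (lam j) * multicentric_deriv p d lam \<phi> l k))
      - (\<Sum>l<n. poly (chain_poly p n l) (lam j) * multicentric_deriv p d lam \<phi> l j))
    / poly (pderiv p) (lam j) ^ n"

declare multicentric_deriv.simps [simp del]

end

theory Submission
  imports
    Defs
    "HOL-Computational_Algebra.Fundamental_Theorem_Algebra"
begin

text \<open>Let \<open>S\<close> be the operator given by the multicentric series and \<open>R(z)\<close> the resolvent of \<open>M\<close>. The
  components \<open>f\<^sub>j\<close> are holomorphic beyond the radius \<open>\<parallel>p(M)\<parallel>\<close>, so the series converges, and
  approximating \<open>\<phi>\<close> by the polynomials obtained from its partial sums shows that
  \<open>(\<phi>(z) - S) R(z)\<close>, after composition with any functional, extends holomorphically across the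
  spectrum of \<open>M\<close> to \<open>U\<^sub>1 \<union> U\<^sub>2\<close>. By Cauchy's theorem its integral over a contour in \<open>U\<^sub>1 \<union> U\<^sub>2\<close>
  vanishes, and the integral of \<open>R\<close> over a contour surrounding the spectrum is \<open>2\<pi>i\<close>; hence \<open>S = \<phi>(M)\<close>.
  With \<open>P = (S + I) / 2\<close>, the same extension shows that \<open>(I - P) R\<close> is holomorphic on \<open>U\<^sub>1\<close> and that
  \<open>P R\<close> is holomorphic off \<open>\<sigma>(A)\<close>, so that the integral of \<open>R = (I - P) R + P R\<close> over \<open>\<gamma>\<^sub>1\<close> is
  \<open>2\<pi>i P\<close>. Functionals separate points by the Hahn-Banach theorem, which reduces all contour
  integrals to complex-valued ones.\<close>

section \<open>Functionals on complex normed spaces\<close>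

text \<open>The series and the integral over \<gamma>1 are linked without deforming one contour into
  another, so no contour separating the two spectra is constructed. The link is algebraic: for a
  polynomial q, q(z) - q(M) is divisible by z - M, so (q(z) - q(M)) R(z) is a polynomial in z,
  without any singularity at the spectrum. Convergence on a level curve |p| = r inside the resolvent
  set, with the maximum modulus principle, carries this over to \<phi>(z) - S. Room for such an r
  strictly above the norm of p(M) comes from compactness of the sublevel sets of p. The main
  obstacle is holomorphy of the f_j on so large a disc: it may contain critical values of p, where
  branches of the inverse of p collide and the formula for f_j divides by p' = 0. Integrating first
  removes the division, so f_j is obtained as the derivative of a bounded fibre sum. The direct-sum
  norm governs the growth of the powers of p(M), and passing to the equivalent product norm costs
  only a constant factor there. As the contours are merely rectifiable, Cauchy's theorem is built on
  Stieltjes sums.\<close>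

definition sublinear :: "('a::real_vector \<Rightarrow> real) \<Rightarrow> bool"
  where "sublinear q \<longleftrightarrow>
    (\<forall>x y. q (x + y) \<le> q x + q y) \<and> (\<forall>r>0. \<forall>x. q (r *\<^sub>R x) = r * q x) \<and> q 0 = 0"

lemma sublinear_ge:
  assumes "sublinear q"
  shows "- q (- x) \<le> q x"
proof -
  have "q (x + - x) \<le> q x + q (- x)"
    using assms unfolding sublinear_def by blast
  then show ?thesis
    using assms by (simp add: sublinear_def)
qed

lemma sublinear_norm: "sublinear (norm :: 'a::real_normed_vector \<Rightarrow> real)"
  by (auto simp: sublinear_def norm_triangle_ineq)

text \<open>The infimum of \<open>q (x + t *\<^sub>R y) - t * q y\<close> over
  \<open>t \<ge> 0\<close> is the largest sublinear functional below \<open>q\<close> whose value at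
  \<open>- y\<close> is at most \<open>- q y\<close>. The parameters \<open>t = 0\<close> and
  \<open>t = 1\<close> give the two stated bounds.\<close>

lemma sublinear_shift:
  fixes q :: "'a::real_vector \<Rightarrow> real"
  assumes q: "sublinear q"
  obtains q' where "sublinear q'" "\<And>x. q' x \<le> q x" "\<And>x. q' x \<le> q (x + y) - q y"
proof -
  define A where "A x = (\<lambda>t. q (x + t *\<^sub>R y) - t * q y) ` {0..}" for x
  define q' where "q' x = Inf (A x)" for x
  have sub: "q (a + b) \<le> q a + q b" for a b
    using q by (auto simp: sublinear_def)
  have hom: "q (r *\<^sub>R x) = r * q x" if "r \<ge> 0" for r x
    using q that by (cases "r = 0") (auto simp: sublinear_def)
  have lb: "- q (- x) \<le> s" if s: "s \<in> A x" for s x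
  proof -
    from s obtain t where t: "t \<ge> 0" "s = q (x + t *\<^sub>R y) - t * q y"
      by (auto simp: A_def)
    have "q ((x + t *\<^sub>R y) + (- x)) \<le> q (x + t *\<^sub>R y) + q (- x)"
      by (rule sub)
    moreover have "(x + t *\<^sub>R y) + (- x) = t *\<^sub>R y"
      by simp
    ultimately have "t * q y \<le> q (x + t *\<^sub>R y) + q (- x)"
      using hom[OF t(1), of y] by simp
    then show ?thesis
      using t by simp
  qed
  have bdd: "bdd_below (A x)" for x
    using lb by (rule bdd_belowI)
  have ne: "A x \<noteq> {}" for x
    by (auto simp: A_def)
  have le: "q' x \<le> q (x + t *\<^sub>R y) - t * q y" if "t \<ge> 0" for x t
    unfolding q'_def by (rule cInf_lower) (use that bdd in \<open>auto simp: A_def\<close>)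
  have sub': "q' (x + x') \<le> q' x + q' x'" for x x'
  proof -
    have *: "q' (x + x') \<le> s + s'" if "s \<in> A x" "s' \<in> A x'" for s s'
    proof -
      from that obtain t t' where t: "t \<ge> 0" "s = q (x + t *\<^sub>R y) - t * q y"
        "t' \<ge> 0" "s' = q (x' + t' *\<^sub>R y) - t' * q y"
        by (auto simp: A_def)
      have "q' (x + x') \<le> q ((x + x') + (t + t') *\<^sub>R y) - (t + t') * q y"
        using t by (intro le) auto
      also have "(x + x') + (t + t') *\<^sub>R y = (x + t *\<^sub>R y) + (x' + t' *\<^sub>R y)"
        by (simp add: algebra_simps)
      also have "q \<dots> \<le> q (x + t *\<^sub>R y) + q (x' + t' *\<^sub>R y)"
        by (rule sub)
      finally show ?thesis
        using t by (simp add: algebra_simps)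
    qed
    have "q' (x + x') - s' \<le> q' x" if "s' \<in> A x'" for s'
      unfolding q'_def[of x] using *[OF _ that] ne by (intro cInf_greatest) (auto simp: algebra_simps)
    then have "q' (x + x') - q' x \<le> s'" if "s' \<in> A x'" for s'
      using that by (auto simp: algebra_simps)
    then have "q' (x + x') - q' x \<le> q' x'"
      unfolding q'_def[of x'] using ne by (intro cInf_greatest)
    then show ?thesis
      by simp
  qed
  have half: "q' (r *\<^sub>R x) \<le> r * q' x" if "r > 0" for r x
  proof -
    have "q' (r *\<^sub>R x) / r \<le> s" if "s \<in> A x" for s
    proof -
      from that obtain t where t: "t \<ge> 0" "s = q (x + t *\<^sub>R y) - t * q y"
        by (auto simp: A_def)
      have "q' (r *\<^sub>R x) \<le> q (r *\<^sub>R x + (r * t) *\<^sub>R y) - (r * t) * q y"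
        using t \<open>r > 0\<close> by (intro le) auto
      also have "r *\<^sub>R x + (r * t) *\<^sub>R y = r *\<^sub>R (x + t *\<^sub>R y)"
        by (simp add: scaleR_add_right)
      also have "q (r *\<^sub>R (x + t *\<^sub>R y)) - (r * t) * q y = r * s"
        using t \<open>r > 0\<close> by (simp add: hom right_diff_distrib)
      finally show ?thesis
        using \<open>r > 0\<close> by (simp add: field_simps)
    qed
    then have "q' (r *\<^sub>R x) / r \<le> q' x"
      unfolding q'_def[of x] using ne by (intro cInf_greatest)
    then show ?thesis
      using that by (simp add: field_simps)
  qed
  have "q' (r *\<^sub>R x) = r * q' x" if "r > 0" for r x
    using half[OF that, of x] half[of "inverse r" "r *\<^sub>R x"] that by (simp add: field_simps)
  moreover have "q' 0 = 0"
    using le[of 0 0] q half[of 2 0] by (simp add: sublinear_def)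
  ultimately have "sublinear q'"
    using sub' by (auto simp: sublinear_def)
  moreover have "q' x \<le> q x" for x
    using le[of 0 x] by simp
  moreover have "q' x \<le> q (x + y) - q y" for x
    using le[of 1 x] by simp
  ultimately show thesis
    by (rule that)
qed

text \<open>The pointwise infimum is finite because every sublinear \<open>q \<le> u\<close>
  satisfies \<open>- u (- x) \<le> q x\<close>. It is subadditive because of two members of a chain
  the smaller one can serve for both summands.\<close>

lemma sublinear_Inf_chain:
  fixes C :: "('a::real_vector \<Rightarrow> real) set"
  assumes C: "C \<noteq> {}" "\<And>q. q \<in> C \<Longrightarrow> sublinear q"
    and chain: "\<And>q r. q \<in> C \<Longrightarrow> r \<in> C \<Longrightarrow> q \<le> r \<or> r \<le> q"
    and u: "sublinear u" "\<And>q. q \<in> C \<Longrightarrow> q \<le> u"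
  obtains m where "sublinear m" "\<And>q. q \<in> C \<Longrightarrow> m \<le> q"
proof -
  define m where "m x = (INF q\<in>C. q x)" for x
  have lb: "- u (- x) \<le> q x" if "q \<in> C" for q x
    using sublinear_ge[OF C(2)[OF that], of x] le_funD[OF u(2)[OF that], of "- x"] by linarith
  have bdd: "bdd_below ((\<lambda>q. q x) ` C)" for x
    using lb by (intro bdd_belowI2)
  have le: "m x \<le> q x" if "q \<in> C" for q x
    unfolding m_def using bdd that by (rule cINF_lower)
  have ge: "a \<le> m x" if "\<And>q. q \<in> C \<Longrightarrow> a \<le> q x" for a x
    unfolding m_def using C(1) that by (rule cINF_greatest)
  have sub: "m (x + y) \<le> m x + m y" for x y
  proof -
    have *: "m (x + y) \<le> q x + r y" if "q \<in> C" "r \<in> C" for q r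
      using chain[OF that]
    proof
      assume "q \<le> r"
      then show ?thesis
        using le[OF that(1), of "x + y"] C(2)[OF that(1)] unfolding sublinear_def le_fun_def
        by (smt (verit))
    next
      assume "r \<le> q"
      then show ?thesis
        using le[OF that(2), of "x + y"] C(2)[OF that(2)] unfolding sublinear_def le_fun_def
        by (smt (verit))
    qed
    have "m (x + y) - r y \<le> m x" if "r \<in> C" for r
      using *[OF _ that] by (intro ge) (simp add: algebra_simps)
    then have "m (x + y) - m x \<le> m y"
      by (intro ge) (simp add: algebra_simps)
    then show ?thesis by simp
  qed
  have half: "m (r *\<^sub>R x) \<le> r * m x" if "r > 0" for r x
  proof -
    have "m (r *\<^sub>R x) / r \<le> m x"
      using le[of _ "r *\<^sub>R x"] that C(2)
      by (intro ge) (simp add: sublinear_def field_simps)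
    then show ?thesis
      using that by (simp add: field_simps)
  qed
  have "m (r *\<^sub>R x) = r * m x" if "r > 0" for r x
    using half[OF that, of x] half[of "inverse r" "r *\<^sub>R x"] that by (simp add: field_simps)
  moreover have "(\<lambda>q. q 0) ` C = (\<lambda>_. 0) ` C"
    by (intro image_cong) (use C(2) in \<open>auto simp: sublinear_def\<close>)
  then have "m 0 = 0"
    using C(1) by (simp add: m_def)
  ultimately have "sublinear m"
    using sub by (auto simp: sublinear_def)
  then show thesis
    using le that by (auto simp: le_fun_def)
qed

text \<open>A minimal sublinear functional is linear: replacing \<open>q\<close> by its shift in direction \<open>y\<close>
  cannot make it smaller, which forces \<open>q x + q y \<le> q (x + y)\<close>.\<close>

lemma Hahn_Banach_real:
  fixes v :: "'a::real_normed_vector"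
  assumes "v \<noteq> 0"
  obtains f :: "'a \<Rightarrow> real" where "bounded_linear f" "f v \<noteq> 0"
proof -
  \<comment> \<open>Minimizing below the shift of the norm in direction \<open>v\<close>, rather
    than below the norm, forces \<open>q (- v) \<le> - norm v\<close> for the resulting linear
    \<open>q\<close>, hence \<open>q v \<noteq> 0\<close>.\<close>
  obtain u where u: "sublinear u" "\<And>x. u x \<le> norm x" "\<And>x. u x \<le> norm (x + v) - norm v"
    using sublinear_shift[OF sublinear_norm] by blast
  \<comment> \<open>The order is reversed: chains are bounded by their infimum, and a maximal
    element of \<open>R\<close> is a minimal sublinear functional.\<close>
  define R where "R = {(q, r). sublinear q \<and> q \<le> u \<and> sublinear r \<and> r \<le> u \<and> r \<le> q}"
  have fld: "q \<in> Field R \<longleftrightarrow> sublinear q \<and> q \<le> u" for q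
    by (auto simp: Field_def R_def)
  have po: "Partial_order R"
    by (auto simp: partial_order_on_def preorder_on_def refl_on_def fld trans_def antisym_def)
      (auto simp: R_def Field_def)
  have "\<exists>m\<in>Field R. \<forall>q\<in>C. (q, m) \<in> R" if "C \<in> Chains R" for C
  proof (cases "C = {}")
    case True
    then show ?thesis
      using u(1) by (auto simp: fld intro!: bexI[of _ u])
  next
    case False
    have C: "sublinear q" "q \<le> u" if "q \<in> C" for q
      using that \<open>C \<in> Chains R\<close> by (auto simp: Chains_def R_def)
    have "q \<le> r \<or> r \<le> q" if "q \<in> C" "r \<in> C" for q r
      using that \<open>C \<in> Chains R\<close> by (auto simp: Chains_def R_def)
    then obtain m where m: "sublinear m" "\<And>q. q \<in> C \<Longrightarrow> m \<le> q"
      using sublinear_Inf_chain[OF False C(1) _ u(1) C(2)] by blast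
    then have "m \<le> u"
      using False C(2) by (meson all_not_in_conv order_trans)
    then have "m \<in> Field R"
      using m by (simp add: fld)
    moreover have "\<forall>q\<in>C. (q, m) \<in> R"
      using m C \<open>m \<le> u\<close> by (simp add: R_def)
    ultimately show ?thesis
      by (intro bexI[of _ m])
  qed
  then obtain q where q: "q \<in> Field R" "\<And>r. r \<in> Field R \<Longrightarrow> (q, r) \<in> R \<Longrightarrow> r = q"
    using Zorns_po_lemma[OF po] by blast
  then have sq: "sublinear q" and qu: "q \<le> u"
    by (auto simp: fld)
  have min: "r = q" if r: "sublinear r" "\<And>x. r x \<le> q x" for r
  proof (rule q(2))
    have "r \<le> q"
      using r(2) by (rule le_funI)
    then show "r \<in> Field R" "(q, r) \<in> R"
      using r(1) sq qu order_trans[OF _ qu] by (simp only: fld, simp add: R_def)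
  qed
  have add: "q (x + y) = q x + q y" for x y
  proof -
    obtain q' where q': "sublinear q'" "\<And>x. q' x \<le> q x" "\<And>x. q' x \<le> q (x + y) - q y"
      using sublinear_shift[OF sq] by blast
    have "q' = q"
      using q' by (intro min)
    then show ?thesis
      using q'(3)[of x] sq by (auto simp: sublinear_def intro: antisym)
  qed
  have neg: "q (- x) = - q x" for x
    using add[of x "- x"] sq by (simp add: sublinear_def)
  have hom: "q (r *\<^sub>R x) = r * q x" for r x
  proof -
    consider "r > 0" | "r = 0" | "r < 0" by linarith
    then show ?thesis
    proof cases
      case 3
      then have "q ((- r) *\<^sub>R x) = (- r) * q x"
        using sq by (simp only: sublinear_def neg_0_less_iff_less)
      then show ?thesis
        using neg[of "(- r) *\<^sub>R x"] by simp
    qed (use sq in \<open>auto simp: sublinear_def\<close>)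
  qed
  have le: "q x \<le> norm x" for x
    using qu u(2)[of x] by (auto simp: le_fun_def intro: order_trans)
  have "bounded_linear q"
  proof (rule bounded_linear_intro[where K = 1])
    show "norm (q x) \<le> norm x * 1" for x
      using le[of x] le[of "- x"] neg[of x] by (auto simp: abs_le_iff)
  qed (auto simp: add hom)
  moreover have "q (- v) \<le> - norm v"
    using le_funD[OF qu, of "- v"] u(3)[of "- v"] by simp
  then have "q (- v) < 0"
    using assms zero_less_norm_iff[of v] by linarith
  then have "q v \<noteq> 0"
    by (simp add: neg)
  ultimately show thesis
    by (rule that)
qed

section \<open>Complex-linear functionals and separation of points\<close>

lemma scaleC_one [simp]: "1 *\<^sub>C (x::'a::complex_normed_vector) = x"
  using scaleC_of_real[of 1 x] by simp

lemma bounded_bilinear_scaleC: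
  "bounded_bilinear (\<lambda>c (x::'a::complex_normed_vector). c *\<^sub>C x)"
proof
  show "\<exists>K. \<forall>a (b::'a). norm (a *\<^sub>C b) \<le> norm a * norm b * K"
    by (rule exI[of _ 1]) (simp add: norm_scaleC)
next
  fix r :: real and a :: complex and b :: 'a
  show "(r *\<^sub>R a) *\<^sub>C b = r *\<^sub>R (a *\<^sub>C b)"
    by (simp add: scaleR_conv_of_real scaleC_scaleC flip: scaleC_of_real)
  show "a *\<^sub>C (r *\<^sub>R b) = r *\<^sub>R (a *\<^sub>C b)"
    by (simp add: scaleC_scaleC mult.commute flip: scaleC_of_real)
qed (simp_all add: scaleC_add_left scaleC_add_right)

interpretation scaleC: bounded_bilinear "\<lambda>c (x::'a::complex_normed_vector). c *\<^sub>C x"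
  by (rule bounded_bilinear_scaleC)

definition complex_functional :: "('a::complex_normed_vector \<Rightarrow> complex) \<Rightarrow> bool"
  where "complex_functional l \<longleftrightarrow> bounded_linear l \<and> (\<forall>c x. l (c *\<^sub>C x) = c * l x)"

lemma complex_functional_separates:
  fixes v :: "'a::complex_normed_vector"
  assumes "\<And>l. complex_functional l \<Longrightarrow> l v = 0"
  shows "v = 0"
proof (rule ccontr)
  assume "v \<noteq> 0"
  then obtain f :: "'a \<Rightarrow> real" where f: "bounded_linear f" "f v \<noteq> 0"
    by (rule Hahn_Banach_real)
  interpret f: bounded_linear f by (rule f)
  \<comment> \<open>The complex-linear functional with real part \<open>f\<close>.\<close>
  define l where "l x = complex_of_real (f x) - \<i> * complex_of_real (f (\<i> *\<^sub>C x))" for x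
  have "bounded_linear l"
    unfolding l_def
    by (intro bounded_linear_sub bounded_linear_compose[OF bounded_linear_mult_right]
        bounded_linear_compose[OF bounded_linear_of_real]
        bounded_linear_compose[OF f(1)] f(1) bounded_linear_scaleC)
  moreover have "l (c *\<^sub>C x) = c * l x" for c x
  proof -
    have r: "f (complex_of_real r *\<^sub>C y) = r * f y" for r y
      by (simp add: scaleC_of_real f.scaleR)
    have "c = complex_of_real (Re c) + complex_of_real (Im c) * \<i>"
      by (simp add: complex_eq_iff)
    then have "c *\<^sub>C x = (complex_of_real (Re c) + complex_of_real (Im c) * \<i>) *\<^sub>C x"
      by (rule arg_cong)
    then have d: "c *\<^sub>C x = complex_of_real (Re c) *\<^sub>C x + complex_of_real (Im c) *\<^sub>C (\<i> *\<^sub>C x)"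
      by (simp only: scaleC_add_left scaleC_scaleC)
    have "\<i> * c = complex_of_real (Re c) * \<i> + complex_of_real (- Im c)"
      by (simp add: complex_eq_iff)
    then have "(\<i> * c) *\<^sub>C x = (complex_of_real (Re c) * \<i> + complex_of_real (- Im c)) *\<^sub>C x"
      by (rule arg_cong)
    then have "\<i> *\<^sub>C (c *\<^sub>C x)
        = complex_of_real (Re c) *\<^sub>C (\<i> *\<^sub>C x) + complex_of_real (- Im c) *\<^sub>C x"
      by (simp only: scaleC_add_left scaleC_scaleC)
    then have "f (\<i> *\<^sub>C (c *\<^sub>C x)) = Re c * f (\<i> *\<^sub>C x) - Im c * f x"
      by (simp only: f.add r minus_mult_left[symmetric] diff_conv_add_uminus)
    moreover have "f (c *\<^sub>C x) = Re c * f x + Im c * f (\<i> *\<^sub>C x)"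
      by (simp only: d f.add r)
    ultimately show ?thesis
      by (simp add: l_def complex_eq_iff algebra_simps)
  qed
  ultimately have "l v = 0"
    using assms by (auto simp: complex_functional_def)
  then show False
    using f(2) by (simp add: l_def complex_eq_iff)
qed

text \<open>Scalar integrands thereby fall under \<open>has_curve_integral\<close>, and a functional
  becomes a linear map between spaces of the same class, through which integrals can be
  pushed.\<close>

instantiation complex :: complex_normed_vector
begin

definition scaleC_complex :: "complex \<Rightarrow> complex \<Rightarrow> complex"
  where [simp]: "scaleC_complex c x = c * x"

instance
  by standard (simp_all add: algebra_simps norm_mult scaleR_conv_of_real)

end

instance complex :: complex_banach ..

section \<open>Stieltjes integrals along rectifiable curves\<close>

text \<open>Any majorant \<open>v\<close> of the increments takes the place of the total variation:
  its increments telescope over a division, so that sums along \<open>g\<close> are bounded by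
  multiples of \<open>v 1 - v 0\<close>.\<close>

definition variation_bound :: "(real \<Rightarrow> complex) \<Rightarrow> (real \<Rightarrow> real) \<Rightarrow> bool"
  where "variation_bound g v \<longleftrightarrow>
    (\<forall>a b. 0 \<le> a \<longrightarrow> a \<le> b \<longrightarrow> b \<le> 1 \<longrightarrow> norm (g b - g a) \<le> v b - v a)"

lemma variation_boundD:
  assumes "variation_bound g v" "0 \<le> a" "a \<le> b" "b \<le> 1"
  shows "norm (g b - g a) \<le> v b - v a" "v a \<le> v b"
proof -
  show *: "norm (g b - g a) \<le> v b - v a"
    using assms by (simp add: variation_bound_def)
  show "v a \<le> v b"
    using order_trans[OF norm_ge_zero *] by simp
qed

text \<open>The choice of tolerance in all estimates below; \<open>V\<close> is a variation and may
  be \<open>0\<close>, which the \<open>+ 1\<close> takes care of.\<close>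

lemma divide_add_one_bounds:
  fixes e V :: real
  assumes "e > 0" "V \<ge> 0"
  shows "0 < e / (V + 1)" "e / (V + 1) * V < e"
  using assms by (simp_all add: field_simps)

text \<open>The majorant is the arc length up to \<open>t\<close>, the supremum of polygonal lengths
  over divisions of \<open>{0..t}\<close>. It dominates increments because a division of
  \<open>{0..a}\<close> is prolonged by the interval \<open>{a..b}\<close>.\<close>

lemma rectifiable_variation_bound:
  assumes "rectifiable_closed_curve g"
  obtains v where "variation_bound g v"
proof -
  define S where "S D = (\<Sum>k\<in>D. dist (g (Inf k)) (g (Sup k)))" for D
  obtain L where L: "\<And>D. D division_of {0..1} \<Longrightarrow> S D \<le> L"
    using assms unfolding rectifiable_closed_curve_def S_def by blast
  define v where "v t = (SUP D\<in>{D. D division_of {0..t}}. S D)" for t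
  have join: "D \<union> {{a..b}} division_of {0..b}"
    if "D division_of {0..a}" "0 \<le> a" "a < b" for D and a b :: real
  proof -
    have "cbox a b \<noteq> {}"
      using \<open>a < b\<close> by simp
    from division_of_self[OF this] have "{{a..b}} division_of {a..b}"
      by (simp only: box_real)
    then have "D \<union> {{a..b}} division_of ({0..a} \<union> {a..b})"
      by (intro division_disjoint_union that) auto
    then show ?thesis
      using that by (simp add: ivl_disj_un_two_touch)
  qed
  have bound: "S D \<le> L" if "D division_of {0..t}" "0 \<le> t" "t \<le> 1" for D t
  proof (cases "t = 1")
    case False
    then have *: "D \<union> {{t..1}} division_of {0..1}"
      using that by (intro join) auto
    have "S D \<le> S (D \<union> {{t..1}})"
      unfolding S_def using division_of_finite[OF *] by (intro sum_mono2) auto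
    then show ?thesis
      using L[OF *] by simp
  qed (use L that in auto)
  have bdd: "bdd_above (S ` {D. D division_of {0..t}})" if "0 \<le> t" "t \<le> 1" for t
    using bound that by (intro bdd_aboveI2[of _ _ L]) auto
  have "norm (g b - g a) \<le> v b - v a" if "0 \<le> a" "a < b" "b \<le> 1" for a b
  proof -
    have "S D \<le> v b - norm (g b - g a)" if D: "D division_of {0..a}" for D
    proof -
      have notin: "{a..b} \<notin> D"
        using division_ofD(2)[OF D, of "{a..b}"] \<open>a < b\<close> \<open>0 \<le> a\<close> by auto
      have "S D + norm (g b - g a) = S (D \<union> {{a..b}})"
        using division_of_finite[OF D] notin \<open>a < b\<close>
        by (simp add: S_def dist_norm norm_minus_commute)
      also have "\<dots> \<le> v b"
        unfolding v_def
        using join[OF D \<open>0 \<le> a\<close> \<open>a < b\<close>] \<open>0 \<le> a\<close> \<open>a < b\<close> \<open>b \<le> 1\<close> by (intro cSUP_upper bdd) auto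
      finally show ?thesis by simp
    qed
    moreover have "{D. D division_of {0..a}} \<noteq> {}"
      using elementary_interval[of 0 a] by auto
    ultimately have "v a \<le> v b - norm (g b - g a)"
      unfolding v_def[of a] by (intro cSUP_least) auto
    then show ?thesis by simp
  qed
  then have "variation_bound g v"
    unfolding variation_bound_def by (metis cancel_comm_monoid_add_class.diff_cancel
        less_eq_real_def norm_zero order_refl)
  then show thesis
    by (rule that)
qed

section \<open>Stieltjes sums and the comparison of two divisions\<close>

definition stieltjes_sum ::
  "(real \<Rightarrow> complex) \<Rightarrow> (complex \<Rightarrow> 'a::complex_normed_vector) \<Rightarrow> (real \<times> real set) set \<Rightarrow> 'a"
  where "stieltjes_sum g F D = (\<Sum>(t, k)\<in>D. (g (Sup k) - g (Inf k)) *\<^sub>C F (g t))"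

lemma tagged_division_interval:
  assumes "D tagged_division_of {0..1::real}" "(t, k) \<in> D"
  obtains a b where "k = {a..b}" "0 \<le> a" "a \<le> b" "b \<le> 1" "t \<in> k" "t \<in> {0..1}"
proof -
  obtain a b where "k = {a..b}"
    using tagged_division_ofD(4)[OF assms] by auto
  moreover have "t \<in> k" "k \<subseteq> {0..1}"
    using tagged_division_ofD(2,3)[OF assms] by auto
  ultimately show thesis
    using that[of a b] by auto
qed

definition clamp_to :: "real set \<Rightarrow> real \<Rightarrow> real"
  where "clamp_to k x = max (Inf k) (min (Sup k) x)"

text \<open>Clamping gives a meaning to every pair of intervals, with value \<open>0\<close> for
  disjoint ones. Double sums can therefore run over all pairs from two divisions, and no common
  refinement has to be built as a division.\<close>

definition overlap_increment :: "(real \<Rightarrow> 'b::ab_group_add) \<Rightarrow> real set \<Rightarrow> real set \<Rightarrow> 'b"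
  where "overlap_increment f k l = f (clamp_to k (Sup l)) - f (clamp_to k (Inf l))"

text \<open>Additivity over a division, applied to \<open>f\<close> after the clamp, which sends
  \<open>0\<close> and \<open>1\<close> to the end points of \<open>k\<close>.\<close>

lemma sum_overlap_increment:
  fixes f :: "real \<Rightarrow> 'b::real_normed_vector"
  assumes "D tagged_division_of {0..1}" "k = {a..b}" "0 \<le> a" "a \<le> b" "b \<le> 1"
  shows "(\<Sum>(t, l)\<in>D. overlap_increment f k l) = f (Sup k) - f (Inf k)"
  using additive_tagged_division_1[OF _ assms(1), of "\<lambda>x. f (clamp_to k x)"] assms(2-)
  by (simp add: clamp_to_def overlap_increment_def)

lemma overlap_increment_commute:
  assumes "k = {a..b}" "a \<le> b" "l = {c..d}" "c \<le> d"
  shows "overlap_increment f k l = overlap_increment f l k"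
  using assms by (auto simp: overlap_increment_def clamp_to_def max_def min_def)

lemma overlap_increment_disjoint:
  assumes "k = {a..b}" "a \<le> b" "l = {c..d}" "c \<le> d" "k \<inter> l = {}"
  shows "overlap_increment f k l = 0"
proof -
  have "b < c \<or> d < a"
  proof (rule ccontr)
    assume "\<not> (b < c \<or> d < a)"
    then have "max a c \<in> k \<inter> l"
      using assms by auto
    then show False
      using assms by simp
  qed
  then show ?thesis
    using assms by (auto simp: overlap_increment_def clamp_to_def max_def min_def)
qed

text \<open>Both sums are refined to the pairwise intersections \<open>k \<inter> l\<close>; the increment of \<open>g\<close> over
  such an intersection is the increment between the clamped end points of \<open>l\<close>.\<close>

lemma stieltjes_sum_diff_le:
  fixes F :: "complex \<Rightarrow> 'a::complex_normed_vector"
  assumes g: "variation_bound g v"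
    and D: "D tagged_division_of {0..1}" and E: "E tagged_division_of {0..1}"
    and osc: "\<And>t k s l. (t, k) \<in> D \<Longrightarrow> (s, l) \<in> E \<Longrightarrow> k \<inter> l \<noteq> {} \<Longrightarrow>
      norm (F (g t) - F (g s)) \<le> e"
  shows "norm (stieltjes_sum g F D - stieltjes_sum g F E) \<le> e * (v 1 - v 0)"
proof -
  let ?d = overlap_increment
  have d1: "(\<Sum>(s, l)\<in>E. ?d h k l) = h (Sup k) - h (Inf k)" if tk: "(t, k) \<in> D"
    for h :: "real \<Rightarrow> complex" and t k
    using tagged_division_interval[OF D tk] sum_overlap_increment[OF E] by metis
  have d1': "(\<Sum>(s, l)\<in>E. ?d v k l) = v (Sup k) - v (Inf k)" if tk: "(t, k) \<in> D" for t k
    using tagged_division_interval[OF D tk] sum_overlap_increment[OF E] by metis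
  have d2: "(\<Sum>(t, k)\<in>D. ?d g k l) = g (Sup l) - g (Inf l)" if sl: "(s, l) \<in> E" for s l
  proof -
    obtain a b where l: "l = {a..b}" "0 \<le> a" "a \<le> b" "b \<le> 1"
      using tagged_division_interval[OF E sl] by metis
    have "(\<Sum>(t, k)\<in>D. ?d g k l) = (\<Sum>(t, k)\<in>D. ?d g l k)"
    proof (intro sum.cong refl, clarify)
      fix t k assume "(t, k) \<in> D"
      then obtain a' b' where "k = {a'..b'}" "a' \<le> b'"
        using tagged_division_interval[OF D] by metis
      then show "?d g k l = ?d g l k"
        using l by (intro overlap_increment_commute)
    qed
    then show ?thesis
      using l by (simp add: sum_overlap_increment[OF D])
  qed
  have "stieltjes_sum g F D = (\<Sum>(t, k)\<in>D. \<Sum>(s, l)\<in>E. ?d g k l *\<^sub>C F (g t))"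
    unfolding stieltjes_sum_def
    by (intro sum.cong refl)
      (auto simp: split_def scaleC.sum_left[symmetric] d1[unfolded split_def])
  moreover have "stieltjes_sum g F E = (\<Sum>(s, l)\<in>E. \<Sum>(t, k)\<in>D. ?d g k l *\<^sub>C F (g s))"
    unfolding stieltjes_sum_def
    by (intro sum.cong refl)
      (auto simp: split_def scaleC.sum_left[symmetric] d2[unfolded split_def])
  then have "stieltjes_sum g F E = (\<Sum>(t, k)\<in>D. \<Sum>(s, l)\<in>E. ?d g k l *\<^sub>C F (g s))"
    by (simp add: split_def sum.swap[of _ E D])
  ultimately have "stieltjes_sum g F D - stieltjes_sum g F E
      = (\<Sum>(t, k)\<in>D. \<Sum>(s, l)\<in>E. ?d g k l *\<^sub>C (F (g t) - F (g s)))"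
    by (simp add: split_def sum_subtractf scaleC.diff_right)
  also have "norm \<dots> \<le> (\<Sum>(t, k)\<in>D. \<Sum>(s, l)\<in>E. e * ?d v k l)"
    unfolding split_def
  proof (intro sum_norm_le)
    fix x y assume "x \<in> D" "y \<in> E"
    obtain t k s l where xy: "x = (t, k)" "y = (s, l)"
      by (cases x, cases y)
    obtain a b where k: "k = {a..b}" "0 \<le> a" "a \<le> b" "b \<le> 1"
      using tagged_division_interval[OF D, of t k] \<open>x \<in> D\<close> xy by metis
    obtain a' b' where l: "l = {a'..b'}" "0 \<le> a'" "a' \<le> b'" "b' \<le> 1"
      using tagged_division_interval[OF E, of s l] \<open>y \<in> E\<close> xy by metis
    have "norm (?d g k l *\<^sub>C (F (g t) - F (g s))) \<le> e * ?d v k l"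
    proof (cases "k \<inter> l = {}")
      case True
      then show ?thesis
        using k l by (simp add: overlap_increment_disjoint scaleC.zero_left)
    next
      case False
      then have "norm (F (g t) - F (g s)) \<le> e"
        using osc \<open>x \<in> D\<close> \<open>y \<in> E\<close> xy by blast
      moreover have "norm (?d g k l) \<le> ?d v k l"
        unfolding overlap_increment_def using k l by (intro variation_boundD[OF g]) (auto simp: clamp_to_def)
      ultimately have "norm (?d g k l) * norm (F (g t) - F (g s)) \<le> ?d v k l * e"
        by (intro mult_mono) (auto intro: order_trans[OF norm_ge_zero])
      then show ?thesis
        by (simp add: norm_scaleC mult.commute)
    qed
    then show "norm (?d g (snd x) (snd y) *\<^sub>C (F (g (fst x)) - F (g (fst y))))
        \<le> e * ?d v (snd x) (snd y)"
      by (simp add: xy)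
  qed
  also have "\<dots> = e * (\<Sum>(t, k)\<in>D. v (Sup k) - v (Inf k))"
    unfolding sum_distrib_left
    by (intro sum.cong refl)
      (auto simp: split_def sum_distrib_left[symmetric] d1'[unfolded split_def])
  also have "(\<Sum>(t, k)\<in>D. v (Sup k) - v (Inf k)) = v 1 - v 0"
    by (intro additive_tagged_division_1 D) simp
  finally show ?thesis .
qed

section \<open>The integral as a limit along refining meshes\<close>

definition mesh_below :: "real \<Rightarrow> (real \<times> real set) set \<Rightarrow> bool"
  where "mesh_below \<delta> D \<longleftrightarrow> D tagged_division_of {0..1} \<and> (\<lambda>t. ball t \<delta>) fine D"

text \<open>The tags of two overlapping intervals are each within \<open>\<delta> / 2\<close> of a
  common point, hence within \<open>\<delta>\<close> of each other.\<close>

lemma stieltjes_sum_close: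
  fixes F :: "complex \<Rightarrow> 'a::complex_normed_vector"
  assumes g: "variation_bound g v"
    and D: "mesh_below (\<delta> / 2) D" and E: "mesh_below (\<delta> / 2) E"
    and osc: "\<And>s t. s \<in> {0..1} \<Longrightarrow> t \<in> {0..1} \<Longrightarrow> dist s t < \<delta> \<Longrightarrow> norm (F (g s) - F (g t)) \<le> e"
  shows "norm (stieltjes_sum g F D - stieltjes_sum g F E) \<le> e * (v 1 - v 0)"
proof (rule stieltjes_sum_diff_le[OF g])
  show DE: "D tagged_division_of {0..1}" "E tagged_division_of {0..1}"
    using D E by (simp_all add: mesh_below_def)
  fix t k s l assume *: "(t, k) \<in> D" "(s, l) \<in> E" "k \<inter> l \<noteq> {}"
  then obtain x where "x \<in> k" "x \<in> l" by blast
  then have "dist t x < \<delta> / 2" "dist s x < \<delta> / 2"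
    using fineD[OF _ *(1)] fineD[OF _ *(2)] D E by (fastforce simp: mesh_below_def)+
  then have "dist t s < \<delta>"
    using dist_triangle_less_add[of t x "\<delta> / 2" s "\<delta> / 2"] by simp
  moreover have "t \<in> {0..1}" "s \<in> {0..1}"
    using tagged_division_interval[OF DE(1) *(1)] tagged_division_interval[OF DE(2) *(2)] by metis+
  ultimately show "norm (F (g t) - F (g s)) \<le> e"
    using osc by blast
qed

lemma mesh_below_exists: "\<delta> > 0 \<Longrightarrow> \<exists>D. mesh_below \<delta> D"
  using fine_division_exists_real[of "\<lambda>t. ball t \<delta>" 0 1] unfolding mesh_below_def
  by (metis gauge_ball)

lemma mesh_below_mono:
  assumes "mesh_below \<delta> D" "\<delta> \<le> \<delta>'"
  shows "mesh_below \<delta>' D"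
  using assms(1) subset_ball[OF assms(2)] unfolding mesh_below_def fine_def by blast

text \<open>As a filter, the limit for vanishing mesh is accessible to the general rules on limits,
  on completeness through Cauchy filters and on uniform limits.\<close>

definition mesh_filter :: "(real \<times> real set) set filter"
  where "mesh_filter = (INF \<delta>\<in>{0<..}. principal {D. mesh_below \<delta> D})"

lemma eventually_mesh_filter:
  "eventually P mesh_filter \<longleftrightarrow> (\<exists>\<delta>>0. \<forall>D. mesh_below \<delta> D \<longrightarrow> P D)"
proof -
  have "\<exists>x\<in>{0<..}. principal {D. mesh_below x D}
      \<le> inf (principal {D. mesh_below a D}) (principal {D. mesh_below b D})"
    if "a \<in> {0<..}" "b \<in> {0<..}" for a b
    using that by (intro bexI[of _ "min a b"]) (auto intro: mesh_below_mono)
  then have "eventually P mesh_filter \<longleftrightarrow>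
      (\<exists>\<delta>\<in>{0<..}. eventually P (principal {D. mesh_below \<delta> D}))"
    unfolding mesh_filter_def by (intro eventually_INF_base) auto
  then show ?thesis
    by (simp add: eventually_principal Bex_def)
qed

lemma eventually_mesh_below: "\<delta> > 0 \<Longrightarrow> \<forall>\<^sub>F D in mesh_filter. mesh_below \<delta> D"
  unfolding eventually_mesh_filter by blast

lemma mesh_filter_neq_bot [simp]: "mesh_filter \<noteq> bot"
  using mesh_below_exists unfolding trivial_limit_def eventually_mesh_filter by blast

lemma has_curve_integral_iff_tendsto:
  "has_curve_integral F I g \<longleftrightarrow> (stieltjes_sum g F \<longlongrightarrow> I) mesh_filter"
  by (simp add: has_curve_integral_def stieltjes_sum_def tendsto_iff eventually_mesh_filter
      dist_norm mesh_below_def)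

text \<open>The limit in the second division of \<open>stieltjes_sum_close\<close>. As the error
  depends on \<open>F\<close> only through a modulus of continuity along \<open>g\<close>, it is
  uniform over families of integrands that share one.\<close>

lemma stieltjes_sum_error:
  assumes g: "variation_bound g v" and I: "has_curve_integral F I g" and "\<delta> > 0"
    and D: "mesh_below (\<delta> / 2) D"
    and osc: "\<And>s t. s \<in> {0..1} \<Longrightarrow> t \<in> {0..1} \<Longrightarrow> dist s t < \<delta> \<Longrightarrow> norm (F (g s) - F (g t)) \<le> e"
  shows "norm (stieltjes_sum g F D - I) \<le> e * (v 1 - v 0)"
proof (rule tendsto_upperbound)
  show "((\<lambda>E. norm (stieltjes_sum g F D - stieltjes_sum g F E)) \<longlongrightarrow> norm (stieltjes_sum g F D - I))
      mesh_filter"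
    using I by (intro tendsto_intros) (simp add: has_curve_integral_iff_tendsto)
  have "\<forall>\<^sub>F E in mesh_filter. mesh_below (\<delta> / 2) E"
    using \<open>\<delta> > 0\<close> by (intro eventually_mesh_below) simp
  then show "\<forall>\<^sub>F E in mesh_filter.
      norm (stieltjes_sum g F D - stieltjes_sum g F E) \<le> e * (v 1 - v 0)"
    by (rule eventually_mono) (use osc in \<open>auto intro: stieltjes_sum_close[OF g D]\<close>)
qed simp

lemma curve_integral_exists:
  fixes F :: "complex \<Rightarrow> 'a::complex_banach"
  assumes g: "rectifiable_closed_curve g" and F: "continuous_on (path_image g) F"
  obtains I where "has_curve_integral F I g"
proof -
  obtain v where v: "variation_bound g v"
    using rectifiable_variation_bound[OF g] .
  define V where "V = v 1 - v 0"
  have "V \<ge> 0"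
    unfolding V_def using variation_boundD(2)[OF v, of 0 1] by simp
  have "continuous_on {0..1} (\<lambda>t. F (g t))"
    using g F by (intro continuous_on_compose2[OF F])
      (auto simp: rectifiable_closed_curve_def path_def path_image_def)
  then have uc: "uniformly_continuous_on {0..1} (\<lambda>t. F (g t))"
    by (rule compact_uniformly_continuous) simp
  have "cauchy_filter (filtermap (stieltjes_sum g F) mesh_filter)"
    unfolding cauchy_filter_metric_filtermap
  proof (intro allI impI)
    fix e :: real assume "e > 0"
    define e' where "e' = e / (V + 1)"
    have e': "e' > 0" "e' * V < e"
      unfolding e'_def by (intro divide_add_one_bounds \<open>e > 0\<close> \<open>V \<ge> 0\<close>)+
    then obtain \<delta> where \<delta>: "\<delta> > 0"
      "\<And>s t. s \<in> {0..1} \<Longrightarrow> t \<in> {0..1} \<Longrightarrow> dist s t < \<delta> \<Longrightarrow> norm (F (g s) - F (g t)) \<le> e'"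
      using uc unfolding uniformly_continuous_on_def by (metis dist_norm less_imp_le)
    have "dist (stieltjes_sum g F D) (stieltjes_sum g F E) < e"
      if "mesh_below (\<delta> / 2) D" "mesh_below (\<delta> / 2) E" for D E
    proof -
      have "dist (stieltjes_sum g F D) (stieltjes_sum g F E) \<le> e' * V"
        unfolding dist_norm V_def using \<delta>(2) by (intro stieltjes_sum_close[OF v that])
      then show ?thesis
        using e'(2) by simp
    qed
    then show "\<exists>P. eventually P mesh_filter \<and>
        (\<forall>D E. P D \<and> P E \<longrightarrow> dist (stieltjes_sum g F D) (stieltjes_sum g F E) < e)"
      using eventually_mesh_below[of "\<delta> / 2"] \<delta>(1) by (intro exI[of _ "mesh_below (\<delta> / 2)"]) auto
  qed
  then have "\<exists>I. filtermap (stieltjes_sum g F) mesh_filter \<le> nhds I"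
    by (rule cauchy_filter_complete_converges[OF _ complete_UNIV]) (simp_all add: filtermap_bot_iff)
  then obtain I where "filtermap (stieltjes_sum g F) mesh_filter \<le> nhds I" ..
  then have "has_curve_integral F I g"
    by (simp add: has_curve_integral_iff_tendsto filterlim_def)
  then show thesis
    by (rule that)
qed

lemma has_curve_integral_unique:
  "has_curve_integral F I g \<Longrightarrow> has_curve_integral F J g \<Longrightarrow> I = J"
  unfolding has_curve_integral_iff_tendsto by (rule tendsto_unique[OF mesh_filter_neq_bot])

lemma curve_integral_eqI: "has_curve_integral F I g \<Longrightarrow> curve_integral g F = I"
  unfolding curve_integral_def by (blast intro: has_curve_integral_unique)

lemma has_curve_integral_curve_integral:
  fixes F :: "complex \<Rightarrow> 'a::complex_banach"
  assumes "rectifiable_closed_curve g" "continuous_on (path_image g) F"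
  shows "has_curve_integral F (curve_integral g F) g"
  using curve_integral_exists[OF assms] curve_integral_eqI by metis

lemma has_curve_integral_cong:
  assumes "has_curve_integral F I g" "\<And>w. w \<in> path_image g \<Longrightarrow> F w = G w"
  shows "has_curve_integral G I g"
proof -
  \<comment> \<open>The mesh \<open>1\<close> is arbitrary; what counts is that \<open>D\<close>
    divides \<open>{0..1}\<close>, so that its tags lie there.\<close>
  have "stieltjes_sum g F D = stieltjes_sum g G D" if "mesh_below 1 D" for D
    unfolding stieltjes_sum_def
  proof (intro sum.cong refl, clarify)
    fix t k assume "(t, k) \<in> D"
    then have "t \<in> {0..1}"
      using tagged_division_interval[of D] that unfolding mesh_below_def by metis
    then show "(g (Sup k) - g (Inf k)) *\<^sub>C F (g t) = (g (Sup k) - g (Inf k)) *\<^sub>C G (g t)"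
      using assms(2) by (simp add: path_image_def)
  qed
  then have "\<forall>\<^sub>F D in mesh_filter. stieltjes_sum g F D = stieltjes_sum g G D"
    using eventually_mesh_below[of 1] by (auto elim: eventually_mono)
  then show ?thesis
    using assms(1) unfolding has_curve_integral_iff_tendsto by (simp cong: tendsto_cong)
qed

text \<open>Equivalence for every value \<open>I\<close> makes the two definite descriptions
  coincide, whether or not the integrals exist.\<close>

lemma curve_integral_cong:
  assumes "\<And>w. w \<in> path_image g \<Longrightarrow> F w = G w"
  shows "curve_integral g F = curve_integral g G"
proof -
  have "has_curve_integral F I g \<longleftrightarrow> has_curve_integral G I g" for I
    using has_curve_integral_cong[of F I g G] has_curve_integral_cong[of G I g F] assms by auto
  then show ?thesis
    by (simp add: curve_integral_def)
qed

lemma has_curve_integral_linear: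
  fixes T :: "'a::complex_normed_vector \<Rightarrow> 'b::complex_normed_vector"
  assumes "has_curve_integral F I g" "bounded_linear T" "\<And>c x. T (c *\<^sub>C x) = c *\<^sub>C T x"
  shows "has_curve_integral (\<lambda>z. T (F z)) (T I) g"
proof -
  interpret T: bounded_linear T by (rule assms)
  have "stieltjes_sum g (\<lambda>z. T (F z)) = (\<lambda>D. T (stieltjes_sum g F D))"
    by (rule ext) (simp add: stieltjes_sum_def T.sum assms(3) split_def)
  then show ?thesis
    using assms(1) T.tendsto by (simp add: has_curve_integral_iff_tendsto)
qed

lemma has_curve_integral_add:
  fixes F G :: "complex \<Rightarrow> 'a::complex_normed_vector"
  assumes "has_curve_integral F I g" "has_curve_integral G J g"
  shows "has_curve_integral (\<lambda>z. F z + G z) (I + J) g"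
proof -
  have "stieltjes_sum g (\<lambda>z. F z + G z) = (\<lambda>D. stieltjes_sum g F D + stieltjes_sum g G D)"
    by (rule ext) (simp add: stieltjes_sum_def split_def scaleC_add_right sum.distrib)
  then show ?thesis
    using assms by (simp add: has_curve_integral_iff_tendsto tendsto_add)
qed

lemma has_curve_integral_scaleC:
  assumes "has_curve_integral F I g"
  shows "has_curve_integral (\<lambda>z. c *\<^sub>C F z) (c *\<^sub>C I) g"
  using assms by (rule has_curve_integral_linear)
    (auto intro: bounded_linear_scaleC simp: scaleC_scaleC mult.commute)

lemma has_curve_integral_diff:
  fixes F G :: "complex \<Rightarrow> 'a::complex_normed_vector"
  assumes "has_curve_integral F I g" "has_curve_integral G J g"
  shows "has_curve_integral (\<lambda>z. F z - G z) (I - J) g"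
  using has_curve_integral_add[OF assms(1) has_curve_integral_scaleC[OF assms(2), of "-1"]]
  by (simp add: scaleC.minus_left)

lemma has_curve_integral_bound:
  assumes g: "variation_bound g v" and I: "has_curve_integral F I g"
    and B: "\<And>w. w \<in> path_image g \<Longrightarrow> norm (F w) \<le> B"
  shows "norm I \<le> B * (v 1 - v 0)"
proof (rule tendsto_upperbound)
  show "((\<lambda>D. norm (stieltjes_sum g F D)) \<longlongrightarrow> norm I) mesh_filter"
    using I by (intro tendsto_norm) (simp add: has_curve_integral_iff_tendsto)
  have "norm (stieltjes_sum g F D) \<le> B * (v 1 - v 0)" if D: "D tagged_division_of {0..1}" for D
  proof -
    have "norm (stieltjes_sum g F D) \<le> (\<Sum>(t, k)\<in>D. B * (v (Sup k) - v (Inf k)))"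
      unfolding stieltjes_sum_def split_def
    proof (rule sum_norm_le)
      fix x assume "x \<in> D"
      then obtain t k where x: "x = (t, k)" "(t, k) \<in> D"
        by (cases x) auto
      obtain a b where k: "k = {a..b}" "0 \<le> a" "a \<le> b" "b \<le> 1" "t \<in> {0..1}"
        using tagged_division_interval[OF D x(2)] by metis
      have "norm (g b - g a) * norm (F (g t)) \<le> (v b - v a) * B"
        using variation_boundD[OF g k(2-4)] B[of "g t"] k(5) by (intro mult_mono) (auto simp: path_image_def)
      then show "norm ((g (Sup (snd x)) - g (Inf (snd x))) *\<^sub>C F (g (fst x)))
          \<le> B * (v (Sup (snd x)) - v (Inf (snd x)))"
        using k by (simp add: x norm_scaleC mult.commute)
    qed
    also have "\<dots> = B * (v 1 - v 0)"
      using additive_tagged_division_1[OF _ D, of v]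
      by (simp add: split_def sum_distrib_left[symmetric])
    finally show ?thesis .
  qed
  then show "\<forall>\<^sub>F D in mesh_filter. norm (stieltjes_sum g F D) \<le> B * (v 1 - v 0)"
    using eventually_mesh_below[of 1] by (auto simp: mesh_below_def elim: eventually_mono)
qed simp

text \<open>With a continuous logarithm \<open>q\<close> of \<open>g - z\<close>, the increments of \<open>g\<close> divided by \<open>g t - z\<close>
  are \<open>exp a - exp b\<close> for small \<open>a\<close> and \<open>b\<close> with \<open>a - b\<close> an increment of \<open>q\<close>.\<close>

lemma has_curve_integral_winding_number:
  assumes g: "rectifiable_closed_curve g" and z: "z \<notin> path_image g"
  shows "has_curve_integral (\<lambda>w. 1 / (w - z)) (2 * complex_of_real pi * \<i> * winding_number g z) g"
proof -
  have pg: "path g"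
    using g by (simp add: rectifiable_closed_curve_def)
  obtain q where q: "path q" "pathfinish q - pathstart q = 2 * of_real pi * \<i> * winding_number g z"
    "\<And>t. t \<in> {0..1} \<Longrightarrow> g t = z + exp (q t)"
    using winding_number_as_continuous_log[OF pg z] by metis
  obtain v where v: "variation_bound g v"
    using rectifiable_variation_bound[OF g] .
  define V where "V = v 1 - v 0"
  have "V \<ge> 0"
    unfolding V_def using variation_boundD(2)[OF v, of 0 1] by simp
  obtain m where m: "m > 0" "\<And>w. w \<in> path_image g \<Longrightarrow> m \<le> norm (w - z)"
    using separate_point_closed[OF closed_path_image[OF pg] z] by (metis dist_norm dist_commute)
  show ?thesis
    unfolding has_curve_integral_iff_tendsto tendsto_iff eventually_mesh_filter dist_norm
  proof (intro allI impI)
    fix \<epsilon> :: real assume "\<epsilon> > 0"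
    define \<epsilon>' where "\<epsilon>' = \<epsilon> / (V + 1)"
    have \<epsilon>': "\<epsilon>' > 0" "\<epsilon>' * V < \<epsilon>"
      unfolding \<epsilon>'_def by (intro divide_add_one_bounds \<open>\<epsilon> > 0\<close> \<open>V \<ge> 0\<close>)+
    \<comment> \<open>The bound \<open>1/2\<close> lets increments of \<open>q\<close> be absorbed
      on the left below; the bound \<open>\<epsilon>' * m / 2\<close> turns the final factor
      \<open>2 * e / m\<close> into at most \<open>\<epsilon>'\<close>.\<close>
    define e where "e = min (1/2) (\<epsilon>' * m / 2)"
    have e: "e > 0" "e \<le> 1/2" and "e \<le> \<epsilon>' * m / 2"
      using \<epsilon>'(1) m(1) unfolding e_def by (simp, intro min.cobounded1, intro min.cobounded2)
    then have "2 * e / m \<le> \<epsilon>'"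
      using m(1) by (simp add: field_simps)
    have "isCont exp (0::complex)" by simp
    then obtain \<eta> where \<eta>: "\<eta> > 0" "\<And>x::complex. norm x < \<eta> \<Longrightarrow> norm (exp x - 1) < e"
      unfolding continuous_at_eps_delta using e(1) by (force simp: dist_norm)
    have exp_close: "norm ((exp a - exp b) - (a - b)) \<le> e * norm (a - b)"
      if "norm a < \<eta>" "norm b < \<eta>" for a b :: complex
    proof -
      have "norm ((exp a - a) - (exp b - b)) \<le> e * norm (a - b)"
      proof (rule field_differentiable_bound)
        show "((\<lambda>x. exp x - x) has_field_derivative exp x - 1) (at x within ball 0 \<eta>)" for x :: complex
          by (auto intro!: derivative_eq_intros)
        show "norm (exp x - 1) \<le> e" if "x \<in> ball 0 \<eta>" for x :: complex
          using \<eta>(2)[of x] that by simp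
      qed (use that in auto)
      then show ?thesis
        by (simp add: algebra_simps)
    qed
    have "uniformly_continuous_on {0..1} q"
      using q(1) by (intro compact_uniformly_continuous) (auto simp: path_def)
    then obtain \<delta> where \<delta>: "\<delta> > 0"
      "\<And>s t. s \<in> {0..1} \<Longrightarrow> t \<in> {0..1} \<Longrightarrow> dist s t < \<delta> \<Longrightarrow> norm (q s - q t) < \<eta>"
      unfolding uniformly_continuous_on_def using \<eta>(1) by (metis dist_norm dist_commute)
    have "norm (stieltjes_sum g (\<lambda>w. 1 / (w - z)) D - 2 * of_real pi * \<i> * winding_number g z) < \<epsilon>"
      if "mesh_below \<delta> D" for D
    proof -
      from that have D: "D tagged_division_of {0..1}" "(\<lambda>t. ball t \<delta>) fine D"
        by (simp_all add: mesh_below_def)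
      have qsum: "(\<Sum>(t, k)\<in>D. q (Sup k) - q (Inf k)) = 2 * of_real pi * \<i> * winding_number g z"
        using additive_tagged_division_1[OF _ D(1), of q] q(2)
        by (simp add: pathfinish_def pathstart_def)
      have "norm (stieltjes_sum g (\<lambda>w. 1 / (w - z)) D - (\<Sum>(t, k)\<in>D. q (Sup k) - q (Inf k)))
          = norm (\<Sum>(t, k)\<in>D. (g (Sup k) - g (Inf k)) / (g t - z) - (q (Sup k) - q (Inf k)))"
        by (simp add: stieltjes_sum_def split_def sum_subtractf)
      also have "\<dots> \<le> (\<Sum>(t, k)\<in>D. 2 * e / m * (v (Sup k) - v (Inf k)))"
        unfolding split_def
      proof (rule sum_norm_le)
        fix x assume "x \<in> D"
        then obtain t k where x: "x = (t, k)" "(t, k) \<in> D"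
          by (cases x) auto
        obtain a b where k: "k = {a..b}" "0 \<le> a" "a \<le> b" "b \<le> 1" "t \<in> {0..1}"
          using tagged_division_interval[OF D(1) x(2)] by metis
        have ab: "dist a t < \<delta>" "dist b t < \<delta>"
          using fineD[OF D(2) x(2)] k by (auto simp: subset_eq dist_commute)
        define A where "A = q b - q t"
        define B where "B = q a - q t"
        have small: "norm A < \<eta>" "norm B < \<eta>"
          using \<delta>(2)[of b t] \<delta>(2)[of a t] ab k by (auto simp: A_def B_def)
        have "g t \<in> path_image g"
          using k(5) by (simp add: path_image_def)
        then have gt: "g t - z = exp (q t)" "m \<le> norm (g t - z)"
          using q(3)[OF k(5)] by (simp, intro m(2))
        have quot: "(g b - g a) / (g t - z) = exp A - exp B"
          using q(3)[of a] q(3)[of b] k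
          by (simp add: gt A_def B_def exp_diff diff_divide_distrib)
        have le: "norm ((exp A - exp B) - (A - B)) \<le> e * norm (A - B)"
          by (rule exp_close[OF small])
        \<comment> \<open>Only continuity is known of the logarithm \<open>q\<close>. Since the
          error is at most half of \<open>norm (A - B)\<close>, the increment of \<open>q\<close> is
          at most twice the relative increment of \<open>g\<close>, whose variation is under
          control.\<close>
        have "norm (A - B) \<le> norm (exp A - exp B) + norm ((exp A - exp B) - (A - B))"
          using norm_triangle_ineq4[of "exp A - exp B" "(exp A - exp B) - (A - B)"] by simp
        also have "\<dots> \<le> norm (exp A - exp B) + 1/2 * norm (A - B)"
          using order_trans[OF le mult_right_mono[OF e(2)]] by simp
        finally have "norm (A - B) \<le> 2 * norm ((g b - g a) / (g t - z))"
          by (simp add: quot)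
        also have "\<dots> \<le> 2 * ((v b - v a) / m)"
          unfolding norm_divide using variation_boundD[OF v k(2-4)] gt(2) m(1)
          by (intro mult_left_mono frac_le) auto
        finally have "e * norm (A - B) \<le> e * (2 * ((v b - v a) / m))"
          using e(1) by (intro mult_left_mono) auto
        then have "norm ((exp A - exp B) - (A - B)) \<le> 2 * e / m * (v b - v a)"
          using le by (simp add: field_simps)
        then show "norm ((g (Sup (snd x)) - g (Inf (snd x))) / (g (fst x) - z)
            - (q (Sup (snd x)) - q (Inf (snd x)))) \<le> 2 * e / m * (v (Sup (snd x)) - v (Inf (snd x)))"
          using k by (simp add: x quot A_def B_def)
      qed
      also have "\<dots> = 2 * e / m * (\<Sum>(t, k)\<in>D. v (Sup k) - v (Inf k))"
        by (simp only: split_def sum_distrib_left)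
      also have "(\<Sum>(t, k)\<in>D. v (Sup k) - v (Inf k)) = V"
        unfolding V_def by (intro additive_tagged_division_1 D) simp
      also have "2 * e / m * V \<le> \<epsilon>' * V"
        using \<open>2 * e / m \<le> \<epsilon>'\<close> \<open>V \<ge> 0\<close> by (rule mult_right_mono)
      also note \<epsilon>'(2)
      finally show ?thesis
        by (simp add: qsum)
    qed
    then show "\<exists>\<delta>>0. \<forall>D. mesh_below \<delta> D \<longrightarrow>
        norm (stieltjes_sum g (\<lambda>w. 1 / (w - z)) D - 2 * of_real pi * \<i> * winding_number g z) < \<epsilon>"
      using \<delta>(1) by blast
  qed
qed

text \<open>Each Stieltjes sum is a finite combination of functions holomorphic in \<open>z\<close>,
  and joint uniform continuity on \<open>cball x r \<times> {0..1}\<close> makes the sums converge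
  uniformly on the disc. This replaces differentiation under the integral.\<close>

lemma holomorphic_curve_integral:
  assumes g: "rectifiable_closed_curve g" and S: "open S"
    and cont: "continuous_on (S \<times> path_image g) (\<lambda>(z, w). H z w)"
    and hol: "\<And>w. w \<in> path_image g \<Longrightarrow> (\<lambda>z. H z w) holomorphic_on S"
  shows "(\<lambda>z. curve_integral g (H z)) holomorphic_on S"
proof -
  obtain v where v: "variation_bound g v"
    using rectifiable_variation_bound[OF g] .
  define V where "V = v 1 - v 0"
  have "V \<ge> 0"
    unfolding V_def using variation_boundD(2)[OF v, of 0 1] by simp
  have cg: "continuous_on {0..1} g"
    using g by (simp add: rectifiable_closed_curve_def path_def)
  have "\<exists>r>0. (\<lambda>z. curve_integral g (H z)) holomorphic_on ball x r" if "x \<in> S" for x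
  proof -
    obtain r where r: "r > 0" "cball x r \<subseteq> S"
      using S \<open>x \<in> S\<close> open_contains_cball by blast
    have hol_sum: "(\<lambda>z. stieltjes_sum g (H z) D) holomorphic_on S" if D: "mesh_below 1 D" for D
      unfolding stieltjes_sum_def split_def scaleC_complex_def
    proof (intro holomorphic_intros hol)
      fix y assume "y \<in> D"
      then show "g (fst y) \<in> path_image g"
        using tagged_division_interval[of D "fst y" "snd y"] D unfolding mesh_below_def
        by (metis image_eqI path_image_def prod.collapse)
    qed
    have "continuous_on (cball x r \<times> {0..1}) (\<lambda>y. (\<lambda>(z, w). H z w) (fst y, g (snd y)))"
      using r by (intro continuous_on_compose2[OF cont] continuous_intros continuous_on_compose2[OF cg])
        (auto simp: path_image_def)
    then have uc: "uniformly_continuous_on (cball x r \<times> {0..1}) (\<lambda>y. H (fst y) (g (snd y)))"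
      by (intro compact_uniformly_continuous compact_Times) auto
    have ulim: "uniform_limit (cball x r) (\<lambda>D z. stieltjes_sum g (H z) D)
        (\<lambda>z. curve_integral g (H z)) mesh_filter"
      unfolding uniform_limit_iff
    proof (intro allI impI)
      fix e :: real assume "e > 0"
      define e' where "e' = e / (V + 1)"
      have e': "e' > 0" "e' * V < e"
        unfolding e'_def by (intro divide_add_one_bounds \<open>e > 0\<close> \<open>V \<ge> 0\<close>)+
      obtain \<delta> where \<delta>: "\<delta> > 0" "\<And>y y'. y \<in> cball x r \<times> {0..1} \<Longrightarrow> y' \<in> cball x r \<times> {0..1} \<Longrightarrow>
          dist y' y < \<delta> \<Longrightarrow> norm (H (fst y') (g (snd y')) - H (fst y) (g (snd y))) < e'"
        using uc e'(1) unfolding uniformly_continuous_on_def by (metis dist_norm)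
      have "dist (stieltjes_sum g (H z) D) (curve_integral g (H z)) < e"
        if D: "mesh_below (\<delta> / 2) D" and z: "z \<in> cball x r" for D z
      proof -
        have "continuous_on (path_image g) (\<lambda>w. (z, w))"
          by (intro continuous_on_Pair continuous_on_const continuous_on_id)
        then have "continuous_on (path_image g) (H z)"
          using continuous_on_compose2[OF cont, of "path_image g" "\<lambda>w. (z, w)"] z r(2)
          by (simp add: image_subset_iff[of "Pair z"] subset_eq[of "cball x r"])
        then have "has_curve_integral (H z) (curve_integral g (H z)) g"
          by (intro has_curve_integral_curve_integral g)
        moreover have "norm (H z (g s) - H z (g t)) \<le> e'" if "s \<in> {0..1}" "t \<in> {0..1}" "dist s t < \<delta>" for s t
          using \<delta>(2)[of "(z, t)" "(z, s)"] that z by (simp add: dist_Pair_Pair less_imp_le)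
        ultimately have "norm (stieltjes_sum g (H z) D - curve_integral g (H z)) \<le> e' * V"
          unfolding V_def using \<delta>(1) by (intro stieltjes_sum_error[OF v _ _ D])
        then show ?thesis
          using e'(2) by (simp add: dist_norm)
      qed
      then show "\<forall>\<^sub>F D in mesh_filter. \<forall>z\<in>cball x r.
          dist (stieltjes_sum g (H z) D) (curve_integral g (H z)) < e"
        using eventually_mesh_below[of "\<delta> / 2"] \<delta>(1) by (auto elim: eventually_mono)
    qed
    have "\<forall>\<^sub>F D in mesh_filter. continuous_on (cball x r) (\<lambda>z. stieltjes_sum g (H z) D) \<and>
        (\<lambda>z. stieltjes_sum g (H z) D) holomorphic_on ball x r"
    proof (rule eventually_mono[OF eventually_mesh_below[of 1]])
      fix D assume "mesh_below 1 D"
      then have "(\<lambda>z. stieltjes_sum g (H z) D) holomorphic_on cball x r"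
        using hol_sum r(2) holomorphic_on_subset by blast
      then show "continuous_on (cball x r) (\<lambda>z. stieltjes_sum g (H z) D) \<and>
          (\<lambda>z. stieltjes_sum g (H z) D) holomorphic_on ball x r"
        using holomorphic_on_imp_continuous_on holomorphic_on_subset ball_subset_cball by blast
    qed simp
    then show ?thesis
      using holomorphic_uniform_limit[OF _ ulim mesh_filter_neq_bot] r(1) by blast
  qed
  then show ?thesis
    using S analytic_on_def analytic_on_open by blast
qed

section \<open>Cauchy's theorem for cycles of rectifiable curves\<close>

text \<open>The diagonal is the critical place: near \<open>z\<close> the function
  \<open>h u - deriv h z * u\<close> has derivative at most \<open>e / 2\<close>, so by the mean
  value estimate every difference quotient of two nearby points is within \<open>e / 2\<close> of
  \<open>deriv h z\<close>.\<close>

lemma continuous_on_difference_quotient: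
  assumes U: "open U" and h: "h holomorphic_on U"
  shows "continuous_on (U \<times> U) (\<lambda>(z, w). if w = z then deriv h z else (h w - h z) / (w - z))"
    (is "continuous_on _ ?H")
proof -
  have contU: "continuous_on U h"
    by (rule holomorphic_on_imp_continuous_on[OF h])
  have "isCont ?H x" if "x \<in> U \<times> U" for x
  proof (cases "fst x = snd x")
    case False
    define V where "V = (U \<times> U) \<inter> {x. fst x \<noteq> snd x}"
    have "open V"
      unfolding V_def by (intro open_Int open_Times U open_Collect_neq continuous_intros)
    have "continuous_on V (\<lambda>x. (h (snd x) - h (fst x)) / (snd x - fst x))"
      by (intro continuous_intros continuous_on_compose2[OF contU]) (auto simp: V_def)
    then have "continuous_on V ?H"
      by (rule continuous_on_eq) (auto simp: V_def)
    then show ?thesis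
      using \<open>open V\<close> that False by (auto simp: continuous_on_eq_continuous_at V_def)
  next
    case True
    define z where "z = fst x"
    have x: "x = (z, z)" "z \<in> U"
      using that True by (simp_all add: z_def prod_eq_iff mem_Times_iff)
    have "continuous_on U (deriv h)"
      by (intro holomorphic_on_imp_continuous_on holomorphic_deriv h U)
    then have dz: "isCont (deriv h) z"
      using U x by (simp add: continuous_on_eq_continuous_at)
    obtain r0 where r0: "r0 > 0" "ball z r0 \<subseteq> U"
      using U x(2) openE by blast
    show ?thesis
      unfolding continuous_at_eps_delta
    proof (intro allI impI)
      fix e :: real assume "e > 0"
      then obtain r1 where r1: "r1 > 0" "\<And>y. dist y z < r1 \<Longrightarrow> dist (deriv h y) (deriv h z) < e / 2"
        using dz unfolding continuous_at_eps_delta by (metis half_gt_zero)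
      define r where "r = min r0 r1"
      have "dist (?H y) (?H x) < e" if y: "dist y x < r" for y
      proof -
        obtain a b where ab: "y = (a, b)"
          by (cases y)
        have "dist a z < r" "dist b z < r"
          using y dist_fst_le[of y x] dist_snd_le[of y x] by (auto simp: ab x)
        then have in_ball: "a \<in> ball z r" "b \<in> ball z r"
          by (auto simp: dist_commute)
        show ?thesis
        proof (cases "a = b")
          case True
          then show ?thesis
            using r1(2)[of a] in_ball(1) \<open>e > 0\<close> by (auto simp: ab x r_def dist_commute)
        next
          case False
          have "norm ((h b - deriv h z * b) - (h a - deriv h z * a)) \<le> e / 2 * norm (b - a)"
          proof (rule field_differentiable_bound[of "ball z r" _ "\<lambda>u. deriv h u - deriv h z"])
            fix u assume u: "u \<in> ball z r"
            then have "u \<in> U"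
              using r0 by (auto simp: r_def)
            then have "(h has_field_derivative deriv h u) (at u within ball z r)"
              using holomorphic_derivI[OF h U] by blast
            then show "((\<lambda>b. h b - deriv h z * b) has_field_derivative deriv h u - deriv h z)
                (at u within ball z r)"
              by (auto intro!: derivative_eq_intros)
            show "norm (deriv h u - deriv h z) \<le> e / 2"
              using r1(2)[of u] u by (auto simp: r_def dist_norm norm_minus_commute)
          qed (use in_ball in auto)
          moreover have "(h b - h a) / (b - a) - deriv h z
              = ((h b - deriv h z * b) - (h a - deriv h z * a)) / (b - a)"
            using False by (simp add: field_simps)
          ultimately have "norm ((h b - h a) / (b - a) - deriv h z) \<le> e / 2"
            using False by (simp add: norm_divide field_simps)
          then show ?thesis
            using False \<open>e > 0\<close> by (simp add: ab x dist_norm)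
        qed
      qed
      then show "\<exists>d>0. \<forall>y. dist y x < d \<longrightarrow> dist (?H y) (?H x) < e"
        using r0(1) r1(1) by (intro exI[of _ r]) (auto simp: r_def)
    qed
  qed
  then show ?thesis
    by (intro continuous_at_imp_continuous_on) blast
qed

lemma holomorphic_difference_quotient:
  assumes "open U" "h holomorphic_on U" "w \<in> U"
  shows "(\<lambda>z. if w = z then deriv h z else (h w - h z) / (w - z)) holomorphic_on U"
proof -
  have "(\<lambda>z. if z = w then deriv h w else (h z - h w) / (z - w)) holomorphic_on U"
    using assms by (intro pole_lemma) (auto simp: interior_open)
  then show ?thesis
    by (rule holomorphic_transform) (auto simp: field_simps minus_divide_right)
qed

lemma holomorphic_on_sum_list:
  "(\<And>x. x \<in> set xs \<Longrightarrow> f x holomorphic_on U) \<Longrightarrow> (\<lambda>z. \<Sum>x\<leftarrow>xs. f x z) holomorphic_on U"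
  by (induction xs) (auto intro!: holomorphic_intros)

lemma continuous_on_sum_list:
  fixes f :: "'a \<Rightarrow> 'b::topological_space \<Rightarrow> 'c::topological_monoid_add"
  shows "(\<And>x. x \<in> set xs \<Longrightarrow> continuous_on U (f x)) \<Longrightarrow> continuous_on U (\<lambda>z. \<Sum>x\<leftarrow>xs. f x z)"
  by (induction xs) (auto intro!: continuous_on_add)

text \<open>For a sum of winding numbers, this turns the condition \<open>n z = 0\<close> into the
  open condition \<open>norm (n z) < 1\<close>.\<close>

lemma Ints_norm_less_one:
  fixes z :: complex
  assumes "z \<in> \<int>" "norm z < 1"
  shows "z = 0"
proof -
  obtain k where k: "z = of_int k"
    using assms(1) by (rule Ints_cases)
  then have "\<bar>real_of_int k\<bar> < 1"
    using assms(2) by (simp only: norm_of_int)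
  then have "k = 0"
    by linarith
  then show ?thesis
    using k by simp
qed

lemma tendsto_sum_list_zero:
  fixes f :: "'a \<Rightarrow> 'b \<Rightarrow> 'c::topological_monoid_add"
  shows "(\<And>x. x \<in> set xs \<Longrightarrow> (f x \<longlongrightarrow> 0) F) \<Longrightarrow> ((\<lambda>z. \<Sum>x\<leftarrow>xs. f x z) \<longlongrightarrow> 0) F"
proof (induction xs)
  case (Cons a xs)
  then have "((\<lambda>z. f a z + (\<Sum>x\<leftarrow>xs. f x z)) \<longlongrightarrow> 0 + 0) F"
    by (intro tendsto_add) auto
  then show ?case by simp
qed auto

lemma rectifiable_closed_curveD:
  assumes "rectifiable_closed_curve g"
  shows "path g" "pathfinish g = pathstart g" "compact (path_image g)"
  using assms by (auto simp: rectifiable_closed_curve_def)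

lemma surrounding_contourD:
  assumes "surrounding_contour \<Gamma> K U"
  shows "\<And>g. g \<in> set \<Gamma> \<Longrightarrow> rectifiable_closed_curve g"
    and "\<And>g. g \<in> set \<Gamma> \<Longrightarrow> path_image g \<subseteq> U - K"
    and "\<And>z. z \<in> K \<Longrightarrow> (\<Sum>g\<leftarrow>\<Gamma>. winding_number g z) = 1"
    and "\<And>z. z \<notin> U \<Longrightarrow> (\<Sum>g\<leftarrow>\<Gamma>. winding_number g z) = 0"
  using assms by (auto simp: surrounding_contour_def)

lemma surrounding_contourI:
  assumes "\<And>g. g \<in> set \<Gamma> \<Longrightarrow> rectifiable_closed_curve g"
    and "\<And>g. g \<in> set \<Gamma> \<Longrightarrow> path_image g \<subseteq> U - K"
    and "\<And>z. z \<in> K \<Longrightarrow> (\<Sum>g\<leftarrow>\<Gamma>. winding_number g z) = 1"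
    and "\<And>z. z \<notin> U \<Longrightarrow> (\<Sum>g\<leftarrow>\<Gamma>. winding_number g z) = 0"
  shows "surrounding_contour \<Gamma> K U"
  using assms by (auto simp: surrounding_contour_def)

lemma Cauchy_transform_at_infinity:
  assumes g: "rectifiable_closed_curve g" and h: "continuous_on (path_image g) h"
  shows "((\<lambda>z. curve_integral g (\<lambda>w. h w / (w - z))) \<longlongrightarrow> (0::complex)) at_infinity"
proof -
  obtain v where v: "variation_bound g v"
    using rectifiable_variation_bound[OF g] .
  define V where "V = v 1 - v 0"
  have "V \<ge> 0"
    unfolding V_def using variation_boundD(2)[OF v, of 0 1] by simp
  obtain R where R: "\<And>w. w \<in> path_image g \<Longrightarrow> norm w \<le> R"
    using compact_imp_bounded[OF rectifiable_closed_curveD(3)[OF g]] by (auto simp: bounded_iff)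
  have "bounded (h ` path_image g)"
    by (intro compact_imp_bounded compact_continuous_image h rectifiable_closed_curveD g)
  then obtain B where B: "B > 0" "\<And>w. w \<in> path_image g \<Longrightarrow> norm (h w) \<le> B"
    by (auto simp: bounded_pos)
  show ?thesis
    unfolding Lim_at_infinity
  proof (intro allI impI)
    fix e :: real assume "e > 0"
    \<comment> \<open>At distance \<open>m\<close> from the curve the integrand is at most
      \<open>B / m = e / (V + 1)\<close>, which leaves the integral strictly below
      \<open>e\<close>.\<close>
    define m where "m = B * (V + 1) / e"
    have "m > 0"
      using \<open>e > 0\<close> B(1) \<open>V \<ge> 0\<close> by (simp add: m_def)
    have "dist (curve_integral g (\<lambda>w. h w / (w - z))) 0 < e" if z: "R + m \<le> norm z" for z
    proof -
      have far: "m \<le> norm (w - z)" if "w \<in> path_image g" for w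
        using R[OF that] z norm_triangle_ineq2[of z w] by (simp add: norm_minus_commute)
      then have "\<forall>w\<in>path_image g. w - z \<noteq> 0"
        using \<open>m > 0\<close> by fastforce
      then have "continuous_on (path_image g) (\<lambda>w. h w / (w - z))"
        by (intro continuous_intros h) auto
      then have "has_curve_integral (\<lambda>w. h w / (w - z)) (curve_integral g (\<lambda>w. h w / (w - z))) g"
        by (rule has_curve_integral_curve_integral[OF g])
      then have "norm (curve_integral g (\<lambda>w. h w / (w - z))) \<le> B / m * (v 1 - v 0)"
      proof (rule has_curve_integral_bound[OF v])
        show "norm (h w / (w - z)) \<le> B / m" if "w \<in> path_image g" for w
          unfolding norm_divide using far[OF that] B(1) B(2)[OF that] \<open>m > 0\<close> by (intro frac_le) auto
      qed
      also have "\<dots> = e * (V / (V + 1))"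
        using B(1) by (simp add: m_def V_def)
      also have "\<dots> < e * 1"
        using \<open>e > 0\<close> \<open>V \<ge> 0\<close> by (intro mult_strict_left_mono) auto
      finally show ?thesis by simp
    qed
    then show "\<exists>b. \<forall>z. b \<le> norm z \<longrightarrow> dist (curve_integral g (\<lambda>w. h w / (w - z))) 0 < e"
      by blast
  qed
qed

lemma Cauchy_transform_holomorphic:
  assumes g: "rectifiable_closed_curve g" and h: "continuous_on (path_image g) h"
    and V: "open V" "V \<inter> path_image g = {}"
  shows "(\<lambda>z. curve_integral g (\<lambda>w. h w / (w - z))) holomorphic_on V"
proof (rule holomorphic_curve_integral[OF g V(1)])
  show "continuous_on (V \<times> path_image g) (\<lambda>(z, w). h w / (w - z))"
    unfolding split_def
    by (intro continuous_intros continuous_on_compose2[OF h]) (use V(2) in auto)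
  show "(\<lambda>z. h w / (w - z)) holomorphic_on V" if "w \<in> path_image g" for w
    by (intro holomorphic_intros) (use V(2) that in auto)
qed

text \<open>Dixon's argument: the integrals of the difference quotients over the cycle, which are
  holomorphic in \<open>U\<close>, and the Cauchy transform, which is holomorphic off the cycle, agree where
  the winding number vanishes and so form an entire function, which tends to \<open>0\<close> at infinity.\<close>

lemma Cauchy_transform_cycle_zero:
  assumes U: "open U" and h: "h holomorphic_on U"
    and \<Gamma>: "surrounding_contour \<Gamma> {} U"
    and z: "\<And>g. g \<in> set \<Gamma> \<Longrightarrow> z \<notin> path_image g" "(\<Sum>g\<leftarrow>\<Gamma>. winding_number g z) = 0"
  shows "(\<Sum>g\<leftarrow>\<Gamma>. curve_integral g (\<lambda>w. h w / (w - z))) = (0::complex)"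
proof -
  note rect = surrounding_contourD(1)[OF \<Gamma>] and wn = surrounding_contourD(4)[OF \<Gamma>]
  have sub: "path_image g \<subseteq> U" if "g \<in> set \<Gamma>" for g
    using surrounding_contourD(2)[OF \<Gamma> that] by simp
  define P where "P = (\<Union>g\<in>set \<Gamma>. path_image g)"
  define n where "n z = (\<Sum>g\<leftarrow>\<Gamma>. winding_number g z)" for z
  \<comment> \<open>The cycle lies in \<open>U\<close> and has winding number \<open>0\<close>
    around every point outside, so \<open>V\<close> contains the complement of \<open>U\<close> and
    the two sets cover the plane.\<close>
  define V where "V = {z. z \<notin> P \<and> n z = 0}"
  define H where "H z w = (if w = z then deriv h z else (h w - h z) / (w - z))" for z w
  define E1 where "E1 z = (\<Sum>g\<leftarrow>\<Gamma>. curve_integral g (H z))" for z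
  define E2 where "E2 z = (\<Sum>g\<leftarrow>\<Gamma>. curve_integral g (\<lambda>w. h w / (w - z)))" for z
  define E where "E z = (if z \<in> V then E2 z else E1 z)" for z
  have "compact P"
    unfolding P_def using rect by (intro compact_UN) (auto simp: rectifiable_closed_curveD)
  then have "closed P" "bounded P"
    by (auto simp: compact_imp_closed compact_imp_bounded)
  have "P \<subseteq> U"
    using sub by (auto simp: P_def)
  have conth: "continuous_on (path_image g) h" if "g \<in> set \<Gamma>" for g
    using holomorphic_on_imp_continuous_on[OF h] sub[OF that] continuous_on_subset by blast
  have "open V"
  proof -
    have "continuous_on (- P) n"
      unfolding n_def
    proof (intro continuous_on_sum_list)
      fix g assume "g \<in> set \<Gamma>"
      then show "continuous_on (- P) (winding_number g)"
        using rectifiable_closed_curveD[OF rect]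
        by (intro continuous_on_subset[OF continuous_on_winding_number]) (auto simp: P_def)
    qed
    then have "open (n -` ball 0 1 \<inter> - P)"
      using \<open>closed P\<close> by (subst (asm) continuous_on_open_vimage) auto
    also have "n -` ball 0 1 \<inter> - P = V"
    proof -
      have "n z \<in> \<int>" if "z \<notin> P" for z
        unfolding n_def
      proof -
        have "(\<Sum>g\<leftarrow>\<Delta>. winding_number g z) \<in> \<int>" if "set \<Delta> \<subseteq> set \<Gamma>" for \<Delta>
          using that
        proof (induction \<Delta>)
          case (Cons g \<Delta>)
          then have "winding_number g z \<in> \<int>"
            using \<open>z \<notin> P\<close> rectifiable_closed_curveD[OF rect]
            by (intro integer_winding_number) (auto simp: P_def)
          then show ?case
            using Cons by auto
        qed auto
        then show "(\<Sum>g\<leftarrow>\<Gamma>. winding_number g z) \<in> \<int>" by blast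
      qed
      then show ?thesis
        using Ints_norm_less_one by (auto simp: V_def)
    qed
    finally show ?thesis .
  qed
  have far: "\<exists>R. \<forall>z. norm z > R \<longrightarrow> z \<in> V"
  proof -
    obtain R where R: "\<And>w. w \<in> P \<Longrightarrow> norm w \<le> R"
      using \<open>bounded P\<close> by (auto simp: bounded_iff)
    have "z \<in> V" if "norm z > R" for z
    proof -
      have "winding_number g z = 0" if "g \<in> set \<Gamma>" for g
      proof (rule winding_number_zero_outside)
        have "path_image g \<subseteq> P"
          using that by (auto simp: P_def)
        then show "path_image g \<subseteq> cball 0 R"
          using R by auto
      qed (use rectifiable_closed_curveD[OF rect[OF that]] \<open>norm z > R\<close> in auto)
      then have "n z = 0"
        unfolding n_def by (simp add: sum_list_0 cong: map_cong)
      then show ?thesis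
        using R[of z] that by (auto simp: V_def)
    qed
    then show ?thesis by blast
  qed
  have E12: "E1 z = E2 z" if "z \<in> U" "z \<in> V" for z
  proof -
    have "curve_integral g (H z) = curve_integral g (\<lambda>w. h w / (w - z))
        - h z * (2 * of_real pi * \<i> * winding_number g z)" if g: "g \<in> set \<Gamma>" for g
    proof -
      have zg: "z \<notin> path_image g"
        using \<open>z \<in> V\<close> g by (auto simp: V_def P_def)
      have "continuous_on (path_image g) (\<lambda>w. h w / (w - z))"
        using zg by (intro continuous_intros conth g) auto
      then have "has_curve_integral (\<lambda>w. h w / (w - z) - h z *\<^sub>C (1 / (w - z)))
          (curve_integral g (\<lambda>w. h w / (w - z)) - h z *\<^sub>C (2 * of_real pi * \<i> * winding_number g z)) g"
        by (intro has_curve_integral_diff has_curve_integral_scaleC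
            has_curve_integral_curve_integral has_curve_integral_winding_number rect g zg)
      then have "has_curve_integral (H z)
          (curve_integral g (\<lambda>w. h w / (w - z)) - h z *\<^sub>C (2 * of_real pi * \<i> * winding_number g z)) g"
        by (rule has_curve_integral_cong) (use zg in \<open>auto simp: H_def diff_divide_distrib\<close>)
      then show ?thesis
        by (simp add: curve_integral_eqI)
    qed
    then have "E1 z = (\<Sum>g\<leftarrow>\<Gamma>. curve_integral g (\<lambda>w. h w / (w - z))
        - h z * (2 * of_real pi * \<i> * winding_number g z))"
      unfolding E1_def by (intro arg_cong[of _ _ sum_list] map_cong refl)
    also have "\<dots> = E2 z - h z * (2 * of_real pi * \<i> * n z)"
      unfolding E2_def n_def by (simp add: sum_list_subtractf sum_list_const_mult)
    finally show ?thesis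
      using that by (simp add: V_def)
  qed
  have "E holomorphic_on (U \<union> V)"
  proof (rule holomorphic_on_Un[OF _ _ U \<open>open V\<close>])
    have "E1 holomorphic_on U"
      unfolding E1_def
    proof (intro holomorphic_on_sum_list holomorphic_curve_integral rect U)
      fix g assume g: "g \<in> set \<Gamma>"
      show "continuous_on (U \<times> path_image g) (\<lambda>(z, w). H z w)"
        unfolding H_def using sub[OF g]
        by (intro continuous_on_subset[OF continuous_on_difference_quotient[OF U h]]) auto
      show "(\<lambda>z. H z w) holomorphic_on U" if "w \<in> path_image g" for w
        unfolding H_def using sub[OF g] that by (intro holomorphic_difference_quotient U h) auto
    qed
    then show "E holomorphic_on U"
      by (rule holomorphic_transform) (auto simp: E_def E12)
    have "E2 holomorphic_on V"
      unfolding E2_def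
      by (intro holomorphic_on_sum_list Cauchy_transform_holomorphic rect conth \<open>open V\<close>)
        (auto simp: V_def P_def)
    then show "E holomorphic_on V"
      by (rule holomorphic_transform) (auto simp: E_def)
  qed
  moreover have "U \<union> V = UNIV"
    using wn \<open>P \<subseteq> U\<close> by (auto simp: V_def n_def)
  ultimately have "E holomorphic_on UNIV"
    by simp
  moreover have "(E \<longlongrightarrow> 0) at_infinity"
  proof (rule Lim_transform_eventually)
    show "(E2 \<longlongrightarrow> 0) at_infinity"
      unfolding E2_def by (intro tendsto_sum_list_zero Cauchy_transform_at_infinity rect conth)
    obtain R where "\<And>z. norm z > R \<Longrightarrow> z \<in> V"
      using far by blast
    then show "\<forall>\<^sub>F z in at_infinity. E2 z = E z"
      unfolding eventually_at_infinity by (intro exI[of _ "R + 1"]) (auto simp: E_def)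
  qed
  ultimately have "E z = 0"
    by (rule Liouville_weak_0)
  moreover have "z \<in> V"
    using z by (auto simp: V_def P_def n_def)
  ultimately show ?thesis
    by (simp add: E_def E2_def)
qed

text \<open>The vanishing Cauchy transform, applied to \<open>h w * (w - z)\<close> so that the
  kernel cancels. The point \<open>z\<close> is taken so far away that all winding numbers around it
  are \<open>0\<close>.\<close>

theorem Cauchy_theorem_cycle:
  fixes h :: "complex \<Rightarrow> complex"
  assumes U: "open U" and h: "h holomorphic_on U"
    and \<Gamma>: "surrounding_contour \<Gamma> {} U"
  shows "(\<Sum>g\<leftarrow>\<Gamma>. curve_integral g h) = 0"
proof -
  note rect = surrounding_contourD(1)[OF \<Gamma>]
  have "bounded (\<Union>g\<in>set \<Gamma>. path_image g)"
    using rect by (intro bounded_UN) (auto simp: rectifiable_closed_curveD compact_imp_bounded)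
  then obtain R where R: "\<And>g w. g \<in> set \<Gamma> \<Longrightarrow> w \<in> path_image g \<Longrightarrow> norm w \<le> R"
    by (auto simp: bounded_iff)
  \<comment> \<open>The absolute value covers a negative \<open>R\<close>, which is possible for an
    empty cycle.\<close>
  define z where "z = complex_of_real (\<bar>R\<bar> + 1)"
  have "norm z > R"
    unfolding z_def by (simp only: norm_of_real)
  have zg: "z \<notin> path_image g" if "g \<in> set \<Gamma>" for g
    using R[OF that, of z] \<open>norm z > R\<close> by auto
  have "winding_number g z = 0" if "g \<in> set \<Gamma>" for g
    using rectifiable_closed_curveD[OF rect[OF that]] R[OF that] \<open>norm z > R\<close>
    by (intro winding_number_zero_outside[of g "cball 0 R"]) auto
  then have "(\<Sum>g\<leftarrow>\<Gamma>. winding_number g z) = 0"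
    by (simp add: sum_list_0 cong: map_cong)
  then have "(\<Sum>g\<leftarrow>\<Gamma>. curve_integral g (\<lambda>w. (h w * (w - z)) / (w - z))) = 0"
    using zg by (intro Cauchy_transform_cycle_zero[OF U _ \<Gamma>] holomorphic_intros h)
  also have "map (\<lambda>g. curve_integral g (\<lambda>w. (h w * (w - z)) / (w - z))) \<Gamma> = map (\<lambda>g. curve_integral g h) \<Gamma>"
    using zg by (intro map_cong refl curve_integral_cong) auto
  finally show ?thesis .
qed

section \<open>Large circles and the residue at infinity\<close>

lemma Lipschitz_rectifiable:
  assumes "path g" "pathfinish g = pathstart g"
    and L: "\<And>s t. s \<in> {0..1} \<Longrightarrow> t \<in> {0..1} \<Longrightarrow> norm (g s - g t) \<le> L * \<bar>s - t\<bar>"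
  shows "rectifiable_closed_curve g" "variation_bound g (\<lambda>t. L * t)"
proof -
  have "(\<Sum>k\<in>D. dist (g (Inf k)) (g (Sup k))) \<le> L" if D: "D division_of {0..1}" for D
  proof -
    have "(\<Sum>k\<in>D. dist (g (Inf k)) (g (Sup k))) \<le> (\<Sum>k\<in>D. L * measure lborel k)"
    proof (rule sum_mono)
      fix k assume k: "k \<in> D"
      obtain a b where ab: "k = cbox a b"
        using division_ofD(4)[OF D k] by blast
      moreover have "k \<noteq> {}" "k \<subseteq> {0..1}"
        using division_ofD(2,3)[OF D k] by auto
      ultimately show "dist (g (Inf k)) (g (Sup k)) \<le> L * measure lborel k"
        using L[of a b] by (auto simp: dist_norm)
    qed
    also have "\<dots> = L * measure lborel {0..1::real}"
      using additive_content_division[of D 0 1] D by (simp add: sum_distrib_left[symmetric])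
    finally show ?thesis by simp
  qed
  then show "rectifiable_closed_curve g"
    using assms by (auto simp: rectifiable_closed_curve_def)
  show "variation_bound g (\<lambda>t. L * t)"
    unfolding variation_bound_def
  proof (intro allI impI)
    fix a b :: real assume "0 \<le> a" "a \<le> b" "b \<le> 1"
    then show "norm (g b - g a) \<le> L * b - L * a"
      using L[of b a] by (simp add: right_diff_distrib)
  qed
qed

text \<open>Mean value estimate along the imaginary axis, a convex set on which the derivative of
  \<open>exp\<close> has modulus \<open>1\<close>.\<close>

lemma norm_exp_imaginary_diff_le:
  fixes a b :: real
  shows "norm (exp (\<i> * complex_of_real a) - exp (\<i> * complex_of_real b)) \<le> \<bar>a - b\<bar>"
proof -
  have "norm (exp (\<i> * complex_of_real a) - exp (\<i> * complex_of_real b))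
      \<le> 1 * norm (\<i> * complex_of_real a - \<i> * complex_of_real b)"
  proof (rule field_differentiable_bound)
    show "convex {z. Re z = 0}"
      by (rule convexI) auto
    show "(exp has_field_derivative exp z) (at z within {z. Re z = 0})" for z :: complex
      by (auto intro!: derivative_eq_intros)
  qed auto
  also have "norm (\<i> * complex_of_real a - \<i> * complex_of_real b) = norm (\<i> * complex_of_real (a - b))"
    by (simp add: right_diff_distrib)
  finally show ?thesis
    by (simp add: norm_mult del: of_real_diff)
qed

text \<open>The hypothesis places the cycle in \<open>U\<close> and lets it wind once around each
  point of the complement. A large circle with reversed orientation cancels these winding numbers,
  so Cauchy's theorem reduces the integral to one over the circle. There \<open>h\<close> is
  \<open>c / z\<close> up to an error of order \<open>1 / r ^ 2\<close> on a curve of length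
  \<open>2 * pi * r\<close>, and \<open>r\<close> tends to infinity.\<close>

theorem cycle_integral_at_infinity:
  fixes h :: "complex \<Rightarrow> complex"
  assumes U: "open U" and h: "h holomorphic_on U"
    and \<Gamma>: "surrounding_contour \<Gamma> (- U) UNIV"
    and inf: "\<And>z. norm z \<ge> r0 \<Longrightarrow> z \<in> U" "\<And>z. norm z \<ge> r0 \<Longrightarrow> norm (h z - c / z) \<le> K / norm z ^ 2"
  shows "(\<Sum>g\<leftarrow>\<Gamma>. curve_integral g h) = 2 * complex_of_real pi * \<i> * c"
proof -
  define I where "I = (\<Sum>g\<leftarrow>\<Gamma>. curve_integral g h)"
  have bound: "norm (I - 2 * of_real pi * \<i> * c) \<le> 2 * pi * K / r" if "r \<ge> r0" "r > 0" for r
  proof -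
    define C where "C = reversepath (circlepath 0 r)"
    have C: "path C" "pathfinish C = pathstart C" "path_image C = sphere 0 r"
      using \<open>r > 0\<close> by (auto simp: C_def)
    have lip: "norm (C s - C t) \<le> 2 * pi * r * \<bar>s - t\<bar>" for s t
    proof -
      have "C s - C t = of_real r * (exp (\<i> * complex_of_real (2 * pi * (1 - s)))
          - exp (\<i> * complex_of_real (2 * pi * (1 - t))))"
        by (simp add: C_def reversepath_def circlepath algebra_simps)
      also have "norm \<dots> \<le> r * \<bar>2 * pi * (1 - s) - 2 * pi * (1 - t)\<bar>"
        unfolding norm_mult using \<open>r > 0\<close>
        by (intro mult_mono norm_exp_imaginary_diff_le) auto
      also have "2 * pi * (1 - s) - 2 * pi * (1 - t) = 2 * pi * (t - s)"
        by (simp add: algebra_simps)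
      also have "r * \<bar>2 * pi * (t - s)\<bar> = 2 * pi * r * \<bar>s - t\<bar>"
        by (simp add: abs_mult abs_minus_commute)
      finally show ?thesis .
    qed
    note rectC = Lipschitz_rectifiable[OF C(1,2) lip]
    have subC: "path_image C \<subseteq> U"
      using inf(1) \<open>r \<ge> r0\<close> by (auto simp: C(3))
    have wnC: "winding_number C z = -1" if "norm z < r" for z
      using that \<open>r > 0\<close> by (simp add: C_def winding_number_reversepath winding_number_circlepath)
    define J where "J = curve_integral C h"
    have "(\<Sum>g\<leftarrow>C # \<Gamma>. curve_integral g h) = 0"
    proof (intro Cauchy_theorem_cycle[OF U h] surrounding_contourI)
      show "(\<Sum>g\<leftarrow>C # \<Gamma>. winding_number g z) = 0" if "z \<notin> U" for z
      proof -
        have "norm z < r"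
          using inf(1)[of z] that \<open>r \<ge> r0\<close> by force
        then show ?thesis
          using surrounding_contourD(3)[OF \<Gamma>, of z] that wnC by simp
      qed
    qed (use surrounding_contourD(1,2)[OF \<Gamma>] rectC(1) subC in auto)
    then have "I = - J"
      by (simp add: I_def J_def eq_neg_iff_add_eq_0 add.commute)
    have "continuous_on (path_image C) h"
      using holomorphic_on_imp_continuous_on[OF h] subC continuous_on_subset by blast
    then have "has_curve_integral h J C"
      unfolding J_def by (rule has_curve_integral_curve_integral[OF rectC(1)])
    moreover have "has_curve_integral (\<lambda>w. 1 / (w - 0)) (2 * of_real pi * \<i> * winding_number C 0) C"
      using \<open>r > 0\<close> by (intro has_curve_integral_winding_number rectC) (auto simp: C(3))
    ultimately have "has_curve_integral (\<lambda>z. h z - c *\<^sub>C (1 / (z - 0)))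
        (J - c *\<^sub>C (2 * of_real pi * \<i> * winding_number C 0)) C"
      by (intro has_curve_integral_diff has_curve_integral_scaleC)
    then have "norm (J - c *\<^sub>C (2 * of_real pi * \<i> * winding_number C 0))
        \<le> K / r ^ 2 * (2 * pi * r * 1 - 2 * pi * r * 0)"
    proof (rule has_curve_integral_bound[OF rectC(2)])
      show "norm (h w - c *\<^sub>C (1 / (w - 0))) \<le> K / r ^ 2" if "w \<in> path_image C" for w
        using inf(2)[of w] that \<open>r \<ge> r0\<close> by (simp add: C(3))
    qed
    moreover have "J - c *\<^sub>C (2 * of_real pi * \<i> * winding_number C 0) = - (I - 2 * of_real pi * \<i> * c)"
      using \<open>I = - J\<close> wnC[of 0] \<open>r > 0\<close> by simp
    ultimately show ?thesis
      using \<open>r > 0\<close> by (simp add: power2_eq_square norm_minus_commute mult.commute)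
  qed
  have "norm (I - 2 * of_real pi * \<i> * c) \<le> 0"
  proof (rule tendsto_lowerbound)
    show "((\<lambda>r. 2 * pi * K / r) \<longlongrightarrow> 0) at_top"
      by (intro real_tendsto_divide_at_top[OF tendsto_const] filterlim_ident)
    show "\<forall>\<^sub>F r in at_top. norm (I - 2 * of_real pi * \<i> * c) \<le> 2 * pi * K / r"
      using eventually_ge_at_top[of r0] eventually_gt_at_top[of 0]
      by eventually_elim (rule bound)
  qed (rule trivial_limit_at_top_linorder)
  then have "I = 2 * of_real pi * \<i> * c"
    by (simp only: norm_le_zero_iff right_minus_eq)
  then show ?thesis
    by (simp only: I_def)
qed

text \<open>At points of \<open>U - Z\<close>, in the applications points of the spectrum,
  \<open>F\<close> has no meaningful value. Each functional is allowed its own scalar extension, so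
  no operator-valued extension has to be produced, and scalar function theory suffices.\<close>

definition weak_extension ::
  "complex set \<Rightarrow> complex set \<Rightarrow> (complex \<Rightarrow> 'a::complex_normed_vector) \<Rightarrow> bool"
  where "weak_extension U Z F \<longleftrightarrow> (\<forall>l. complex_functional l \<longrightarrow>
    (\<exists>h. h holomorphic_on U \<and> (\<forall>z\<in>Z. h z = l (F z))))"

lemma weak_extension_mono:
  assumes "weak_extension U Z F" "V \<subseteq> U" "W \<subseteq> Z" "\<And>z. z \<in> W \<Longrightarrow> G z = F z"
  shows "weak_extension V W G"
  unfolding weak_extension_def
proof (intro allI impI)
  fix l :: "'a \<Rightarrow> complex" assume "complex_functional l"
  then obtain h where "h holomorphic_on U" "\<forall>z\<in>Z. h z = l (F z)"
    using assms(1) unfolding weak_extension_def by blast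
  then show "\<exists>h. h holomorphic_on V \<and> (\<forall>z\<in>W. h z = l (G z))"
    using assms(2-4) by (intro exI[of _ h]) (auto intro: holomorphic_on_subset)
qed

lemma weak_extension_linear:
  assumes "weak_extension U Z F" "bounded_linear T" "\<And>c x. T (c *\<^sub>C x) = c *\<^sub>C T x"
  shows "weak_extension U Z (\<lambda>z. T (F z))"
  unfolding weak_extension_def
proof (intro allI impI)
  fix l :: "'b \<Rightarrow> complex" assume "complex_functional l"
  then have "complex_functional (\<lambda>x. l (T x))"
    using assms(2,3) bounded_linear_compose[of l T] by (auto simp: complex_functional_def)
  then show "\<exists>h. h holomorphic_on U \<and> (\<forall>z\<in>Z. h z = l (T (F z)))"
    using assms(1) unfolding weak_extension_def by blast
qed

text \<open>The extensions on \<open>U\<close> and \<open>V\<close> are chosen independently for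
  each functional; they can be glued because the overlap lies where both are equal to
  \<open>l (F z)\<close>.\<close>

lemma weak_extension_Un:
  assumes "open U" "open V" and F: "weak_extension U Z F" "weak_extension V W F"
    and overlap: "U \<inter> V \<subseteq> Z \<inter> W" and "Z \<subseteq> U" "W \<subseteq> V"
  shows "weak_extension (U \<union> V) (Z \<union> W) F"
  unfolding weak_extension_def
proof (intro allI impI)
  fix l :: "'a \<Rightarrow> complex" assume l: "complex_functional l"
  obtain h k where h: "h holomorphic_on U" "\<And>z. z \<in> Z \<Longrightarrow> h z = l (F z)"
    and k: "k holomorphic_on V" "\<And>z. z \<in> W \<Longrightarrow> k z = l (F z)"
    using F l unfolding weak_extension_def by metis
  define e where "e z = (if z \<in> U then h z else k z)" for z
  have "h z = k z" if "z \<in> U \<inter> V" for z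
  proof -
    have "z \<in> Z" "z \<in> W"
      using overlap that by blast+
    then show ?thesis
      using h(2) k(2) by simp
  qed
  then have "e holomorphic_on V"
    using k(1) by (intro holomorphic_transform[OF k(1)]) (simp add: e_def)
  moreover have "e holomorphic_on U"
    using h(1) by (rule holomorphic_transform) (simp add: e_def)
  ultimately have "e holomorphic_on U \<union> V"
    using assms(1,2) by (intro holomorphic_on_Un)
  moreover have "\<forall>z\<in>Z \<union> W. e z = l (F z)"
    using h(2) k(2) overlap assms(6,7) by (auto simp: e_def)
  ultimately show "\<exists>h. h holomorphic_on U \<union> V \<and> (\<forall>z\<in>Z \<union> W. h z = l (F z))"
    by blast
qed

lemma complex_functional_contour_sum_integral:
  fixes F :: "complex \<Rightarrow> 'a::complex_banach"
  assumes l: "complex_functional l" and \<Gamma>: "surrounding_contour \<Gamma> K U"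
    and F: "continuous_on (U - K) F" and h: "\<And>w. w \<in> U - K \<Longrightarrow> h w = l (F w)"
  shows "l (contour_sum_integral \<Gamma> F) = (\<Sum>g\<leftarrow>\<Gamma>. curve_integral g h)"
proof -
  interpret l: bounded_linear l
    using l by (simp add: complex_functional_def)
  note D = surrounding_contourD[OF \<Gamma>]
  have *: "l (curve_integral g F) = curve_integral g h" if g: "g \<in> set \<Gamma>" for g
  proof -
    have "has_curve_integral (\<lambda>z. l (F z)) (l (curve_integral g F)) g"
    proof (rule has_curve_integral_linear[where T = l])
      show "has_curve_integral F (curve_integral g F) g"
        using D(2)[OF g] F
        by (intro has_curve_integral_curve_integral D(1) g) (rule continuous_on_subset)
    qed (use l in \<open>auto simp: complex_functional_def\<close>)
    then have "has_curve_integral h (l (curve_integral g F)) g"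
      by (rule has_curve_integral_cong) (use h D(2)[OF g] in auto)
    then show ?thesis
      by (simp add: curve_integral_eqI)
  qed
  have "l (\<Sum>g\<leftarrow>\<Delta>. curve_integral g F) = (\<Sum>g\<leftarrow>\<Delta>. curve_integral g h)" if "set \<Delta> \<subseteq> set \<Gamma>" for \<Delta>
    using that
  proof (induction \<Delta>)
    case (Cons g \<Delta>)
    have "g \<in> set \<Gamma>" "set \<Delta> \<subseteq> set \<Gamma>"
      using Cons.prems by simp_all
    from *[OF this(1)] Cons.IH[OF this(2)] show ?case
      by (simp only: list.map sum_list.Cons l.add)
  qed (simp only: list.map sum_list.Nil l.zero)
  then show ?thesis
    unfolding contour_sum_integral_def by blast
qed

theorem contour_sum_integral_zero:
  fixes F :: "complex \<Rightarrow> 'a::complex_banach"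
  assumes U: "open U" and \<Gamma>: "surrounding_contour \<Gamma> K U"
    and F: "continuous_on (U - K) F" "weak_extension U (U - K) F"
  shows "contour_sum_integral \<Gamma> F = 0"
proof (rule complex_functional_separates)
  fix l :: "'a \<Rightarrow> complex" assume l: "complex_functional l"
  then obtain h where h: "h holomorphic_on U" "\<And>w. w \<in> U - K \<Longrightarrow> h w = l (F w)"
    using F(2) unfolding weak_extension_def by blast
  then have "l (contour_sum_integral \<Gamma> F) = (\<Sum>g\<leftarrow>\<Gamma>. curve_integral g h)"
    by (intro complex_functional_contour_sum_integral[OF l \<Gamma> F(1)])
  also have "\<dots> = 0"
    using surrounding_contourD[OF \<Gamma>]
    by (intro Cauchy_theorem_cycle[OF U h(1)] surrounding_contourI) auto
  finally show "l (contour_sum_integral \<Gamma> F) = 0" .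
qed

text \<open>\<open>Z\<close> is where \<open>F\<close> lives, and \<open>U\<close> is where its
  scalar extensions live. The contour has to surround the complement of \<open>U\<close> only:
  singularities of \<open>F\<close> inside \<open>U\<close>, across which it extends, may lie off
  \<open>K\<close>. This freedom is what allows a contour around one part of a spectrum.\<close>

theorem contour_sum_integral_at_infinity:
  fixes F :: "complex \<Rightarrow> 'a::complex_banach"
  assumes U: "open U" and \<Gamma>: "surrounding_contour \<Gamma> K V" "- U \<subseteq> K" "V - K \<subseteq> Z"
    and inf: "\<And>z. norm z \<ge> b \<Longrightarrow> z \<in> Z"
      "\<And>z. norm z \<ge> b \<Longrightarrow> norm (F z - (1 / z) *\<^sub>C c) \<le> B / norm z ^ 2"
    and F: "continuous_on Z F" "weak_extension U Z F" "Z \<subseteq> U"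
  shows "contour_sum_integral \<Gamma> F = (2 * complex_of_real pi * \<i>) *\<^sub>C c"
proof -
  have "contour_sum_integral \<Gamma> F - (2 * complex_of_real pi * \<i>) *\<^sub>C c = 0"
  proof (rule complex_functional_separates)
    fix l :: "'a \<Rightarrow> complex" assume l: "complex_functional l"
    then interpret l: bounded_linear l
      by (simp add: complex_functional_def)
    have lC: "l (a *\<^sub>C x) = a * l x" for a x
      using l by (simp add: complex_functional_def)
    obtain h where h: "h holomorphic_on U" "\<And>w. w \<in> Z \<Longrightarrow> h w = l (F w)"
      using F(2) l unfolding weak_extension_def by blast
    obtain L where L: "L > 0" "\<And>x. norm (l x) \<le> norm x * L"
      using l.pos_bounded by blast
    have bound: "norm (h z - l c / z) \<le> B * L / norm z ^ 2" if "norm z \<ge> b" for z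
    proof -
      have "h z - l c / z = l (F z - (1 / z) *\<^sub>C c)"
        using h(2)[OF inf(1)[OF that]] by (simp add: l.diff lC)
      then have "norm (h z - l c / z) \<le> norm (F z - (1 / z) *\<^sub>C c) * L"
        using L(2) by simp
      also have "\<dots> \<le> B / norm z ^ 2 * L"
        using inf(2)[OF that] L(1) by (intro mult_right_mono) auto
      finally show ?thesis by simp
    qed
    have "(\<Sum>g\<leftarrow>\<Gamma>. curve_integral g h) = 2 * complex_of_real pi * \<i> * l c"
    proof (rule cycle_integral_at_infinity[OF U h(1)])
      show "surrounding_contour \<Gamma> (- U) UNIV"
        using surrounding_contourD[OF \<Gamma>(1)] \<Gamma>(2) by (intro surrounding_contourI) blast+
      show "z \<in> U" if "b \<le> norm z" for z
        using inf(1)[OF that] F(3) by blast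
    qed (rule bound)
    moreover have "l (contour_sum_integral \<Gamma> F) = (\<Sum>g\<leftarrow>\<Gamma>. curve_integral g h)"
      using h(2) \<Gamma>(3)
      by (intro complex_functional_contour_sum_integral[OF l \<Gamma>(1)] continuous_on_subset[OF F(1)]) auto
    ultimately show "l (contour_sum_integral \<Gamma> F - (2 * complex_of_real pi * \<i>) *\<^sub>C c) = 0"
      by (simp add: l.diff lC)
  qed
  then show ?thesis by simp
qed

section \<open>Resolvents\<close>

interpretation compose: bounded_bilinear
  "(o\<^sub>L) :: ('b::real_normed_vector \<Rightarrow>\<^sub>L 'c::real_normed_vector) \<Rightarrow> ('a::real_normed_vector \<Rightarrow>\<^sub>L 'b) \<Rightarrow> _"
  by (rule bounded_bilinear_blinfun_compose)

lemma compose_assoc: "(R o\<^sub>L S) o\<^sub>L T = R o\<^sub>L (S o\<^sub>L T)"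
  by (rule blinfun_eqI) simp

lemma compose_id [simp]: "id_blinfun o\<^sub>L T = T" "T o\<^sub>L id_blinfun = T"
  by (rule blinfun_eqI; simp)+

lemma scaleC_compose: "(c *\<^sub>C S) o\<^sub>L T = c *\<^sub>C (S o\<^sub>L T)"
  by (rule blinfun_eqI) (simp add: scaleC_blinfun.rep_eq)

lemma compose_scaleC: "complex_linear_op S \<Longrightarrow> S o\<^sub>L (c *\<^sub>C T) = c *\<^sub>C (S o\<^sub>L T)"
  by (rule blinfun_eqI) (simp add: scaleC_blinfun.rep_eq complex_linear_op_def)

lemma complex_linear_op_zero [simp]: "complex_linear_op 0"
  by (simp add: complex_linear_op_def scaleC.zero_right)

lemma complex_linear_op_id [simp]: "complex_linear_op id_blinfun"
  by (simp add: complex_linear_op_def)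

lemma complex_linear_op_add [intro]:
  "complex_linear_op S \<Longrightarrow> complex_linear_op T \<Longrightarrow> complex_linear_op (S + T)"
  by (simp add: complex_linear_op_def blinfun.add_left scaleC_add_right)

lemma complex_linear_op_diff [intro]:
  "complex_linear_op S \<Longrightarrow> complex_linear_op T \<Longrightarrow> complex_linear_op (S - T)"
  by (simp add: complex_linear_op_def blinfun.diff_left scaleC.diff_right)

lemma complex_linear_op_scaleC [intro]: "complex_linear_op T \<Longrightarrow> complex_linear_op (c *\<^sub>C T)"
  by (simp add: complex_linear_op_def scaleC_blinfun.rep_eq scaleC_scaleC mult.commute)

lemma complex_linear_op_compose [intro]:
  "complex_linear_op S \<Longrightarrow> complex_linear_op T \<Longrightarrow> complex_linear_op (S o\<^sub>L T)"
  by (simp add: complex_linear_op_def)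

lemma complex_linear_op_sum [intro]:
  "(\<And>x. x \<in> A \<Longrightarrow> complex_linear_op (f x)) \<Longrightarrow> complex_linear_op (\<Sum>x\<in>A. f x)"
  by (induction A rule: infinite_finite_induct) auto

lemma complex_linear_op_LIMSEQ:
  assumes "f \<longlonglongrightarrow> T" "\<And>n. complex_linear_op (f n)"
  shows "complex_linear_op T"
  unfolding complex_linear_op_def
proof (intro allI)
  fix c x
  have lim: "(\<lambda>n. f n y) \<longlonglongrightarrow> T y" for y
    by (intro blinfun.tendsto assms tendsto_const)
  have "(\<lambda>n. c *\<^sub>C f n x) \<longlonglongrightarrow> c *\<^sub>C T x"
    by (intro scaleC.tendsto tendsto_const lim)
  moreover have "(\<lambda>n. c *\<^sub>C f n x) \<longlonglongrightarrow> T (c *\<^sub>C x)"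
    using lim[of "c *\<^sub>C x"] assms(2) by (simp add: complex_linear_op_def)
  ultimately show "T (c *\<^sub>C x) = c *\<^sub>C T x"
    by (rule LIMSEQ_unique[symmetric])
qed

lemma complex_linear_op_suminf:
  "summable f \<Longrightarrow> (\<And>n. complex_linear_op (f n)) \<Longrightarrow> complex_linear_op (suminf f)"
  by (rule complex_linear_op_LIMSEQ[OF summable_LIMSEQ]) auto

lemma complex_linear_op_inverse:
  assumes T: "complex_linear_op T" and S: "S o\<^sub>L T = id_blinfun" "T o\<^sub>L S = id_blinfun"
  shows "complex_linear_op S"
  unfolding complex_linear_op_def
proof (intro allI)
  fix c x
  have inv: "T (S y) = y" for y
    using S(2) by (metis blinfun_apply_blinfun_compose blinfun_apply_id_blinfun)
  have inv': "S (T y) = y" for y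
    using S(1) by (metis blinfun_apply_blinfun_compose blinfun_apply_id_blinfun)
  have "S (c *\<^sub>C x) = S (c *\<^sub>C T (S x))"
    by (simp add: inv)
  also have "\<dots> = S (T (c *\<^sub>C S x))"
    using T by (simp add: complex_linear_op_def)
  finally show "S (c *\<^sub>C x) = c *\<^sub>C S x"
    by (simp add: inv')
qed

lemma op_power_0 [simp]: "op_power T 0 = id_blinfun"
  by (simp add: op_power_def)

lemma op_power_Suc: "op_power T (Suc n) = T o\<^sub>L op_power T n"
  by (simp add: op_power_def)

lemma op_power_Suc2: "op_power T (Suc n) = op_power T n o\<^sub>L T"
proof (induction n)
  case (Suc n)
  have "op_power T (Suc (Suc n)) = T o\<^sub>L (op_power T n o\<^sub>L T)"
    by (simp only: op_power_Suc[of T "Suc n"] Suc.IH)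
  then show ?case
    by (simp only: op_power_Suc compose_assoc)
qed (simp add: op_power_Suc)

lemma complex_linear_op_power [intro]: "complex_linear_op T \<Longrightarrow> complex_linear_op (op_power T n)"
  by (induction n) (auto simp: op_power_Suc)

lemma norm_op_power_le: "norm (op_power T n) \<le> norm T ^ n"
proof (induction n)
  case (Suc n)
  have "norm (op_power T (Suc n)) \<le> norm T * norm (op_power T n)"
    unfolding op_power_Suc by (rule norm_blinfun_compose)
  also have "\<dots> \<le> norm T * norm T ^ n"
    by (intro mult_left_mono Suc) simp
  finally show ?case by simp
qed (simp add: norm_blinfun_id_le)

lemma inverse_op_unique:
  assumes "L o\<^sub>L T = id_blinfun" "T o\<^sub>L R = id_blinfun"
  shows "L = R"
  by (metis assms compose_assoc compose_id)

section \<open>Neumann series and estimates of the resolvent\<close>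

lemma resolventI:
  assumes "S o\<^sub>L (z *\<^sub>C id_blinfun - T) = id_blinfun" "(z *\<^sub>C id_blinfun - T) o\<^sub>L S = id_blinfun"
  shows "z \<notin> op_spectrum T" "resolvent T z = S"
proof -
  show "z \<notin> op_spectrum T"
    using assms by (auto simp: op_spectrum_def op_invertible_def)
  show "resolvent T z = S"
    unfolding resolvent_def op_inverse_def
    using assms by (intro the_equality) (auto intro: inverse_op_unique)
qed

lemma resolvent_inverse:
  assumes "z \<notin> op_spectrum T"
  shows "resolvent T z o\<^sub>L (z *\<^sub>C id_blinfun - T) = id_blinfun"
    and "(z *\<^sub>C id_blinfun - T) o\<^sub>L resolvent T z = id_blinfun"
proof -
  obtain S where "S o\<^sub>L (z *\<^sub>C id_blinfun - T) = id_blinfun" "(z *\<^sub>C id_blinfun - T) o\<^sub>L S = id_blinfun"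
    using assms by (auto simp: op_spectrum_def op_invertible_def)
  then show "resolvent T z o\<^sub>L (z *\<^sub>C id_blinfun - T) = id_blinfun"
    "(z *\<^sub>C id_blinfun - T) o\<^sub>L resolvent T z = id_blinfun"
    using resolventI(2)[of S z T] by simp_all
qed

lemma complex_linear_op_resolvent [intro]:
  assumes "complex_linear_op T" "z \<notin> op_spectrum T"
  shows "complex_linear_op (resolvent T z)"
  by (rule complex_linear_op_inverse[OF _ resolvent_inverse[OF assms(2)]])
    (intro complex_linear_op_diff complex_linear_op_scaleC complex_linear_op_id assms(1))

text \<open>The hypothesis bounds powers instead of the norm, because a bound measured in an
  equivalent norm survives the change of norm only up to a constant factor \<open>C\<close>. The
  inverse is the series of \<open>op_power T n\<close> divided by \<open>w ^ Suc n\<close>, with a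
  geometric majorant.\<close>

lemma Neumann_resolvent:
  fixes T :: "'a::complex_banach \<Rightarrow>\<^sub>L 'a"
  assumes T: "complex_linear_op T" and C: "\<And>n. norm (op_power T n) \<le> C * \<tau> ^ n"
    and \<tau>: "0 \<le> \<tau>" "\<tau> < norm w"
  shows "w \<notin> op_spectrum T" "norm (resolvent T w) \<le> C / (norm w - \<tau>)"
proof -
  have "w \<noteq> 0"
    using \<tau> by auto
  define f where "f n = (1 / w ^ Suc n) *\<^sub>C op_power T n" for n
  define b where "b n = C / norm w * (\<tau> / norm w) ^ n" for n
  have fb: "norm (f n) \<le> b n" for n
  proof -
    have "norm (f n) \<le> 1 / norm w ^ Suc n * (C * \<tau> ^ n)"
      unfolding f_def norm_scaleC by (intro mult_mono C) (auto simp: norm_divide norm_power norm_mult)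
    then show ?thesis
      by (simp add: b_def power_divide)
  qed
  have b: "b sums (C / norm w * (1 / (1 - \<tau> / norm w)))"
  proof -
    have "\<bar>\<tau> / norm w\<bar> < 1"
      using \<tau> \<open>w \<noteq> 0\<close> by (simp add: divide_less_eq)
    then show ?thesis
      unfolding b_def by (intro sums_mult geometric_sums) simp
  qed
  have f: "summable f"
    using sums_summable[OF b] fb by (rule summable_comparison_test'[where N = 0])
  have Tf: "T o\<^sub>L f n = w *\<^sub>C f (Suc n)" "f n o\<^sub>L T = w *\<^sub>C f (Suc n)" for n
    using \<open>w \<noteq> 0\<close> by (simp_all add: f_def compose_scaleC[OF T] scaleC_compose scaleC_scaleC
        flip: op_power_Suc op_power_Suc2)
  have "w *\<^sub>C suminf f = w *\<^sub>C f 0 + w *\<^sub>C (\<Sum>n. f (Suc n))"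
    using suminf_split_head[OF f] by (simp add: scaleC.diff_right)
  also have "w *\<^sub>C f 0 = id_blinfun"
    using \<open>w \<noteq> 0\<close> by (simp add: f_def scaleC_scaleC)
  also have "w *\<^sub>C (\<Sum>n. f (Suc n)) = (\<Sum>n. w *\<^sub>C f (Suc n))"
    using f by (intro bounded_linear.suminf[OF bounded_linear_scaleC]) (simp add: summable_Suc_iff)
  finally have wf: "w *\<^sub>C suminf f = id_blinfun + (\<Sum>n. w *\<^sub>C f (Suc n))" .
  have "T o\<^sub>L suminf f = (\<Sum>n. w *\<^sub>C f (Suc n))"
    using bounded_linear.suminf[OF compose.bounded_linear_right f, of T] by (simp add: Tf)
  moreover have "suminf f o\<^sub>L T = (\<Sum>n. w *\<^sub>C f (Suc n))"
    using bounded_linear.suminf[OF compose.bounded_linear_left f, of T] by (simp add: Tf)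
  moreover have "complex_linear_op (suminf f)"
    unfolding f_def
    by (intro complex_linear_op_suminf f[unfolded f_def] complex_linear_op_scaleC complex_linear_op_power T)
  ultimately have "suminf f o\<^sub>L (w *\<^sub>C id_blinfun - T) = id_blinfun"
    "(w *\<^sub>C id_blinfun - T) o\<^sub>L suminf f = id_blinfun"
    using wf by (simp_all add: compose.diff_left compose.diff_right scaleC_compose compose_scaleC)
  note res = resolventI[OF this]
  show "w \<notin> op_spectrum T"
    by (rule res)
  have "norm (suminf f) \<le> suminf b"
    using fb sums_summable[OF b] by (rule norm_suminf_le)
  also have "suminf b = C / norm w * (1 / ((norm w - \<tau>) / norm w))"
    using sums_unique[OF b] \<open>w \<noteq> 0\<close> by (simp add: diff_divide_distrib)
  also have "\<dots> = C / (norm w - \<tau>)"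
    using \<open>w \<noteq> 0\<close> by simp
  finally show "norm (resolvent T w) \<le> C / (norm w - \<tau>)"
    by (simp add: res)
qed

text \<open>The factorization z - T = (I - X) (z0 - T) with X = (z0 - z) R(z0) leaves a factor I - X
  with \<open>norm X \<le> 1 / 2\<close>, whose inverse is the resolvent of \<open>X\<close> at
  \<open>1\<close> and has norm at most \<open>2\<close>.\<close>

lemma resolvent_perturbation:
  fixes T :: "'a::complex_banach \<Rightarrow>\<^sub>L 'a"
  assumes T: "complex_linear_op T" and z0: "z0 \<notin> op_spectrum T"
    and z: "norm (z - z0) * norm (resolvent T z0) \<le> 1 / 2"
  shows "z \<notin> op_spectrum T" "norm (resolvent T z) \<le> 2 * norm (resolvent T z0)"
proof -
  define R where "R = resolvent T z0"
  define X where "X = (z0 - z) *\<^sub>C R"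
  have clR: "complex_linear_op R"
    unfolding R_def using T z0 by auto
  have X: "complex_linear_op X"
    unfolding X_def using clR by auto
  have normX: "norm X \<le> 1 / 2"
    using z by (simp add: X_def R_def norm_scaleC norm_minus_commute)
  have pow: "norm (op_power X n) \<le> 1 * (1 / 2) ^ n" for n
    using order_trans[OF norm_op_power_le power_mono[OF normX]] by simp
  have one: "1 \<notin> op_spectrum X" and "norm (resolvent X 1) \<le> 1 / (norm (1::complex) - 1 / 2)"
    by (rule Neumann_resolvent[OF X pow]; simp)+
  then have Y: "norm (resolvent X 1) \<le> 2"
    by simp
  define Y where "Y = resolvent X 1"
  note inv = resolvent_inverse[OF one, folded Y_def, simplified]
    resolvent_inverse[OF z0, folded R_def]
  have fact: "z *\<^sub>C id_blinfun - T = (id_blinfun - X) o\<^sub>L (z0 *\<^sub>C id_blinfun - T)"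
  proof -
    have "X o\<^sub>L (z0 *\<^sub>C id_blinfun - T) = (z0 - z) *\<^sub>C id_blinfun"
      by (simp only: X_def scaleC_compose inv)
    then show ?thesis
      by (simp add: compose.diff_left scaleC.diff_left)
  qed
  have "(R o\<^sub>L Y) o\<^sub>L (z *\<^sub>C id_blinfun - T)
      = R o\<^sub>L ((Y o\<^sub>L (id_blinfun - X)) o\<^sub>L (z0 *\<^sub>C id_blinfun - T))"
    by (simp only: fact compose_assoc)
  also have "\<dots> = id_blinfun"
    by (simp only: inv compose_id)
  finally have "(R o\<^sub>L Y) o\<^sub>L (z *\<^sub>C id_blinfun - T) = id_blinfun" .
  moreover have "(z *\<^sub>C id_blinfun - T) o\<^sub>L (R o\<^sub>L Y)
      = (id_blinfun - X) o\<^sub>L (((z0 *\<^sub>C id_blinfun - T) o\<^sub>L R) o\<^sub>L Y)"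
    by (simp only: fact compose_assoc)
  then have "(z *\<^sub>C id_blinfun - T) o\<^sub>L (R o\<^sub>L Y) = id_blinfun"
    by (simp only: inv compose_id)
  ultimately have res: "z \<notin> op_spectrum T" "resolvent T z = R o\<^sub>L Y"
    by (rule resolventI)+
  show "z \<notin> op_spectrum T"
    by (rule res)
  have "norm (R o\<^sub>L Y) \<le> norm R * norm Y"
    by (rule norm_blinfun_compose)
  also have "\<dots> \<le> norm R * 2"
    unfolding Y_def by (intro mult_left_mono Y) simp
  finally show "norm (resolvent T z) \<le> 2 * norm (resolvent T z0)"
    by (simp add: res R_def mult.commute)
qed

lemma resolvent_perturbation_ball:
  fixes T :: "'a::complex_banach \<Rightarrow>\<^sub>L 'a"
  assumes T: "complex_linear_op T" and z0: "z0 \<notin> op_spectrum T"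
  obtains r where "r > 0" "\<And>z. z \<in> ball z0 r \<Longrightarrow> z \<notin> op_spectrum T"
    "\<And>z. z \<in> ball z0 r \<Longrightarrow> norm (resolvent T z) \<le> 2 * norm (resolvent T z0)"
proof
  \<comment> \<open>The \<open>+ 1\<close> avoids division by zero: on the zero space the resolvent
    is \<open>0\<close>.\<close>
  define r where "r = 1 / (2 * (norm (resolvent T z0) + 1))"
  show "r > 0"
    by (simp add: r_def add_nonneg_pos)
  have "norm (z - z0) * norm (resolvent T z0) \<le> 1 / 2" if "z \<in> ball z0 r" for z
  proof -
    have "norm (z - z0) * norm (resolvent T z0) \<le> r * (norm (resolvent T z0) + 1)"
      using that \<open>r > 0\<close> by (intro mult_mono) (auto simp: dist_norm norm_minus_commute)
    also have "\<dots> = 1 / 2"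
      using add_nonneg_pos[of "norm (resolvent T z0)" 1] by (simp add: r_def)
    finally show ?thesis .
  qed
  then show "z \<notin> op_spectrum T" "norm (resolvent T z) \<le> 2 * norm (resolvent T z0)"
    if "z \<in> ball z0 r" for z
    using resolvent_perturbation[OF T z0] that by blast+
qed

lemma open_resolvent_set:
  fixes T :: "'a::complex_banach \<Rightarrow>\<^sub>L 'a"
  assumes T: "complex_linear_op T"
  shows "open (- op_spectrum T)"
  unfolding open_contains_ball
proof
  fix z0 assume "z0 \<in> - op_spectrum T"
  then obtain r where "r > 0" "\<And>z. z \<in> ball z0 r \<Longrightarrow> z \<notin> op_spectrum T"
    using resolvent_perturbation_ball[OF T] by (metis ComplD)
  then show "\<exists>e>0. ball z0 e \<subseteq> - op_spectrum T"
    by blast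
qed

lemma resolvent_identity:
  assumes T: "complex_linear_op T" and z: "z \<notin> op_spectrum T" and w: "w \<notin> op_spectrum T"
  shows "resolvent T z - resolvent T w = (w - z) *\<^sub>C (resolvent T z o\<^sub>L resolvent T w)"
proof -
  let ?Z = "resolvent T z" and ?W = "resolvent T w"
  have "?Z - ?W = (?Z o\<^sub>L ((w *\<^sub>C id_blinfun - T) o\<^sub>L ?W))
      - ((?Z o\<^sub>L (z *\<^sub>C id_blinfun - T)) o\<^sub>L ?W)"
    by (simp only: resolvent_inverse(1)[OF z] resolvent_inverse(2)[OF w] compose_id)
  also have "\<dots> = ?Z o\<^sub>L (((w *\<^sub>C id_blinfun - T) - (z *\<^sub>C id_blinfun - T)) o\<^sub>L ?W)"
    by (simp only: compose_assoc compose.diff_left compose.diff_right)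
  also have "(w *\<^sub>C id_blinfun - T) - (z *\<^sub>C id_blinfun - T) = (w - z) *\<^sub>C id_blinfun"
    by (simp add: scaleC.diff_left)
  also have "?Z o\<^sub>L ((w - z) *\<^sub>C id_blinfun o\<^sub>L ?W) = (w - z) *\<^sub>C (?Z o\<^sub>L ?W)"
    using T z by (simp add: scaleC_compose compose_scaleC complex_linear_op_resolvent)
  finally show ?thesis .
qed

lemma continuous_on_resolvent:
  fixes T :: "'a::complex_banach \<Rightarrow>\<^sub>L 'a"
  assumes T: "complex_linear_op T"
  shows "continuous_on (- op_spectrum T) (resolvent T)"
proof -
  have "isCont (resolvent T) w" if w: "w \<notin> op_spectrum T" for w
  proof -
    obtain r where r: "r > 0" "\<And>z. z \<in> ball w r \<Longrightarrow> z \<notin> op_spectrum T"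
      "\<And>z. z \<in> ball w r \<Longrightarrow> norm (resolvent T z) \<le> 2 * norm (resolvent T w)"
      using resolvent_perturbation_ball[OF T w] by metis
    define K where "K = 2 * norm (resolvent T w) * norm (resolvent T w)"
    have "norm (resolvent T z - resolvent T w) \<le> norm (z - w) * K" if "z \<in> ball w r" for z
    proof -
      have "norm (resolvent T z - resolvent T w)
          \<le> norm (w - z) * (norm (resolvent T z) * norm (resolvent T w))"
        unfolding resolvent_identity[OF T r(2)[OF that] w] norm_scaleC
        by (intro mult_left_mono norm_blinfun_compose) simp
      also have "\<dots> \<le> norm (w - z) * K"
        unfolding K_def using r(3)[OF that] by (intro mult_left_mono mult_right_mono) auto
      finally show ?thesis
        by (simp add: norm_minus_commute)
    qed
    moreover have "\<forall>\<^sub>F z in at w. z \<in> ball w r"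
      using r(1) by (intro eventually_at_in_open') auto
    ultimately have "\<forall>\<^sub>F z in at w. norm (resolvent T z - resolvent T w) \<le> norm (z - w) * K"
      by (auto elim: eventually_mono)
    moreover have "((\<lambda>z. norm (z - w) * K) \<longlongrightarrow> 0) (at w)"
      by (auto intro!: tendsto_eq_intros)
    ultimately have "((\<lambda>z. resolvent T z - resolvent T w) \<longlongrightarrow> 0) (at w)"
      by (rule Lim_null_comparison)
    then show ?thesis
      by (simp add: isCont_def LIM_zero_iff)
  qed
  then show ?thesis
    by (intro continuous_at_imp_continuous_on) auto
qed

lemma holomorphic_resolvent:
  fixes T :: "'a::complex_banach \<Rightarrow>\<^sub>L 'a"
  assumes T: "complex_linear_op T" and l: "complex_functional l"
  shows "(\<lambda>z. l (resolvent T z)) holomorphic_on - op_spectrum T"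
proof -
  interpret l: bounded_linear l
    using l by (simp add: complex_functional_def)
  have "((\<lambda>z. l (resolvent T z)) has_field_derivative - l (resolvent T w o\<^sub>L resolvent T w)) (at w)"
    if w: "w \<in> - op_spectrum T" for w
    unfolding has_field_derivative_iff
  proof (rule Lim_transform_eventually)
    have "isCont (resolvent T) w"
      using continuous_on_resolvent[OF T] open_resolvent_set[OF T] w
      by (simp add: continuous_on_eq_continuous_at)
    then show "((\<lambda>z. - l (resolvent T z o\<^sub>L resolvent T w)) \<longlongrightarrow> - l (resolvent T w o\<^sub>L resolvent T w)) (at w)"
      by (intro tendsto_minus l.tendsto compose.tendsto tendsto_const) (simp add: isCont_def)
    have "\<forall>\<^sub>F z in at w. z \<in> - op_spectrum T - {w}"
      using open_resolvent_set[OF T] w by (intro eventually_at_in_open)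
    then show "\<forall>\<^sub>F z in at w. - l (resolvent T z o\<^sub>L resolvent T w)
        = (l (resolvent T z) - l (resolvent T w)) / (z - w)"
    proof (rule eventually_mono)
      fix z assume z: "z \<in> - op_spectrum T - {w}"
      have "l (resolvent T z) - l (resolvent T w) = l (resolvent T z - resolvent T w)"
        by (simp add: l.diff)
      also have "\<dots> = (w - z) * l (resolvent T z o\<^sub>L resolvent T w)"
        using resolvent_identity[OF T, of z w] l z w by (simp add: complex_functional_def)
      finally show "- l (resolvent T z o\<^sub>L resolvent T w)
          = (l (resolvent T z) - l (resolvent T w)) / (z - w)"
        using z by (simp add: field_simps)
    qed
  qed
  then show ?thesis
    using open_resolvent_set[OF T] by (subst holomorphic_on_open) blast+
qed

lemma weak_extension_resolvent:
  fixes T :: "'a::complex_banach \<Rightarrow>\<^sub>L 'a"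
  assumes "complex_linear_op T"
  shows "weak_extension (- op_spectrum T) (- op_spectrum T) (resolvent T)"
  unfolding weak_extension_def using holomorphic_resolvent[OF assms] by blast

text \<open>From (z - T) R(z) = I one gets R(z) - I / z = T R(z) / z, and R(z) is at most
  \<open>2 / norm z\<close> once \<open>norm z\<close> exceeds twice the norm of \<open>T\<close>.
  The \<open>+ 1\<close> keeps \<open>z\<close> away from \<open>0\<close> when
  \<open>T = 0\<close>.\<close>

lemma resolvent_at_infinity:
  fixes T :: "'a::complex_banach \<Rightarrow>\<^sub>L 'a"
  assumes T: "complex_linear_op T" and z: "norm z \<ge> 2 * norm T + 1"
  shows "z \<notin> op_spectrum T"
    and "norm (resolvent T z - (1 / z) *\<^sub>C id_blinfun) \<le> 2 * norm T / norm z ^ 2"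
proof -
  have "norm z > 0"
    using z norm_ge_zero[of T] by linarith
  then have z0: "z \<noteq> 0" "norm z > 0"
    by auto
  have pow: "norm (op_power T n) \<le> 1 * norm T ^ n" for n
    by (simp add: norm_op_power_le)
  have "norm T < norm z"
    using z norm_ge_zero[of T] by linarith
  note N = Neumann_resolvent[OF T pow norm_ge_zero this]
  have zT: "z \<notin> op_spectrum T" and "norm (resolvent T z) \<le> 1 / (norm z - norm T)"
    by (rule N)+
  moreover have "1 / (norm z - norm T) \<le> 1 / (norm z / 2)"
    using z z0 norm_ge_zero[of T] by (intro divide_left_mono mult_pos_pos; linarith)
  ultimately have R: "norm (resolvent T z) \<le> 2 / norm z"
    by simp
  show "z \<notin> op_spectrum T"
    by (rule zT)
  have "z *\<^sub>C resolvent T z - (T o\<^sub>L resolvent T z) = id_blinfun"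
    using resolvent_inverse(2)[OF zT] by (simp add: compose.diff_left scaleC_compose)
  then have "z *\<^sub>C resolvent T z = id_blinfun + (T o\<^sub>L resolvent T z)"
    by (simp add: algebra_simps)
  then have "(1 / z) *\<^sub>C z *\<^sub>C resolvent T z = (1 / z) *\<^sub>C (id_blinfun + (T o\<^sub>L resolvent T z))"
    by (rule arg_cong)
  then have "resolvent T z - (1 / z) *\<^sub>C id_blinfun = (1 / z) *\<^sub>C (T o\<^sub>L resolvent T z)"
    using z0 by (simp add: scaleC_scaleC scaleC_add_right diff_eq_eq add.commute)
  also have "norm \<dots> \<le> 1 / norm z * (norm T * (2 / norm z))"
    unfolding norm_scaleC
    using order_trans[OF norm_blinfun_compose mult_left_mono[OF R norm_ge_zero], of T]
    by (intro mult_mono) (auto simp: norm_divide)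
  also have "\<dots> = 2 * norm T / norm z ^ 2"
    by (simp add: power2_eq_square)
  finally show "norm (resolvent T z - (1 / z) *\<^sub>C id_blinfun) \<le> 2 * norm T / norm z ^ 2" .
qed

section \<open>Polynomials of operators\<close>

lemma op_poly_altdef:
  assumes "degree q \<le> n"
  shows "op_poly q T = (\<Sum>i\<le>n. coeff q i *\<^sub>C op_power T i)"
  unfolding op_poly_def
  by (rule sum.mono_neutral_left) (use assms in \<open>auto simp: coeff_eq_0 scaleC.zero_left\<close>)

lemma op_poly_0 [simp]: "op_poly 0 T = 0"
  by (simp add: op_poly_def scaleC.zero_left)

lemma complex_linear_op_poly [intro]: "complex_linear_op T \<Longrightarrow> complex_linear_op (op_poly q T)"
  unfolding op_poly_def by auto

lemma op_poly_pCons: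
  assumes T: "complex_linear_op T"
  shows "op_poly (pCons a q) T = a *\<^sub>C id_blinfun + (T o\<^sub>L op_poly q T)"
proof -
  have "op_poly (pCons a q) T = (\<Sum>i\<le>Suc (degree q). coeff (pCons a q) i *\<^sub>C op_power T i)"
    by (rule op_poly_altdef) (rule degree_pCons_le)
  also have "\<dots> = a *\<^sub>C id_blinfun + (\<Sum>i\<le>degree q. coeff q i *\<^sub>C op_power T (Suc i))"
    by (subst sum.atMost_Suc_shift) simp
  also have "(\<Sum>i\<le>degree q. coeff q i *\<^sub>C op_power T (Suc i)) = T o\<^sub>L op_poly q T"
    by (simp add: op_poly_def compose.sum_right compose_scaleC[OF T] op_power_Suc)
  finally show ?thesis .
qed

lemma op_poly_1 [simp]: "op_poly 1 T = id_blinfun"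
  by (simp add: op_poly_def)

lemma op_poly_add: "op_poly (q + r) T = op_poly q T + op_poly r T"
proof -
  define n where "n = max (degree q) (degree r)"
  have "degree (q + r) \<le> n" "degree q \<le> n" "degree r \<le> n"
    unfolding n_def by (auto intro: degree_add_le_max)
  then show ?thesis
    by (simp add: op_poly_altdef[of _ n] scaleC_add_left sum.distrib)
qed

lemma op_poly_smult: "op_poly (smult c q) T = c *\<^sub>C op_poly q T"
  by (subst op_poly_altdef[OF degree_smult_le])
    (simp add: op_poly_def scaleC.sum_right scaleC_scaleC)

lemma op_poly_sum: "op_poly (\<Sum>x\<in>A. f x) T = (\<Sum>x\<in>A. op_poly (f x) T)"
  by (induction A rule: infinite_finite_induct) (auto simp: op_poly_add)

lemma op_poly_mult:
  assumes T: "complex_linear_op T"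
  shows "op_poly (q * r) T = op_poly q T o\<^sub>L op_poly r T"
proof (induction q)
  case (pCons a q)
  have "op_poly (pCons a q * r) T = a *\<^sub>C op_poly r T + (T o\<^sub>L (op_poly q T o\<^sub>L op_poly r T))"
    by (simp add: mult_pCons_left op_poly_add op_poly_smult op_poly_pCons[OF T] pCons.IH scaleC.zero_left)
  then show ?case
    by (simp add: op_poly_pCons[OF T] compose.add_left scaleC_compose compose_assoc)
qed simp

lemma op_poly_power:
  "complex_linear_op T \<Longrightarrow> op_poly (q ^ n) T = op_power (op_poly q T) n"
  by (induction n) (simp_all add: op_poly_mult op_power_Suc)

lemma op_poly_commute:
  assumes T: "complex_linear_op T"
  shows "op_poly q T o\<^sub>L op_poly r T = op_poly r T o\<^sub>L op_poly q T"
  by (simp add: mult.commute flip: op_poly_mult[OF T])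

text \<open>Synthetic division by \<open>[:- z, 1:]\<close>, evaluated at \<open>T\<close>. Both
  orders of the factors are recorded because inverses have to be checked on both sides.\<close>

lemma op_poly_factor:
  assumes T: "complex_linear_op T"
  shows "poly q z *\<^sub>C id_blinfun - op_poly q T = op_poly (synthetic_div q z) T o\<^sub>L (z *\<^sub>C id_blinfun - T)"
    and "poly q z *\<^sub>C id_blinfun - op_poly q T = (z *\<^sub>C id_blinfun - T) o\<^sub>L op_poly (synthetic_div q z) T"
proof -
  have lin: "op_poly [:- z, 1:] T = T - z *\<^sub>C id_blinfun"
    by (simp add: op_poly_pCons[OF T] scaleC.minus_left)
  have "op_poly q T = op_poly ([:- z, 1:] * synthetic_div q z + [:poly q z:]) T"
    by (simp only: synthetic_div_correct')
  also have "\<dots> = ((T - z *\<^sub>C id_blinfun) o\<^sub>L op_poly (synthetic_div q z) T) + poly q z *\<^sub>C id_blinfun"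
    by (simp only: op_poly_add op_poly_mult[OF T] lin) (simp add: op_poly_pCons[OF T])
  finally show eq: "poly q z *\<^sub>C id_blinfun - op_poly q T
      = (z *\<^sub>C id_blinfun - T) o\<^sub>L op_poly (synthetic_div q z) T"
    by (simp add: compose.diff_left)
  have neg: "z *\<^sub>C id_blinfun - T = - (T - z *\<^sub>C id_blinfun)"
    by simp
  have "(T - z *\<^sub>C id_blinfun) o\<^sub>L op_poly (synthetic_div q z) T
      = op_poly (synthetic_div q z) T o\<^sub>L (T - z *\<^sub>C id_blinfun)"
    unfolding lin[symmetric] by (rule op_poly_commute[OF T])
  then show "poly q z *\<^sub>C id_blinfun - op_poly q T
      = op_poly (synthetic_div q z) T o\<^sub>L (z *\<^sub>C id_blinfun - T)"
    unfolding eq neg by (simp only: compose.minus_left compose.minus_right)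
qed

text \<open>An inverse \<open>V\<close> of q(z) - q(T) = D W = W D makes \<open>V D\<close> a left
  inverse and \<open>D V\<close> a right inverse of \<open>W\<close>, and a left and a right inverse
  coincide.\<close>

lemma spectral_mapping_op_poly:
  assumes T: "complex_linear_op T" and "poly q z \<notin> op_spectrum (op_poly q T)"
  shows "z \<notin> op_spectrum T"
proof -
  define D where "D = op_poly (synthetic_div q z) T"
  define V where "V = resolvent (op_poly q T) (poly q z)"
  define W where "W = z *\<^sub>C id_blinfun - T"
  have V: "V o\<^sub>L (D o\<^sub>L W) = id_blinfun" "(W o\<^sub>L D) o\<^sub>L V = id_blinfun"
    using resolvent_inverse[OF assms(2)]
    unfolding V_def D_def W_def op_poly_factor(1)[OF T, symmetric] op_poly_factor(2)[OF T, symmetric]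
    by auto
  then have "(V o\<^sub>L D) o\<^sub>L W = id_blinfun" "W o\<^sub>L (D o\<^sub>L V) = id_blinfun"
    by (simp_all only: compose_assoc)
  then have "(V o\<^sub>L D) o\<^sub>L W = id_blinfun" "W o\<^sub>L (V o\<^sub>L D) = id_blinfun"
    using inverse_op_unique by metis+
  then show ?thesis
    unfolding W_def by (rule resolventI(1))
qed

text \<open>The coefficients of \<open>synthetic_div q z\<close> are polynomials in
  \<open>z\<close>. The induction on \<open>q\<close> carries a left factor \<open>S\<close>, which
  collects the powers of \<open>T\<close> split off on the way.\<close>

lemma holomorphic_poly_quotient:
  assumes T: "complex_linear_op T" and l: "complex_functional l"
  shows "(\<lambda>z. l (op_poly (synthetic_div q z) T)) holomorphic_on UNIV"
proof -
  interpret l: bounded_linear l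
    using l by (simp add: complex_functional_def)
  have "(\<lambda>z. l (S o\<^sub>L op_poly (synthetic_div q z) T)) holomorphic_on UNIV" if "complex_linear_op S" for S
    using that
  proof (induction q arbitrary: S)
    case (pCons a q)
    have "l (S o\<^sub>L op_poly (synthetic_div (pCons a q) z) T)
        = poly q z * l S + l ((S o\<^sub>L T) o\<^sub>L op_poly (synthetic_div q z) T)" for z
      using l pCons.prems
      by (simp add: synthetic_div_pCons op_poly_pCons[OF T] compose.add_right compose_scaleC l.add
          complex_functional_def compose_assoc)
    then show ?case
      using pCons.prems T by (auto intro!: holomorphic_intros pCons.IH)
  qed (auto intro!: holomorphic_intros)
  from this[OF complex_linear_op_id] show ?thesis by simp
qed

section \<open>Multicentric representation\<close>

text \<open>Singularities are removed one at a time; the extension across \<open>a\<close> is still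
  bounded, now by the larger of the old bound and its value at \<open>a\<close>, so the induction
  goes on.\<close>

lemma removable_singularities_bounded:
  fixes f :: "complex \<Rightarrow> complex"
  assumes "finite K" "open S" "f holomorphic_on (S - K)" "bounded (f ` (S - K))"
  shows "\<exists>g. g holomorphic_on S \<and> (\<forall>z\<in>S - K. g z = f z)"
  using assms
proof (induction K arbitrary: f)
  case (insert a K)
  show ?case
  proof (cases "a \<in> S - K")
    case True
    have op: "open (S - K)"
      using insert.hyps insert.prems by (intro open_Diff finite_imp_closed) auto
    have eq: "S - insert a K = S - K - {a}"
      by auto
    obtain B where B: "\<And>z. z \<in> S - K - {a} \<Longrightarrow> norm (f z) \<le> B"
      using insert.prems(3) unfolding eq bounded_iff by blast
    have "\<forall>\<^sub>F z in at a. z \<in> S - K - {a}"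
      using op True by (intro eventually_at_in_open)
    then have "\<forall>\<^sub>F z in at a. norm (f z) \<le> B * norm (1::complex)"
      by (rule eventually_mono) (use B in auto)
    then have "f \<in> O[at a](\<lambda>_. 1)"
      by (rule bigoI)
    then obtain g where g: "g holomorphic_on (S - K)" "\<And>z. z \<in> S - K - {a} \<Longrightarrow> g z = f z"
      using holomorphic_on_extend[of f "S - K" a] insert.prems(2) True op
      by (auto simp: eq interior_open)
    have "norm (g z) \<le> max B (norm (g a))" if "z \<in> S - K" for z
      using B[of z] g(2)[of z] that by (cases "z = a") auto
    then have "bounded (g ` (S - K))"
      unfolding bounded_iff by blast
    then obtain h where "h holomorphic_on S" "\<And>z. z \<in> S - K \<Longrightarrow> h z = g z"
      using insert.IH[OF insert.prems(1) g(1)] by blast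
    then show ?thesis
      using g(2) by (intro exI[of _ h]) auto
  next
    case False
    then have "S - insert a K = S - K"
      by auto
    then show ?thesis
      using insert by simp
  qed
qed auto

section \<open>Divided differences and fibres of a polynomial\<close>

lemma poly_pderiv_factor:
  fixes p :: "complex poly"
  shows "poly (pderiv p) a = poly (synthetic_div p a) a"
proof -
  have "pderiv p = pderiv ([:- a, 1:] * synthetic_div p a + [:poly p a:])"
    by (simp only: synthetic_div_correct')
  also have "\<dots> = synthetic_div p a + [:- a, 1:] * pderiv (synthetic_div p a)"
    by (simp only: pderiv_add pderiv_mult) (simp add: pderiv_pCons)
  finally show ?thesis
    by simp
qed

lemma poly_synthetic_div:
  fixes p :: "complex poly"
  shows "poly p x = (x - a) * poly (synthetic_div p a) x + poly p a"
proof -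
  have "poly p x = poly ([:- a, 1:] * synthetic_div p a + [:poly p a:]) x"
    by (simp only: synthetic_div_correct')
  then show ?thesis
    by (simp add: algebra_simps)
qed

text \<open>For distinct points this value is the divided difference (p(b) - p(a)) / (b -
  a).\<close>

lemma synthetic_div_symmetric:
  fixes p :: "complex poly"
  shows "poly (synthetic_div p a) b = poly (synthetic_div p b) a"
proof (cases "a = b")
  case False
  have "(b - a) * (poly (synthetic_div p a) b - poly (synthetic_div p b) a) = 0"
    using poly_synthetic_div[of p b a] poly_synthetic_div[of p a b] by (simp add: algebra_simps)
  then show ?thesis
    using False by simp
qed simp

lemma finite_poly_fibre:
  fixes p :: "complex poly"
  assumes "degree p \<ge> 1"
  shows "finite {z. poly p z = w}" "card {z. poly p z = w} \<le> degree p"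
proof -
  have deg: "degree (p - [:w:]) = degree p"
    using assms degree_add_eq_left[of "[:- w:]" p] by (simp add: diff_conv_add_uminus del: add_uminus_conv_diff)
  then have "p - [:w:] \<noteq> 0"
    using assms by (metis degree_0 not_one_le_zero)
  from poly_roots_finite[OF this] card_poly_roots_bound[OF this]
  show "finite {z. poly p z = w}" "card {z. poly p z = w} \<le> degree p"
    by (simp_all add: deg)
qed

lemma card_regular_poly_fibre:
  fixes p :: "complex poly"
  assumes "degree p \<ge> 1" and reg: "\<And>z. poly p z = w \<Longrightarrow> poly (pderiv p) z \<noteq> 0"
  shows "card {z. poly p z = w} = degree p"
proof -
  define q where "q = p - [:w:]"
  have deg: "degree q = degree p"
    using assms(1) degree_add_eq_left[of "[:- w:]" p]
    by (simp add: q_def diff_conv_add_uminus del: add_uminus_conv_diff)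
  then have "q \<noteq> 0"
    using assms(1) by (metis degree_0 not_one_le_zero)
  have "rsquarefree q"
    using reg by (auto simp: rsquarefree_roots q_def pderiv_diff pderiv_pCons)
  then have "smult (lead_coeff q) (\<Prod>z | poly q z = 0. [:- z, 1:]) = q"
    by (rule complex_poly_decompose_rsquarefree)
  then have "degree q = degree (\<Prod>z | poly q z = 0. [:- z, 1:])"
    using \<open>q \<noteq> 0\<close> by (metis degree_smult_eq leading_coeff_0_iff)
  also have "\<dots> = card {z. poly q z = 0}"
    by (subst degree_prod_eq_sum_degree) auto
  finally show ?thesis
    using deg by (simp add: q_def)
qed

text \<open>Near a regular value, the points of the fibre move holomorphically with speed
  \<open>1 / poly (pderiv p) z\<close>.\<close>

lemma has_field_derivative_sum_poly_fibre:
  fixes p :: "complex poly" and u :: "complex \<Rightarrow> complex"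
  assumes deg: "degree p \<ge> 1"
    and reg: "\<And>z. poly p z = w0 \<Longrightarrow> poly (pderiv p) z \<noteq> 0"
    and u: "\<And>z. poly p z = w0 \<Longrightarrow> (u has_field_derivative u' z) (at z)"
  shows "((\<lambda>w. \<Sum>z | poly p z = w. u z) has_field_derivative
    (\<Sum>z | poly p z = w0. u' z / poly (pderiv p) z)) (at w0)"
proof -
  define Z where "Z w = {z. poly p z = w}" for w
  have finZ: "finite (Z w)" for w
    unfolding Z_def by (rule finite_poly_fibre[OF deg])
  have hol: "poly p holomorphic_on S" for S
    by (intro holomorphic_intros)
  have "\<exists>r>0. inj_on (poly p) (ball z r)" if "z \<in> Z w0" for z
  proof -
    have "deriv (poly p) z = poly (pderiv p) z"
      by (rule DERIV_imp_deriv[OF poly_DERIV])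
    then show ?thesis
      using has_complex_derivative_locally_injective[OF hol UNIV_I open_UNIV, of z] reg[of z] that
      by (auto simp: Z_def)
  qed
  then obtain r where r: "\<And>z. z \<in> Z w0 \<Longrightarrow> r z > 0"
    "\<And>z. z \<in> Z w0 \<Longrightarrow> inj_on (poly p) (ball z (r z))"
    by metis
  \<comment> \<open>\<open>s z\<close> is the local branch of the inverse of \<open>p\<close> that
    passes through \<open>z\<close>.\<close>
  define s where "s z = the_inv_into (ball z (r z)) (poly p)" for z
  have s_w0: "s z w0 = z" if "z \<in> Z w0" for z
    using r[OF that] that the_inv_into_f_f[of "poly p" "ball z (r z)" z] by (simp add: s_def Z_def)
  have s': "(s z has_field_derivative 1 / poly (pderiv p) z) (at w0)" if z: "z \<in> Z w0" for z
  proof -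
    have "(s z has_field_derivative inverse (poly (pderiv p) z)) (at (poly p z))"
    proof (rule has_field_derivative_inverse_strong[OF poly_DERIV])
      show "poly (pderiv p) z \<noteq> 0"
        using reg[of z] z by (simp add: Z_def)
      show "s z (poly p x) = x" if "x \<in> ball z (r z)" for x
        unfolding s_def using r(2)[OF z] that by (rule the_inv_into_f_f)
    qed (use r(1)[OF z] in \<open>auto intro!: continuous_intros\<close>)
    then show ?thesis
      using z by (simp add: Z_def inverse_eq_divide)
  qed
  have s_lim: "(s z \<longlongrightarrow> z) (nhds w0)" if "z \<in> Z w0" for z
  proof -
    have "(s z \<longlongrightarrow> s z w0) (nhds w0)"
      using DERIV_isCont[OF s'[OF that]] by (simp only: isCont_def tendsto_at_iff_tendsto_nhds)
    then show ?thesis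
      by (simp only: s_w0[OF that])
  qed
  have "\<forall>\<^sub>F w in nhds w0. poly p (s z w) = w" if z: "z \<in> Z w0" for z
  proof -
    have "open (poly p ` ball z (r z))"
      by (rule open_mapping_thm3[OF hol open_ball r(2)[OF z]])
    moreover have "w0 \<in> poly p ` ball z (r z)"
      using z r(1)[OF z] by (auto simp: Z_def intro!: image_eqI[of _ _ z])
    ultimately have "\<forall>\<^sub>F w in nhds w0. w \<in> poly p ` ball z (r z)"
      by (rule eventually_nhds_in_open)
    then show ?thesis
      by (rule eventually_mono) (auto simp: s_def f_the_inv_into_f[OF r(2)[OF z]])
  qed
  then have ev1: "\<forall>\<^sub>F w in nhds w0. \<forall>z\<in>Z w0. poly p (s z w) = w"
    by (intro eventually_ball_finite finZ) auto
  have "\<forall>\<^sub>F w in nhds w0. a \<noteq> b \<longrightarrow> s a w \<noteq> s b w" if "a \<in> Z w0" "b \<in> Z w0" for a b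
  proof (cases "a = b")
    case False
    then have "\<forall>\<^sub>F w in nhds w0. s a w - s b w \<noteq> 0"
      using tendsto_imp_eventually_ne[OF tendsto_diff[OF s_lim s_lim], of a b 0] that by simp
    then show ?thesis
      by (rule eventually_mono) simp
  qed simp
  then have ev2: "\<forall>\<^sub>F w in nhds w0. \<forall>a\<in>Z w0. \<forall>b\<in>Z w0. a \<noteq> b \<longrightarrow> s a w \<noteq> s b w"
    by (intro eventually_ball_finite finZ ballI)
  have card: "card (Z w0) = degree p"
    unfolding Z_def using deg reg by (rule card_regular_poly_fibre)
  \<comment> \<open>The branches provide \<open>degree p\<close> distinct points over
    \<open>w\<close>, as many as a fibre can have, so they exhaust it.\<close>
  have ev: "\<forall>\<^sub>F w in nhds w0. (\<Sum>z\<in>Z w. u z) = (\<Sum>z\<in>Z w0. u (s z w))"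
    using ev1 ev2
  proof eventually_elim
    case (elim w)
    then have inj: "inj_on (\<lambda>z. s z w) (Z w0)"
      unfolding inj_on_def by blast
    have sub: "(\<lambda>z. s z w) ` Z w0 \<subseteq> Z w"
      using elim(1) by (auto simp: Z_def)
    have "card (Z w) \<le> card ((\<lambda>z. s z w) ` Z w0)"
      using card_image[OF inj] card finite_poly_fibre(2)[OF deg] by (simp add: Z_def)
    then have "(\<lambda>z. s z w) ` Z w0 = Z w"
      by (rule card_seteq[OF finZ sub])
    then show ?case
      using sum.reindex[OF inj, of u] by simp
  qed
  have "((\<lambda>w. \<Sum>z\<in>Z w0. u (s z w)) has_field_derivative
      (\<Sum>z\<in>Z w0. u' z * (1 / poly (pderiv p) z))) (at w0)"
  proof (intro DERIV_sum DERIV_chain2[where f = u] s')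
    fix z assume z: "z \<in> Z w0"
    then show "(u has_field_derivative u' z) (at (s z w0))"
      using u by (simp add: s_w0) (simp add: Z_def)
  qed
  then have "((\<lambda>w. \<Sum>z\<in>Z w. u z) has_field_derivative
      (\<Sum>z\<in>Z w0. u' z * (1 / poly (pderiv p) z))) (at w0)"
    using DERIV_cong_ev[OF refl ev refl] by blast
  then show ?thesis
    by (simp add: Z_def)
qed

lemma bounded_poly_sublevel:
  fixes p :: "complex poly"
  assumes "degree p \<ge> 1"
  shows "bounded {z. cmod (poly p z) \<le> r}"
proof -
  obtain a q where aq: "p = pCons a q"
    by (cases p)
  then have "q \<noteq> 0"
    using assms by auto
  then obtain b where b: "\<And>z. b \<le> cmod z \<Longrightarrow> r + 1 \<le> cmod (poly p z)"
    using poly_infinity[of q "r + 1" a] aq by auto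
  have "cmod z \<le> b" if "cmod (poly p z) \<le> r" for z
    using that b[of z] by linarith
  then show ?thesis
    unfolding bounded_iff by blast
qed

text \<open>The function \<phi> is described on the open set |p| < \<rho> alone. Local constancy
  makes its derivative vanish when fibre sums are differentiated; the bound \<open>1\<close> keeps
  these sums bounded near critical values.\<close>

locale multicentric_setup =
  fixes p :: "complex poly" and d :: nat and lam :: "nat \<Rightarrow> complex"
    and \<rho> :: real and \<phi> :: "complex \<Rightarrow> complex"
  assumes d: "d \<ge> 1" "degree p = d" and inj: "inj_on lam {1..d}"
    and roots: "{z. poly p z = 0} = lam ` {1..d}"
    and \<rho>: "\<rho> > 0"
    and loc_const: "\<And>z. cmod (poly p z) < \<rho> \<Longrightarrow> \<forall>\<^sub>F u in nhds z. \<phi> u = \<phi> z"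
    and phi_le: "\<And>z. cmod (poly p z) < \<rho> \<Longrightarrow> cmod (\<phi> z) \<le> 1"
begin

abbreviation "\<delta> \<equiv> lagrange_poly d lam"

definition lemniscate :: "complex set"
  where "lemniscate = {z. cmod (poly p z) < \<rho>}"

lemma open_lemniscate: "open lemniscate"
  unfolding lemniscate_def by (intro open_Collect_less continuous_intros)

lemma bounded_lemniscate: "bounded lemniscate"
proof (rule bounded_subset)
  show "bounded {z. cmod (poly p z) \<le> \<rho>}"
    using d by (intro bounded_poly_sublevel) simp
qed (auto simp: lemniscate_def)

lemma card_roots: "card (lam ` {1..d}) = d"
  using card_image[OF inj] by simp

lemma poly_root [simp]: "j \<in> {1..d} \<Longrightarrow> poly p (lam j) = 0"
  using roots by blast

lemma root_in_lemniscate [simp]: "j \<in> {1..d} \<Longrightarrow> lam j \<in> lemniscate"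
  using \<rho> by (simp add: lemniscate_def)

text \<open>At a multiple root, \<open>synthetic_div p (lam j)\<close>, of degree
  \<open>d - 1\<close>, would vanish at \<open>lam j\<close> too and so have all \<open>d\<close>
  roots of \<open>p\<close>.\<close>

lemma simple_root:
  assumes j: "j \<in> {1..d}"
  shows "poly (pderiv p) (lam j) \<noteq> 0"
proof
  assume "poly (pderiv p) (lam j) = 0"
  then have q: "poly (synthetic_div p (lam j)) (lam j) = 0"
    by (simp add: poly_pderiv_factor)
  have "lam k \<in> {z. poly (synthetic_div p (lam j)) z = 0}" if "k \<in> {1..d}" for k
  proof (cases "lam k = lam j")
    case False
    then show ?thesis
      using poly_synthetic_div[of p "lam k" "lam j"] that j by simp
  qed (use q in simp)
  then have sub: "lam ` {1..d} \<subseteq> {z. poly (synthetic_div p (lam j)) z = 0}"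
    by blast
  have nz: "synthetic_div p (lam j) \<noteq> 0"
    using d by (simp add: synthetic_div_eq_0_iff)
  have "d \<le> card {z. poly (synthetic_div p (lam j)) z = 0}"
    using card_mono[OF poly_roots_finite[OF nz] sub] card_roots by simp
  also have "\<dots> \<le> d - 1"
    using card_poly_roots_bound[OF nz] d by (simp add: degree_synthetic_div)
  finally show False
    using d by simp
qed

lemma lagrange_poly_root:
  assumes "j \<in> {1..d}" "k \<in> {1..d}"
  shows "poly (\<delta> j) (lam k) = (if k = j then 1 else 0)"
proof (cases "k = j")
  case True
  have "poly (smult (1 / (lam j - lam i)) [:- lam i, 1:]) (lam j) = 1" if "i \<in> {1..d} - {j}" for i
  proof -
    have "lam j - lam i \<noteq> 0"
      using inj_onD[OF inj, of j i] assms(1) that by auto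
    then show ?thesis
      by (simp add: diff_divide_distrib[symmetric])
  qed
  then have "(\<Prod>i\<in>{1..d} - {j}. poly (smult (1 / (lam j - lam i)) [:- lam i, 1:]) (lam j)) = 1"
    by (intro prod.neutral ballI)
  then show ?thesis
    unfolding lagrange_poly_def poly_prod True by (simp only: if_True simp_thms)
next
  case False
  then show ?thesis
    using assms unfolding lagrange_poly_def poly_prod
    by (simp only: if_False) (intro prod_zero bexI[of _ k]; simp)
qed

lemma degree_lagrange_poly:
  assumes "j \<in> {1..d}"
  shows "degree (\<delta> j) < d"
proof -
  have "degree (\<delta> j) \<le> sum (degree \<circ> (\<lambda>k. smult (1 / (lam j - lam k)) [:- lam k, 1:])) ({1..d} - {j})"
    unfolding lagrange_poly_def by (intro degree_prod_sum_le) auto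
  also have "\<dots> \<le> (\<Sum>k\<in>{1..d} - {j}. 1)"
    by (intro sum_mono) auto
  also have "\<dots> < d"
    using assms by auto
  finally show ?thesis .
qed

lemma lagrange_interpolation:
  assumes "degree q < d"
  shows "(\<Sum>j=1..d. poly (\<delta> j) z * poly q (lam j)) = poly q z"
proof -
  define r where "r = (\<Sum>j=1..d. smult (poly q (lam j)) (\<delta> j))"
  have "r = q"
  proof (rule poly_eqI_degree)
    show "poly r x = poly q x" if x: "x \<in> lam ` {1..d}" for x
    proof -
      obtain k where k: "k \<in> {1..d}" "x = lam k"
        using x by blast
      have "poly r x = (\<Sum>j=1..d. if k = j then poly q (lam j) else 0)"
        unfolding r_def poly_sum using k by (intro sum.cong refl) (simp add: lagrange_poly_root)
      also have "\<dots> = poly q x"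
        using k by simp
      finally show ?thesis .
    qed
    have "degree (smult (poly q (lam j)) (\<delta> j)) < d" if "j \<in> {1..d}" for j
      using degree_smult_le degree_lagrange_poly[OF that] by (rule order_le_less_trans)
    then show "degree r < card (lam ` {1..d})"
      unfolding r_def card_roots using d by (intro degree_sum_less) auto
    show "degree q < card (lam ` {1..d})"
      using assms by (simp only: card_roots)
  qed
  then have "poly q z = poly r z"
    by simp
  also have "\<dots> = (\<Sum>j=1..d. poly (\<delta> j) z * poly q (lam j))"
    by (simp add: r_def poly_sum mult.commute)
  finally show ?thesis ..
qed

text \<open>As a polynomial in \<open>a\<close> the divided difference of \<open>p\<close> has
  degree \<open>d - 1\<close> and is reproduced by interpolation. For \<open>a\<close> and
  \<open>z\<close> in one fibre it is \<open>0\<close> when they differ and the derivative of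
  \<open>p\<close> when they agree, so this identity inverts the linear system for the
  components.\<close>

lemma sum_lagrange_quotient:
  "(\<Sum>j=1..d. poly (\<delta> j) a * poly (synthetic_div p (lam j)) z) = poly (synthetic_div p z) a"
  using lagrange_interpolation[of "synthetic_div p z" a] d
  by (simp add: synthetic_div_symmetric[of p z] degree_synthetic_div)

text \<open>At a regular value \<open>w\<close> the components are forced to be
  \<open>\<Sum>z | poly p z = w. \<phi> z * poly (synthetic_div p (lam j)) z / poly (pderiv p) z\<close>. As
  \<open>\<phi>\<close> is locally constant, this is the derivative of
  \<open>\<Sum>z | poly p z = w. \<phi> z * P z\<close> for a primitive \<open>P\<close> of the quotient polynomial. The
  latter is bounded, so its singularities at the critical values are removable.\<close>

theorem multicentric_representation:
  obtains f where "\<And>j. f j holomorphic_on ball 0 \<rho>"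
    "\<And>z. z \<in> lemniscate \<Longrightarrow> \<phi> z = (\<Sum>j=1..d. poly (\<delta> j) z * f j (poly p z))"
proof -
  define q where "q j = synthetic_div p (lam j)" for j
  define crit where "crit = poly p ` {z. poly (pderiv p) z = 0}"
  have "pderiv p \<noteq> 0"
    using d by (simp add: pderiv_eq_0_iff)
  then have fin_crit: "finite crit"
    unfolding crit_def by (intro finite_imageI poly_roots_finite)
  have reg: "poly (pderiv p) z \<noteq> 0" if "poly p z = w" "w \<notin> crit" for z w
    using that by (auto simp: crit_def)
  have "\<exists>P. \<forall>z. (P has_field_derivative poly (q j) z) (at z)" for j
  proof -
    have "poly (q j) holomorphic_on UNIV"
      by (intro holomorphic_intros)
    then show ?thesis
      using holomorphic_convex_primitive'[OF convex_UNIV open_UNIV] by (metis UNIV_I)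
  qed
  then obtain P where P: "\<And>j z. (P j has_field_derivative poly (q j) z) (at z)"
    by metis
  define F where "F j w = (\<Sum>z | poly p z = w. \<phi> z * P j z)" for j w
  define g where "g j w = (\<Sum>z | poly p z = w. \<phi> z * poly (q j) z / poly (pderiv p) z)" for j w
  have F': "(F j has_field_derivative g j w) (at w)" if w: "w \<in> ball 0 \<rho> - crit" for j w
    unfolding F_def[abs_def] g_def
  proof (rule has_field_derivative_sum_poly_fibre)
    show "degree p \<ge> 1"
      using d by simp
    show "poly (pderiv p) z \<noteq> 0" if "poly p z = w" for z
      using reg that w by blast
    fix z assume "poly p z = w"
    then have "cmod (poly p z) < \<rho>"
      using w by simp
    from loc_const[OF this] have ev: "\<forall>\<^sub>F u in nhds z. \<phi> u * P j u = \<phi> z * P j z + \<phi> z * (P j u - P j z)"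
      by (rule eventually_mono) (simp add: algebra_simps)
    have "((\<lambda>u. \<phi> z * P j z + \<phi> z * (P j u - P j z)) has_field_derivative \<phi> z * poly (q j) z) (at z)"
      by (auto intro!: derivative_eq_intros P)
    then show "((\<lambda>u. \<phi> u * P j u) has_field_derivative \<phi> z * poly (q j) z) (at z)"
      by (simp only: DERIV_cong_ev[OF refl ev refl])
  qed
  have "bounded lemniscate"
    by (rule bounded_lemniscate)
  have "\<exists>G. G holomorphic_on ball 0 \<rho> \<and> (\<forall>w\<in>ball 0 \<rho> - crit. G w = F j w)" for j
  proof (rule removable_singularities_bounded[OF fin_crit open_ball])
    have "open (ball 0 \<rho> - crit)"
      using fin_crit by (intro open_Diff open_ball finite_imp_closed)
    then show "F j holomorphic_on ball 0 \<rho> - crit"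
      using F' by (subst holomorphic_on_open) blast+
    have "continuous_on (closure lemniscate) (P j)"
      using P by (intro continuous_at_imp_continuous_on ballI) (rule DERIV_isCont)
    then have "bounded (P j ` closure lemniscate)"
      using \<open>bounded lemniscate\<close> by (intro compact_imp_bounded compact_continuous_image) auto
    then obtain B where B: "\<And>z. z \<in> lemniscate \<Longrightarrow> norm (P j z) \<le> B" "B > 0"
      using closure_subset[of lemniscate] unfolding bounded_pos by blast
    have "norm (F j w) \<le> of_nat d * B" if "w \<in> ball 0 \<rho>" for w
    proof -
      have "norm (F j w) \<le> (\<Sum>z | poly p z = w. B)"
        unfolding F_def
      proof (rule sum_norm_le)
        fix z assume "z \<in> {z. poly p z = w}"
        then have z: "cmod (poly p z) < \<rho>"
          using that by simp
        have "norm (\<phi> z * P j z) \<le> 1 * B"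
          unfolding norm_mult using B z by (intro mult_mono phi_le) (auto simp: lemniscate_def)
        then show "norm (\<phi> z * P j z) \<le> B"
          by simp
      qed
      also have "\<dots> \<le> of_nat d * B"
        using finite_poly_fibre(2)[of p w] d B(2) by (simp add: mult_right_mono)
      finally show ?thesis .
    qed
    then show "bounded (F j ` (ball 0 \<rho> - crit))"
      unfolding bounded_iff by blast
  qed
  then obtain G where G: "\<And>j. G j holomorphic_on ball 0 \<rho>"
    "\<And>j w. w \<in> ball 0 \<rho> - crit \<Longrightarrow> G j w = F j w"
    by metis
  define f where "f j = deriv (G j)" for j
  have hol_f: "f j holomorphic_on ball 0 \<rho>" for j
    unfolding f_def by (intro holomorphic_deriv G) auto
  have fg: "f j w = g j w" if w: "w \<in> ball 0 \<rho> - crit" for j w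
  proof -
    have "open (ball 0 \<rho> - crit)"
      using fin_crit by (intro open_Diff open_ball finite_imp_closed)
    then have "\<forall>\<^sub>F x in nhds w. x \<in> ball 0 \<rho> - crit"
      using w by (rule eventually_nhds_in_open)
    then have ev: "\<forall>\<^sub>F x in nhds w. G j x = F j x"
      by (rule eventually_mono) (rule G(2))
    have "(G j has_field_derivative g j w) (at w)"
      using F'[OF w, of j] by (simp only: DERIV_cong_ev[OF refl ev refl])
    then show ?thesis
      unfolding f_def by (rule DERIV_imp_deriv)
  qed
  define R where "R z = (\<Sum>j=1..d. poly (\<delta> j) z * f j (poly p z))" for z
  have R_reg: "R z = \<phi> z" if z: "z \<in> lemniscate" "poly p z \<notin> crit" for z
  proof -
    define w where "w = poly p z"
    have w: "w \<in> ball 0 \<rho> - crit"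
      using z by (simp add: w_def lemniscate_def)
    have fin: "finite {y. poly p y = w}"
      using finite_poly_fibre(1)[of p w] d by simp
    have "R z = (\<Sum>j=1..d. \<Sum>y | poly p y = w. \<phi> y / poly (pderiv p) y * (poly (\<delta> j) z * poly (q j) y))"
      unfolding R_def w_def[symmetric] using w
      by (simp add: fg g_def sum_distrib_left algebra_simps)
    also have "\<dots> = (\<Sum>y | poly p y = w. \<phi> y / poly (pderiv p) y * (\<Sum>j=1..d. poly (\<delta> j) z * poly (q j) y))"
      by (subst sum.swap) (simp add: sum_distrib_left)
    also have "\<dots> = (\<Sum>y | poly p y = w. if y = z then \<phi> z else 0)"
    proof (intro sum.cong refl)
      fix y assume "y \<in> {y. poly p y = w}"
      then have y: "poly p y = w" by simp
      have "(\<Sum>j=1..d. poly (\<delta> j) z * poly (q j) y) = poly (synthetic_div p y) z"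
        unfolding q_def by (rule sum_lagrange_quotient)
      also have "\<dots> = (if y = z then poly (pderiv p) z else 0)"
        using poly_synthetic_div[of p z y] y by (auto simp: poly_pderiv_factor w_def)
      finally show "\<phi> y / poly (pderiv p) y * (\<Sum>j=1..d. poly (\<delta> j) z * poly (q j) y) = (if y = z then \<phi> z else 0)"
        using reg[OF y] w by (cases "y = z") auto
    qed
    also have "\<dots> = \<phi> z"
      using fin by (simp add: w_def)
    finally show ?thesis .
  qed
  \<comment> \<open>The points over critical values are finitely many, \<open>R\<close> is
    continuous and \<phi> is constant near \<open>z\<close>, so the identity passes to the
    exceptional points in the limit.\<close>
  have "\<phi> z = R z" if z: "z \<in> lemniscate" for z
  proof -
    have "R holomorphic_on lemniscate"
      unfolding R_def using hol_f
      by (intro holomorphic_intros holomorphic_on_compose_gen[OF _ hol_f, unfolded o_def])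
        (auto simp: lemniscate_def)
    then have contR: "(R \<longlongrightarrow> R z) (at z)"
      using z open_lemniscate holomorphic_on_imp_continuous_on[of R lemniscate]
      by (simp add: continuous_on_eq_continuous_at isCont_def)
    define bad where "bad = (\<Union>w\<in>crit. {y. poly p y = w})"
    have "finite bad"
      unfolding bad_def using fin_crit finite_poly_fibre(1)[of p] d by (intro finite_UN_I) auto
    then have "open (lemniscate - (bad - {z}))"
      using open_lemniscate by (intro open_Diff finite_imp_closed) auto
    then have "\<forall>\<^sub>F y in at z. y \<in> lemniscate - (bad - {z}) - {z}"
      using z by (intro eventually_at_in_open) auto
    moreover have "\<forall>\<^sub>F y in at z. \<phi> y = \<phi> z"
      using loc_const[of z] z unfolding eventually_at_filter
      by (auto simp: lemniscate_def elim: eventually_mono)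
    ultimately have "\<forall>\<^sub>F y in at z. R y = \<phi> z"
    proof eventually_elim
      case (elim y)
      then show ?case
        using R_reg[of y] by (auto simp: bad_def)
    qed
    then have "(R \<longlongrightarrow> \<phi> z) (at z)"
      by (rule tendsto_eventually)
    then show ?thesis
      using contR tendsto_unique by (metis trivial_limit_at)
  qed
  then show thesis
    using that[of f] hol_f by (simp add: R_def)
qed

section \<open>Derivatives of the components at 0\<close>

lemma higher_deriv_poly: "(deriv ^^ n) (poly q) = poly ((pderiv ^^ n) q)"
  for q :: "complex poly"
proof (induction n)
  case (Suc n)
  then show ?case
    by (auto intro!: DERIV_imp_deriv)
qed auto

lemma chain_poly_above: "n < m \<Longrightarrow> chain_poly p n m = 0"
  by (induction p n m rule: chain_poly.induct) auto

lemma chain_poly_diag: "chain_poly p n n = pderiv p ^ n"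
  by (induction n) (auto simp: chain_poly_above)

lemma pderiv_chain_poly_0: "pderiv (chain_poly p n 0) = 0"
  by (cases n) (auto simp: pderiv_1)

text \<open>Differentiating one product of \<open>chain_poly p n l\<close> with the
  \<open>l\<close>-th derivative of \<open>f\<close> at \<open>poly p z\<close> feeds index
  \<open>l\<close> through its own derivative and index \<open>Suc l\<close> through the inner
  derivative; this is the recursion of \<open>chain_poly\<close>.\<close>

lemma higher_deriv_compose_poly:
  assumes f: "f holomorphic_on ball 0 \<rho>" and z: "z \<in> lemniscate"
  shows "(deriv ^^ n) (\<lambda>z. f (poly p z)) z
    = (\<Sum>l\<le>n. poly (chain_poly p n l) z * (deriv ^^ l) f (poly p z))"
  using z
proof (induction n arbitrary: z)
  case (Suc n)
  let ?c = "\<lambda>n l. poly (chain_poly p n l)" and ?f = "\<lambda>l. (deriv ^^ l) f"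
  have "\<forall>\<^sub>F u in nhds z. u \<in> lemniscate"
    using open_lemniscate Suc.prems by (rule eventually_nhds_in_open)
  then have ev: "\<forall>\<^sub>F u in nhds z. (deriv ^^ n) (\<lambda>z. f (poly p z)) u = (\<Sum>l\<le>n. ?c n l u * ?f l (poly p u))"
    by (rule eventually_mono) (rule Suc.IH)
  have f': "(?f l has_field_derivative ?f (Suc l) (poly p z)) (at (poly p z))" for l
    using holomorphic_derivI[OF holomorphic_higher_deriv[OF f open_ball] open_ball, of "poly p z" l] Suc.prems
    by (simp add: lemniscate_def)
  have fp': "((\<lambda>u. ?f l (poly p u)) has_field_derivative ?f (Suc l) (poly p z) * poly (pderiv p) z) (at z)"
    for l
    by (rule DERIV_chain2[where f = "?f l" and g = "poly p", OF f' poly_DERIV])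
  have "((\<lambda>u. \<Sum>l\<le>n. ?c n l u * ?f l (poly p u)) has_field_derivative
      (\<Sum>l\<le>n. ?c n l z * (?f (Suc l) (poly p z) * poly (pderiv p) z)
        + poly (pderiv (chain_poly p n l)) z * ?f l (poly p z))) (at z)"
    by (intro DERIV_sum DERIV_mult' poly_DERIV fp')
  then have "(deriv ^^ Suc n) (\<lambda>z. f (poly p z)) z
      = (\<Sum>l\<le>n. ?c n l z * (?f (Suc l) (poly p z) * poly (pderiv p) z)
        + poly (pderiv (chain_poly p n l)) z * ?f l (poly p z))"
    using deriv_cong_ev[OF ev refl] by (simp add: DERIV_imp_deriv)
  \<comment> \<open>The second sum gains the index \<open>Suc n\<close>, where
    \<open>chain_poly p n (Suc n)\<close> is \<open>0\<close>. It can then be shifted by one as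
    well, because its term at \<open>0\<close> vanishes: \<open>chain_poly p n 0\<close> is
    constant.\<close>
  also have "\<dots> = (\<Sum>l\<le>n. ?c n l z * poly (pderiv p) z * ?f (Suc l) (poly p z))
      + (\<Sum>l\<le>Suc n. poly (pderiv (chain_poly p n l)) z * ?f l (poly p z))"
    by (simp add: sum.distrib chain_poly_above algebra_simps)
  also have "(\<Sum>l\<le>Suc n. poly (pderiv (chain_poly p n l)) z * ?f l (poly p z))
      = (\<Sum>l\<le>n. poly (pderiv (chain_poly p n (Suc l))) z * ?f (Suc l) (poly p z))"
    by (subst sum.atMost_Suc_shift) (simp add: pderiv_chain_poly_0)
  also have "(\<Sum>l\<le>n. ?c n l z * poly (pderiv p) z * ?f (Suc l) (poly p z)) + \<dots>
      = (\<Sum>l\<le>n. ?c (Suc n) (Suc l) z * ?f (Suc l) (poly p z))"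
    by (simp add: sum.distrib[symmetric] algebra_simps)
  also have "\<dots> = (\<Sum>l\<le>Suc n. ?c (Suc n) l z * ?f l (poly p z))"
    by (subst sum.atMost_Suc_shift) simp
  finally show ?case .
qed simp

lemma higher_deriv_sum:
  assumes "\<And>k. k \<in> A \<Longrightarrow> g k holomorphic_on S" "open S" "z \<in> S"
  shows "(deriv ^^ n) (\<lambda>z. \<Sum>k\<in>A. g k z) z = (\<Sum>k\<in>A. (deriv ^^ n) (g k) z)"
  using assms(1)
proof (induction A rule: infinite_finite_induct)
  case (insert k A)
  then have "(deriv ^^ n) (\<lambda>z. g k z + (\<Sum>k\<in>A. g k z)) z
      = (deriv ^^ n) (g k) z + (deriv ^^ n) (\<lambda>z. \<Sum>k\<in>A. g k z) z"
    using assms(2,3) by (intro higher_deriv_add[where S = S] holomorphic_intros) auto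
  then show ?case
    using insert by simp
qed simp_all

text \<open>The product and chain rules are applied to the representation of \<phi> at
  \<open>lam j\<close>, where all derivatives of \<phi> of positive order vanish. Among the terms
  with the Lagrange polynomial undifferentiated only \<open>k = j\<close> survives, and its top term
  has the coefficient \<open>poly (pderiv p) (lam j) ^ n\<close>; solving for it gives the
  recursion.\<close>

theorem higher_deriv_multicentric:
  assumes f: "\<And>k. k \<in> {1..d} \<Longrightarrow> f k holomorphic_on ball 0 \<rho>"
    and rep: "\<And>z. z \<in> lemniscate \<Longrightarrow> \<phi> z = (\<Sum>k=1..d. poly (\<delta> k) z * f k (poly p z))"
    and j: "j \<in> {1..d}"
  shows "(deriv ^^ n) (f j) 0 = multicentric_deriv p d lam \<phi> n j"
  using j
proof (induction n arbitrary: j rule: less_induct)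
  case (less n j)
  let ?h = "\<lambda>k z. f k (poly p z)" and ?c = "\<lambda>m l. poly (chain_poly p m l) (lam j)"
  let ?D = "\<lambda>l k. (deriv ^^ l) (f k) 0" and ?\<delta> = "\<lambda>k m. poly ((pderiv ^^ m) (\<delta> k)) (lam j)"
  have lam: "lam j \<in> lemniscate"
    using less.prems by simp
  have hol: "?h k holomorphic_on lemniscate" if "k \<in> {1..d}" for k
  proof -
    have "poly p holomorphic_on lemniscate" "poly p ` lemniscate \<subseteq> ball 0 \<rho>"
      by (auto simp: lemniscate_def intro!: holomorphic_intros)
    then show ?thesis
      using holomorphic_on_compose_gen[OF _ f[OF that]] by (simp add: o_def)
  qed
  have split: "(\<Sum>m=0..n. a m) = (\<Sum>m<n. a m) + a n" for a :: "nat \<Rightarrow> complex"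
    by (simp add: atLeast0AtMost lessThan_Suc_atMost[symmetric])
  have hder: "(deriv ^^ m) (?h k) (lam j) = (\<Sum>l\<le>m. ?c m l * ?D l k)" if "k \<in> {1..d}" for m k
    using higher_deriv_compose_poly[OF f[OF that] lam] less.prems by simp
  have "\<forall>\<^sub>F u in nhds (lam j). u \<in> lemniscate"
    using open_lemniscate lam by (rule eventually_nhds_in_open)
  then have ev: "\<forall>\<^sub>F u in nhds (lam j). \<phi> u = (\<Sum>k=1..d. ?h k u * poly (\<delta> k) u)"
    by (rule eventually_mono) (simp add: rep mult.commute)
  have "\<forall>\<^sub>F u in nhds (lam j). \<phi> u = \<phi> (lam j)"
    using loc_const lam by (simp add: lemniscate_def)
  then have "(deriv ^^ n) \<phi> (lam j) = (deriv ^^ n) (\<lambda>_. \<phi> (lam j)) (lam j)"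
    by (rule higher_deriv_cong_ev) simp
  then have const: "(deriv ^^ n) \<phi> (lam j) = (if n = 0 then \<phi> (lam j) else 0)"
    by (simp add: higher_deriv_const)
  have "(deriv ^^ n) \<phi> (lam j) = (deriv ^^ n) (\<lambda>u. \<Sum>k=1..d. ?h k u * poly (\<delta> k) u) (lam j)"
    using ev by (rule higher_deriv_cong_ev) simp
  also have "\<dots> = (\<Sum>k=1..d. (deriv ^^ n) (\<lambda>u. ?h k u * poly (\<delta> k) u) (lam j))"
    by (intro higher_deriv_sum[OF _ open_lemniscate lam] holomorphic_intros hol) auto
  also have "\<dots> = (\<Sum>k=1..d. \<Sum>m=0..n. of_nat (n choose m) * (\<Sum>l\<le>m. ?c m l * ?D l k) * ?\<delta> k (n - m))"
  proof (rule sum.cong[OF refl])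
    fix k assume k: "k \<in> {1..d}"
    have "(deriv ^^ n) (\<lambda>u. ?h k u * poly (\<delta> k) u) (lam j)
        = (\<Sum>m=0..n. of_nat (n choose m) * (deriv ^^ m) (?h k) (lam j) * (deriv ^^ (n - m)) (poly (\<delta> k)) (lam j))"
      by (intro higher_deriv_mult[OF hol[OF k] _ open_lemniscate lam] holomorphic_intros)
    then show "(deriv ^^ n) (\<lambda>u. ?h k u * poly (\<delta> k) u) (lam j)
        = (\<Sum>m=0..n. of_nat (n choose m) * (\<Sum>l\<le>m. ?c m l * ?D l k) * ?\<delta> k (n - m))"
      by (simp only: hder[OF k] higher_deriv_poly)
  qed
  also have "\<dots> = (\<Sum>k=1..d. (\<Sum>m<n. of_nat (n choose m) * ?\<delta> k (n - m) * (\<Sum>l\<le>m. ?c m l * ?D l k))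
      + (\<Sum>l\<le>n. ?c n l * ?D l k) * poly (\<delta> k) (lam j))"
    unfolding split
    by (intro sum.cong refl arg_cong2[of _ _ _ _ "(+)"]) (simp_all add: mult_ac)
  also have "\<dots> = (\<Sum>k=1..d. \<Sum>m<n. of_nat (n choose m) * ?\<delta> k (n - m) * (\<Sum>l\<le>m. ?c m l * ?D l k))
      + (\<Sum>k=1..d. if j = k then \<Sum>l\<le>n. ?c n l * ?D l j else 0)"
    unfolding sum.distrib using less.prems
    by (intro arg_cong2[of _ _ _ _ "(+)"] refl sum.cong) (auto simp: lagrange_poly_root)
  also have "(\<Sum>k=1..d. if j = k then \<Sum>l\<le>n. ?c n l * ?D l j else 0) = (\<Sum>l\<le>n. ?c n l * ?D l j)"
    using less.prems by simp
  also have "\<dots> = (\<Sum>l<n. ?c n l * ?D l j) + poly (pderiv p) (lam j) ^ n * ?D n j"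
    by (simp add: lessThan_Suc_atMost[symmetric] chain_poly_diag poly_power)
  finally have main: "poly (pderiv p) (lam j) ^ n * ?D n j = (if n = 0 then \<phi> (lam j) else 0)
      - (\<Sum>k=1..d. \<Sum>m<n. of_nat (n choose m) * ?\<delta> k (n - m) * (\<Sum>l\<le>m. ?c m l * ?D l k))
      - (\<Sum>l<n. ?c n l * ?D l j)"
    unfolding const by (simp only: algebra_simps)
  have "(\<Sum>k=1..d. \<Sum>m<n. of_nat (n choose m) * ?\<delta> k (n - m) * (\<Sum>l\<le>m. ?c m l * ?D l k))
      = (\<Sum>k=1..d. \<Sum>m<n. of_nat (n choose m) * ?\<delta> k (n - m)
          * (\<Sum>l\<le>m. ?c m l * multicentric_deriv p d lam \<phi> l k))"
    by (intro sum.cong refl arg_cong2[of _ _ _ _ times] less.IH) auto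
  moreover have "(\<Sum>l<n. ?c n l * ?D l j) = (\<Sum>l<n. ?c n l * multicentric_deriv p d lam \<phi> l j)"
    using less.prems by (intro sum.cong refl arg_cong2[of _ _ _ _ times] less.IH) auto
  ultimately have "poly (pderiv p) (lam j) ^ n * ?D n j
      = poly (pderiv p) (lam j) ^ n * multicentric_deriv p d lam \<phi> n j"
    unfolding main multicentric_deriv.simps[of p d lam \<phi> n j]
    using simple_root[OF less.prems] by simp
  then show ?case
    using simple_root[OF less.prems] by simp
qed

end

section \<open>Operators on direct sums\<close>

lemma direct_sum_norm_bounds:
  assumes N: "direct_sum_norm N"
  shows "0 \<le> N z" "N z \<le> 2 * norm z" "norm z \<le> 2 * N z"
proof -
  obtain x y where z: "z = (x, y)"
    by (cases z)
  have tri: "N (v + w) \<le> N v + N w" for v w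
    using N by (simp add: direct_sum_norm_def del: split_paired_All)
  have emb: "N (x, 0) = norm x" "N (0, y) = norm y"
    and xy: "norm x \<le> N (x, y)" "norm y \<le> N (x, y)"
    using N by (simp_all add: direct_sum_norm_def del: split_paired_All)
  show "0 \<le> N z"
    unfolding z using norm_ge_zero[of x] xy(1) by linarith
  have "N z \<le> norm x + norm y"
    using tri[of "(x, 0)" "(0, y)"] by (simp add: z emb)
  also have "\<dots> \<le> 2 * norm z"
  proof -
    have "norm x \<le> norm z" "norm y \<le> norm z"
      by (simp_all add: z norm_prod_def real_le_rsqrt)
    then show ?thesis by simp
  qed
  finally show "N z \<le> 2 * norm z" .
  have "norm z \<le> norm x + norm y"
    unfolding z by (rule norm_Pair_le)
  then show "norm z \<le> 2 * N z"
    using xy by (simp add: z)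
qed

lemma op_norm_bounds:
  fixes T :: "('x::complex_normed_vector \<times> 'y::complex_normed_vector) \<Rightarrow>\<^sub>L ('x \<times> 'y)"
  assumes N: "direct_sum_norm N"
  shows "0 \<le> op_norm N T" "N (T z) \<le> op_norm N T * N z"
proof -
  note b = direct_sum_norm_bounds[OF N]
  have N0: "N z = 0 \<longleftrightarrow> z = 0" for z
    using N by (simp add: direct_sum_norm_def del: split_paired_All)
  have "N (T z) / N z \<le> 4 * norm T" for z
  proof -
    have "N (T z) \<le> 2 * norm (T z)"
      by (rule b)
    also have "\<dots> \<le> 2 * (norm T * norm z)"
      by (intro mult_left_mono norm_blinfun) simp
    also have "\<dots> \<le> 2 * (norm T * (2 * N z))"
      by (intro mult_left_mono b) auto
    finally have "N (T z) \<le> 4 * norm T * N z"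
      by simp
    then show ?thesis
      using b(1)[of z] N0[of z] by (cases "N z = 0") (auto simp: divide_le_eq)
  qed
  then have bdd: "bdd_above (range (\<lambda>z. N (T z) / N z))"
    by (intro bdd_aboveI2)
  have le: "N (T z) / N z \<le> op_norm N T" for z
    unfolding op_norm_def by (rule cSUP_upper[OF UNIV_I bdd])
  \<comment> \<open>At \<open>z = 0\<close> the quotient has denominator \<open>0\<close> and hence
    the value \<open>0\<close>, a lower bound for the supremum.\<close>
  show "0 \<le> op_norm N T"
    using le[of 0] N0[of 0] by simp
  show "N (T z) \<le> op_norm N T * N z"
    using le[of z] b(1)[of z] N0[of z] by (cases "N z = 0") (auto simp: divide_le_eq blinfun.zero_right)
qed

text \<open>The powers are estimated in \<open>N\<close>, where \<open>op_norm N\<close> is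
  submultiplicative. The change of norm costs a factor \<open>2\<close> in each direction, once for
  all \<open>n\<close>, so the growth rate remains \<open>op_norm N T\<close>.\<close>

lemma norm_op_power_le_op_norm:
  fixes T :: "('x::complex_normed_vector \<times> 'y::complex_normed_vector) \<Rightarrow>\<^sub>L ('x \<times> 'y)"
  assumes N: "direct_sum_norm N"
  shows "norm (op_power T n) \<le> 4 * op_norm N T ^ n"
proof (rule norm_blinfun_bound)
  note b = direct_sum_norm_bounds[OF N] and o = op_norm_bounds[OF N, of T]
  have pow: "N (op_power T n z) \<le> op_norm N T ^ n * N z" for z
  proof (induction n)
    case (Suc n)
    have "N (op_power T (Suc n) z) \<le> op_norm N T * N (op_power T n z)"
      by (simp add: op_power_Suc o)
    also have "\<dots> \<le> op_norm N T * (op_norm N T ^ n * N z)"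
      by (intro mult_left_mono Suc o)
    finally show ?case
      by (simp add: mult.assoc)
  qed simp
  show "norm (op_power T n z) \<le> 4 * op_norm N T ^ n * norm z" for z
  proof -
    have "norm (op_power T n z) \<le> 2 * (op_norm N T ^ n * N z)"
      using b(3)[of "op_power T n z"] pow[of z] by linarith
    also have "\<dots> \<le> 2 * (op_norm N T ^ n * (2 * norm z))"
      by (intro mult_left_mono b zero_le_power o) auto
    finally show ?thesis by simp
  qed
  show "0 \<le> 4 * op_norm N T ^ n"
    using o by simp
qed

lemma complex_linear_upper_triangular_op:
  assumes "complex_linear_op A" "complex_linear_op B" "complex_linear_op C"
  shows "complex_linear_op (upper_triangular_op A C B)"
  using assms unfolding complex_linear_op_def
  by (auto simp: scaleC_prod_def upper_triangular_op_apply scaleC_add_right)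

text \<open>The inverse is again upper triangular, with the resolvents \<open>R\<close> and
  \<open>R'\<close> on the diagonal and \<open>R o\<^sub>L C o\<^sub>L R'\<close> off it.\<close>

lemma op_spectrum_upper_triangular:
  fixes A :: "'x::complex_banach \<Rightarrow>\<^sub>L 'x" and B :: "'y::complex_banach \<Rightarrow>\<^sub>L 'y"
  assumes A: "z \<notin> op_spectrum A" and B: "z \<notin> op_spectrum B"
  shows "z \<notin> op_spectrum (upper_triangular_op A C B)"
proof (rule resolventI(1))
  define R where "R = resolvent A z"
  define R' where "R' = resolvent B z"
  let ?S = "upper_triangular_op R (R o\<^sub>L C o\<^sub>L R') R'"
  have app: "(z *\<^sub>C id_blinfun - T) v = z *\<^sub>C v - T v" for T :: "'v::complex_normed_vector \<Rightarrow>\<^sub>L 'v" and v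
    by (simp add: blinfun.diff_left scaleC_blinfun.rep_eq)
  have inv: "R (z *\<^sub>C x - A x) = x" "z *\<^sub>C R x - A (R x) = x" for x
    using resolvent_inverse[OF A, folded R_def]
    by (metis app blinfun_apply_blinfun_compose blinfun_apply_id_blinfun)+
  have inv': "R' (z *\<^sub>C y - B y) = y" "z *\<^sub>C R' y - B (R' y) = y" for y
    using resolvent_inverse[OF B, folded R'_def]
    by (metis app blinfun_apply_blinfun_compose blinfun_apply_id_blinfun)+
  show "?S o\<^sub>L (z *\<^sub>C id_blinfun - upper_triangular_op A C B) = id_blinfun"
  proof (rule blinfun_eqI)
    fix v :: "'x \<times> 'y"
    obtain x y where v: "v = (x, y)"
      by (cases v)
    have "z *\<^sub>C x - (A x + C y) = (z *\<^sub>C x - A x) - C y"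
      by simp
    then have "R (z *\<^sub>C x - (A x + C y)) = R (z *\<^sub>C x - A x) - R (C y)"
      by (simp only: blinfun.diff_right)
    then have "R (z *\<^sub>C x - (A x + C y)) = x - R (C y)"
      by (simp only: inv)
    then show "(?S o\<^sub>L (z *\<^sub>C id_blinfun - upper_triangular_op A C B)) v = id_blinfun v"
      by (simp add: v app upper_triangular_op_apply scaleC_prod_def inv')
  qed
  show "(z *\<^sub>C id_blinfun - upper_triangular_op A C B) o\<^sub>L ?S = id_blinfun"
  proof (rule blinfun_eqI)
    fix v :: "'x \<times> 'y"
    obtain x y where v: "v = (x, y)"
      by (cases v)
    have "R x + R (C (R' y)) = R (x + C (R' y))"
      by (simp add: blinfun.add_right)
    moreover have "z *\<^sub>C R (x + C (R' y)) - (A (R (x + C (R' y))) + C (R' y)) = x"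
      using inv(2)[of "x + C (R' y)"] by (simp add: diff_diff_eq[symmetric])
    ultimately show "((z *\<^sub>C id_blinfun - upper_triangular_op A C B) o\<^sub>L ?S) v = id_blinfun v"
      by (simp add: v app upper_triangular_op_apply scaleC_prod_def inv')
  qed
qed

lemma subset_polynomial_hull: "K \<subseteq> polynomial_hull K"
  by (auto simp: polynomial_hull_def intro!: SUP_upper)

section \<open>The multicentric functional calculus\<close>

lemma uniform_limit_transform:
  assumes "uniform_limit X f h F" "\<And>y x. x \<in> X \<Longrightarrow> f y x = g y x" "\<And>x. x \<in> X \<Longrightarrow> h x = i x"
  shows "uniform_limit X g i F"
  using assms(1) uniform_limit_cong'[of X f g h i F] assms(2,3) by blast

lemma uniform_limit_sum:
  fixes f :: "'i \<Rightarrow> 'b \<Rightarrow> 'a \<Rightarrow> 'c::real_normed_vector"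
  assumes "\<And>i. i \<in> I \<Longrightarrow> uniform_limit X (f i) (g i) F"
  shows "uniform_limit X (\<lambda>n x. \<Sum>i\<in>I. f i n x) (\<lambda>x. \<Sum>i\<in>I. g i x) F"
  using assms
  by (induction I rule: infinite_finite_induct) (auto intro!: uniform_limit_add uniform_limit_const)

text \<open>The part of |p| \<le> \<tau> + 1 outside \<open>U\<close> is compact, so |p| attains a
  minimum there, necessarily above \<tau>. The margin gives the component series a radius of
  convergence larger than the norm of p(M).\<close>

lemma poly_sublevel_margin:
  fixes p :: "complex poly"
  assumes "degree p \<ge> 1" "open U" "{z. cmod (poly p z) \<le> \<tau>} \<subseteq> U"
  obtains \<rho> where "\<tau> < \<rho>" "{z. cmod (poly p z) < \<rho>} \<subseteq> U"
proof -
  define K where "K = {z. cmod (poly p z) \<le> \<tau> + 1} - U"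
  have "closed {z. cmod (poly p z) \<le> \<tau> + 1}"
    by (intro closed_Collect_le continuous_intros)
  then have "compact K"
    unfolding K_def using bounded_poly_sublevel[OF assms(1)] assms(2)
    by (intro compact_diff) (auto simp: compact_eq_bounded_closed)
  show thesis
  proof (cases "K = {}")
    case True
    then have "{z. cmod (poly p z) < \<tau> + 1} \<subseteq> U"
      by (auto simp: K_def)
    then show ?thesis
      using that[of "\<tau> + 1"] by simp
  next
    case False
    have "continuous_on K (\<lambda>z. cmod (poly p z))"
      by (intro continuous_intros)
    then obtain z0 where z0: "z0 \<in> K" "\<And>z. z \<in> K \<Longrightarrow> cmod (poly p z0) \<le> cmod (poly p z)"
      using continuous_attains_inf[OF \<open>compact K\<close> False] by blast
    have "\<tau> < cmod (poly p z0)"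
      using z0(1) assms(3) by (force simp: K_def)
    moreover have "z \<in> U" if "cmod (poly p z) < min (cmod (poly p z0)) (\<tau> + 1)" for z
      using z0(2)[of z] that by (auto simp: K_def)
    ultimately show ?thesis
      using that[of "min (cmod (poly p z0)) (\<tau> + 1)"] by auto
  qed
qed

locale multicentric_operator = multicentric_setup p d lam \<rho> \<phi>
  for p d lam \<rho> \<phi> +
  fixes M :: "'a::complex_banach \<Rightarrow>\<^sub>L 'a" and C \<tau> :: real and f :: "nat \<Rightarrow> complex \<Rightarrow> complex"
  assumes M: "complex_linear_op M"
    and \<tau>: "0 \<le> \<tau>" "\<tau> < \<rho>"
    and power_bound: "\<And>n. norm (op_power (op_poly p M) n) \<le> C * \<tau> ^ n"
    and f: "\<And>j. f j holomorphic_on ball 0 \<rho>"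
    and rep: "\<And>z. z \<in> lemniscate \<Longrightarrow> \<phi> z = (\<Sum>j=1..d. poly (\<delta> j) z * f j (poly p z))"
begin

definition coef :: "nat \<Rightarrow> nat \<Rightarrow> complex"
  where "coef j n = (deriv ^^ n) (f j) 0 / fact n"

definition component_op :: "nat \<Rightarrow> 'a \<Rightarrow>\<^sub>L 'a"
  where "component_op j = (\<Sum>n. coef j n *\<^sub>C op_power (op_poly p M) n)"

definition calculus_op :: "'a \<Rightarrow>\<^sub>L 'a"
  where "calculus_op = (\<Sum>j=1..d. op_poly (\<delta> j) M o\<^sub>L component_op j)"

lemma coef_sums: "w \<in> ball 0 \<rho> \<Longrightarrow> (\<lambda>n. coef j n * w ^ n) sums f j w"
  using holomorphic_power_series[OF f, of w j] by (simp add: coef_def)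

lemma summable_norm_coef:
  assumes "0 \<le> r" "r < \<rho>"
  shows "summable (\<lambda>n. norm (coef j n) * r ^ n)"
proof -
  \<comment> \<open>Convergence at the midpoint between \<open>r\<close> and \<rho> gives absolute
    convergence at the smaller radius \<open>r\<close>.\<close>
  have "summable (\<lambda>n. coef j n * complex_of_real ((r + \<rho>) / 2) ^ n)"
    using assms by (intro sums_summable[OF coef_sums]) (simp del: of_real_add of_real_divide)
  then have "summable (\<lambda>n. norm (coef j n * complex_of_real r ^ n))"
    by (rule powser_insidea) (use assms in \<open>simp del: of_real_add of_real_divide\<close>)
  then show ?thesis
    using assms by (simp add: norm_mult norm_power)
qed

lemma summable_component: "summable (\<lambda>n. coef j n *\<^sub>C op_power (op_poly p M) n)"
proof (rule summable_comparison_test'[where N = 0])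
  show "summable (\<lambda>n. C * (norm (coef j n) * \<tau> ^ n))"
    by (intro summable_mult summable_norm_coef \<tau>)
  show "norm (coef j n *\<^sub>C op_power (op_poly p M) n) \<le> C * (norm (coef j n) * \<tau> ^ n)" for n
    unfolding norm_scaleC using mult_left_mono[OF power_bound norm_ge_zero]
    by (simp add: mult.left_commute)
qed

lemma complex_linear_component: "complex_linear_op (component_op j)"
  unfolding component_op_def
  by (intro complex_linear_op_suminf summable_component complex_linear_op_scaleC
      complex_linear_op_power complex_linear_op_poly M)

lemma complex_linear_calculus_op: "complex_linear_op calculus_op"
  unfolding calculus_op_def
  by (intro complex_linear_op_sum complex_linear_op_compose complex_linear_component
      complex_linear_op_poly M)

text \<open>The Neumann series puts \<open>poly p z\<close> outside the spectrum of p(M), and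
  spectral mapping brings this back to \<open>z\<close>. The spectrum of \<open>M\<close> thus lies
  in |p| \<le> \<tau>.\<close>

lemma not_in_spectrum: "\<tau> < cmod (poly p z) \<Longrightarrow> z \<notin> op_spectrum M"
  by (intro spectral_mapping_op_poly[OF M, of p] Neumann_resolvent[OF _ power_bound]
      complex_linear_op_poly M \<tau>)

definition remainder :: "complex \<Rightarrow> 'a \<Rightarrow>\<^sub>L 'a"
  where "remainder z = (\<phi> z *\<^sub>C id_blinfun - calculus_op) o\<^sub>L resolvent M z"

definition approx :: "nat \<Rightarrow> complex poly"
  where "approx n = (\<Sum>j=1..d. \<delta> j * (\<Sum>m<n. smult (coef j m) (p ^ m)))"

lemma op_poly_approx_tendsto: "(\<lambda>n. op_poly (approx n) M) \<longlonglongrightarrow> calculus_op"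
proof -
  have "op_poly (approx n) M
      = (\<Sum>j=1..d. op_poly (\<delta> j) M o\<^sub>L (\<Sum>m<n. coef j m *\<^sub>C op_power (op_poly p M) m))" for n
    by (simp add: approx_def op_poly_sum op_poly_mult[OF M] op_poly_smult op_poly_power[OF M])
  then show ?thesis
    unfolding calculus_op_def component_op_def
    by (simp only:) (intro tendsto_sum compose.tendsto tendsto_const summable_LIMSEQ summable_component)
qed

lemma uniform_limit_approx:
  assumes K: "compact K" "\<And>z. z \<in> K \<Longrightarrow> cmod (poly p z) \<le> r" and r: "0 \<le> r" "r < \<rho>"
  shows "uniform_limit K (\<lambda>n z. poly (approx n) z) \<phi> sequentially"
proof -
  have lim: "uniform_limit K (\<lambda>n z. \<Sum>m<n. coef j m * poly p z ^ m) (\<lambda>z. f j (poly p z)) sequentially" for j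
  proof -
    have "uniform_limit K (\<lambda>n z. \<Sum>m<n. coef j m * poly p z ^ m) (\<lambda>z. \<Sum>m. coef j m * poly p z ^ m) sequentially"
    proof (rule Weierstrass_m_test)
      show "summable (\<lambda>n. norm (coef j n) * r ^ n)"
        by (rule summable_norm_coef[OF r])
      show "norm (coef j n * poly p z ^ n) \<le> norm (coef j n) * r ^ n" if "z \<in> K" for n z
        unfolding norm_mult norm_power using K(2)[OF that] by (intro mult_left_mono power_mono) auto
    qed
    moreover have "(\<Sum>m. coef j m * poly p z ^ m) = f j (poly p z)" if "z \<in> K" for z
      using coef_sums[of "poly p z" j] K(2)[OF that] r by (simp add: sums_iff)
    ultimately show ?thesis
      by (rule uniform_limit_transform[OF _ refl])
  qed
  have contf: "continuous_on K (\<lambda>z. f j (poly p z))" for j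
    by (rule uniform_limit_theorem[OF _ lim]) (auto intro!: always_eventually continuous_intros)
  have "uniform_limit K (\<lambda>n z. \<Sum>j=1..d. poly (\<delta> j) z * (\<Sum>m<n. coef j m * poly p z ^ m))
      (\<lambda>z. \<Sum>j=1..d. poly (\<delta> j) z * f j (poly p z)) sequentially"
  proof (intro uniform_limit_sum uniform_lim_mult uniform_limit_const lim)
    show "bounded ((\<lambda>z. poly (\<delta> j) z) ` K)" "bounded ((\<lambda>z. f j (poly p z)) ` K)" for j
      by (intro compact_imp_bounded compact_continuous_image K contf continuous_intros)+
  qed
  moreover have "(\<Sum>j=1..d. poly (\<delta> j) z * (\<Sum>m<n. coef j m * poly p z ^ m)) = poly (approx n) z" for n z
    by (simp add: approx_def poly_sum)
  moreover have "(\<Sum>j=1..d. poly (\<delta> j) z * f j (poly p z)) = \<phi> z" if "z \<in> K" for z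
    using rep[of z] K(2)[OF that] r by (simp add: lemniscate_def)
  ultimately show ?thesis
    by (rule uniform_limit_transform)
qed

lemma approx_resolvent:
  assumes "z \<notin> op_spectrum M"
  shows "(poly q z *\<^sub>C id_blinfun - op_poly q M) o\<^sub>L resolvent M z = op_poly (synthetic_div q z) M"
  by (simp only: op_poly_factor(1)[OF M] compose_assoc resolvent_inverse(2)[OF assms] compose_id)

text \<open>For a polynomial \<open>q\<close>, the function \<open>(q(z) - q(M)) (z - M)\<^sup>-\<^sup>1\<close> is a polynomial in \<open>z\<close>.
  Along the approximating polynomials these functions converge uniformly on a level curve of \<open>p\<close>
  in the resolvent set, hence, by the maximum modulus principle, inside it.\<close>

lemma weak_extension_lemniscate:
  assumes r: "\<tau> < r" "r < \<rho>"
  defines "W \<equiv> {z. cmod (poly p z) < r}"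
  shows "weak_extension W (W - op_spectrum M) remainder"
  unfolding weak_extension_def
proof (intro allI impI)
  fix l :: "('a \<Rightarrow>\<^sub>L 'a) \<Rightarrow> complex" assume l: "complex_functional l"
  then interpret l: bounded_linear l
    by (simp add: complex_functional_def)
  define K where "K = {z. cmod (poly p z) = r}"
  define D where "D n z = l (op_poly (synthetic_div (approx n) z) M)" for n z
  have holD: "D n holomorphic_on S" for n S
    unfolding D_def using holomorphic_poly_quotient[OF M l] holomorphic_on_subset by blast
  have "open W"
    unfolding W_def by (intro open_Collect_less continuous_intros)
  have "bounded W"
    using d by (intro bounded_subset[OF bounded_poly_sublevel[of p r]]) (auto simp: W_def)
  have "closed K"
    unfolding K_def by (intro closed_Collect_eq continuous_intros)
  moreover have "bounded K"
    using d by (intro bounded_subset[OF bounded_poly_sublevel[of p r]]) (auto simp: K_def)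
  ultimately have "compact K"
    by (simp add: compact_eq_bounded_closed)
  have K: "K \<subseteq> - op_spectrum M"
    using not_in_spectrum r by (auto simp: K_def)
  have frontier: "frontier W \<subseteq> K"
  proof -
    have "closure W \<subseteq> {z. cmod (poly p z) \<le> r}"
      by (intro closure_minimal closed_Collect_le continuous_intros) (auto simp: W_def)
    then show ?thesis
      using \<open>open W\<close> by (force simp: frontier_def interior_open W_def K_def)
  qed
  have contR: "continuous_on K (resolvent M)"
    by (rule continuous_on_subset[OF continuous_on_resolvent[OF M] K])
  have ulim: "uniform_limit K (\<lambda>n z. poly (approx n) z) \<phi> sequentially"
    using r \<tau> by (intro uniform_limit_approx[OF \<open>compact K\<close>, of r]) (auto simp: K_def)
  have cont_phi: "continuous_on K \<phi>"
    by (rule uniform_limit_theorem[OF _ ulim]) (auto intro!: always_eventually continuous_intros)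
  have DK: "D n z = l ((poly (approx n) z *\<^sub>C id_blinfun - op_poly (approx n) M) o\<^sub>L resolvent M z)"
    if "z \<notin> op_spectrum M" for n z
    by (simp only: D_def approx_resolvent[OF that])
  have "uniform_limit K (\<lambda>n z. l ((poly (approx n) z *\<^sub>C id_blinfun - op_poly (approx n) M) o\<^sub>L resolvent M z))
      (\<lambda>z. l (remainder z)) sequentially"
    unfolding remainder_def
  proof (intro l.uniform_limit compose.bounded_uniform_limit uniform_limit_const)
    show "uniform_limit K (\<lambda>n z. poly (approx n) z *\<^sub>C id_blinfun - op_poly (approx n) M)
        (\<lambda>z. \<phi> z *\<^sub>C id_blinfun - calculus_op) sequentially"
    proof (intro uniform_limit_minus bounded_linear.uniform_limit[OF scaleC.bounded_linear_left ulim])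
      show "uniform_limit K (\<lambda>n z. op_poly (approx n) M) (\<lambda>z. calculus_op) sequentially"
        using op_poly_approx_tendsto by (simp add: uniform_limit_iff tendsto_iff eventually_mono)
    qed
    show "bounded (resolvent M ` K)"
      by (intro compact_imp_bounded compact_continuous_image contR \<open>compact K\<close>)
    show "bounded ((\<lambda>z. \<phi> z *\<^sub>C id_blinfun - calculus_op) ` K)"
      by (intro compact_imp_bounded compact_continuous_image \<open>compact K\<close> continuous_on_diff
          scaleC.continuous_on cont_phi continuous_on_const)
  qed
  then have "uniform_limit K D (\<lambda>z. l (remainder z)) sequentially"
    by (rule uniform_limit_transform) (use K in \<open>auto simp: DK\<close>)
  then have cauchyK: "uniformly_Cauchy_on K D"
    by (meson uniformly_convergent_Cauchy uniformly_convergentI)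
  have "uniformly_Cauchy_on W D"
    unfolding uniformly_Cauchy_on_def
  proof (intro allI impI)
    fix e :: real assume "e > 0"
    then obtain n0 where n0: "\<And>z m n. z \<in> K \<Longrightarrow> n0 \<le> m \<Longrightarrow> n0 \<le> n \<Longrightarrow> dist (D m z) (D n z) < e / 2"
      using cauchyK unfolding uniformly_Cauchy_on_def by (metis half_gt_zero)
    have "dist (D m z) (D n z) < e" if "z \<in> W" "n0 \<le> m" "n0 \<le> n" for z m n
    proof -
      have "norm (D m z - D n z) \<le> e / 2"
      proof (rule maximum_modulus_frontier[of "\<lambda>z. D m z - D n z" W])
        show "norm (D m y - D n y) \<le> e / 2" if "y \<in> frontier W" for y
          using n0[of y m n] frontier that \<open>n0 \<le> m\<close> \<open>n0 \<le> n\<close> by (auto simp: dist_norm)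
      qed (use \<open>bounded W\<close> \<open>z \<in> W\<close> in
          \<open>auto intro!: holomorphic_intros holD continuous_intros holomorphic_on_imp_continuous_on\<close>)
      then show ?thesis
        using \<open>e > 0\<close> by (simp add: dist_norm)
    qed
    then show "\<exists>M. \<forall>x\<in>W. \<forall>m\<ge>M. \<forall>n\<ge>M. dist (D m x) (D n x) < e"
      by blast
  qed
  then have "uniformly_convergent_on W D"
    by (rule Cauchy_uniformly_convergent)
  then obtain E where E: "uniform_limit W D E sequentially"
    by (auto simp: uniformly_convergent_on_def)
  have "E holomorphic_on W"
  proof (rule holomorphic_uniform_sequence[OF \<open>open W\<close> holD])
    fix x assume "x \<in> W"
    then obtain e where "e > 0" "cball x e \<subseteq> W"
      using \<open>open W\<close> open_contains_cball by blast
    then show "\<exists>d>0. cball x d \<subseteq> W \<and> uniform_limit (cball x d) D E sequentially"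
      using uniform_limit_on_subset[OF E] by blast
  qed
  moreover have "E z = l (remainder z)" if z: "z \<in> W" "z \<notin> op_spectrum M" for z
  proof (rule LIMSEQ_unique)
    show "(\<lambda>n. D n z) \<longlonglongrightarrow> E z"
      by (rule tendsto_uniform_limitI[OF E z(1)])
    have "uniform_limit {z} (\<lambda>n z. poly (approx n) z) \<phi> sequentially"
      using z r \<tau> by (intro uniform_limit_approx[of _ r]) (auto simp: W_def)
    then have "(\<lambda>n. poly (approx n) z) \<longlonglongrightarrow> \<phi> z"
      by (rule tendsto_uniform_limitI) simp
    then have "(\<lambda>n. l ((poly (approx n) z *\<^sub>C id_blinfun - op_poly (approx n) M) o\<^sub>L resolvent M z))
        \<longlonglongrightarrow> l (remainder z)"
      unfolding remainder_def
      by (intro l.tendsto compose.tendsto tendsto_diff scaleC.tendsto tendsto_const op_poly_approx_tendsto)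
    then show "(\<lambda>n. D n z) \<longlonglongrightarrow> l (remainder z)"
      by (simp only: DK[OF z(2)])
  qed
  ultimately show "\<exists>h. h holomorphic_on W \<and> (\<forall>z\<in>W - op_spectrum M. h z = l (remainder z))"
    by blast
qed

text \<open>Off the spectrum the remainder itself is holomorphic; inside a level between \<tau> and
  \<rho> the extension comes from polynomial approximation. The two regions cover \<open>U\<close>
  because the spectrum lies in |p| \<le> \<tau>, and on their overlap both extensions are the
  remainder.\<close>

theorem weak_extension_remainder:
  assumes U: "open U" "lemniscate \<subseteq> U" "\<phi> holomorphic_on U"
  shows "weak_extension U (U - op_spectrum M) remainder"
proof -
  define r where "r = (\<tau> + \<rho>) / 2"
  have r: "\<tau> < r" "r < \<rho>"
    using \<tau> by (simp_all add: r_def)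
  define W where "W = {z. cmod (poly p z) < r}"
  define V where "V = U - op_spectrum M"
  have "open W"
    unfolding W_def by (intro open_Collect_less continuous_intros)
  have "open V"
    using open_Int[OF U(1) open_resolvent_set[OF M]] by (simp add: V_def Diff_eq)
  have "W \<subseteq> U"
    using U(2) r by (auto simp: W_def lemniscate_def)
  have "weak_extension V V remainder"
    unfolding weak_extension_def
  proof (intro allI impI)
    fix l :: "('a \<Rightarrow>\<^sub>L 'a) \<Rightarrow> complex" assume l: "complex_functional l"
    then interpret l: bounded_linear l
      by (simp add: complex_functional_def)
    have lS: "complex_functional (\<lambda>T. l (calculus_op o\<^sub>L T))"
      using l bounded_linear_compose[OF _ compose.bounded_linear_right, of l]
      by (auto simp: complex_functional_def compose_scaleC complex_linear_calculus_op)
    have "(\<lambda>z. \<phi> z * l (resolvent M z) - l (calculus_op o\<^sub>L resolvent M z)) holomorphic_on V"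
    proof (intro holomorphic_intros)
      show "\<phi> holomorphic_on V"
        using U(3) by (rule holomorphic_on_subset) (auto simp: V_def)
      show "(\<lambda>z. l (resolvent M z)) holomorphic_on V"
        using holomorphic_resolvent[OF M l] by (rule holomorphic_on_subset) (auto simp: V_def)
      show "(\<lambda>z. l (calculus_op o\<^sub>L resolvent M z)) holomorphic_on V"
        using holomorphic_resolvent[OF M lS] by (rule holomorphic_on_subset) (auto simp: V_def)
    qed
    moreover have "\<phi> z * l (resolvent M z) - l (calculus_op o\<^sub>L resolvent M z) = l (remainder z)" for z
      using l by (simp add: remainder_def compose.diff_left scaleC_compose l.diff complex_functional_def)
    ultimately show "\<exists>h. h holomorphic_on V \<and> (\<forall>z\<in>V. h z = l (remainder z))"
      by blast
  qed
  then have "weak_extension (W \<union> V) ((W - op_spectrum M) \<union> V) remainder"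
    using \<open>open W\<close> \<open>open V\<close> weak_extension_lemniscate[OF r, folded W_def] \<open>W \<subseteq> U\<close>
    by (intro weak_extension_Un) (auto simp: V_def)
  moreover have "U \<subseteq> W \<union> V"
    using not_in_spectrum r by (force simp: W_def V_def)
  ultimately show ?thesis
    by (rule weak_extension_mono) (auto simp: V_def)
qed

end

section \<open>Spectral projections\<close>

lemma contour_sum_integral_diff:
  fixes F G :: "complex \<Rightarrow> 'a::complex_banach"
  assumes \<Gamma>: "surrounding_contour \<Gamma> K U"
    and F: "continuous_on (U - K) F" and G: "continuous_on (U - K) G"
  shows "contour_sum_integral \<Gamma> (\<lambda>z. F z - G z) = contour_sum_integral \<Gamma> F - contour_sum_integral \<Gamma> G"
proof -
  note D = surrounding_contourD[OF \<Gamma>]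
  have "map (\<lambda>g. curve_integral g (\<lambda>z. F z - G z)) \<Gamma> = map (\<lambda>g. curve_integral g F - curve_integral g G) \<Gamma>"
    by (intro map_cong refl curve_integral_eqI has_curve_integral_diff
        has_curve_integral_curve_integral D(1) continuous_on_subset[OF F D(2)]
        continuous_on_subset[OF G D(2)])
  then show ?thesis
    by (simp only: contour_sum_integral_def sum_list_subtractf)
qed

text \<open>Only the part of the spectrum where \<open>S \<circ> resolvent T\<close> does not extend holomorphically has
  to be surrounded; the extension is given on \<open>V\<close>.\<close>

lemma resolvent_integral_at_infinity:
  fixes S T :: "'a::complex_banach \<Rightarrow>\<^sub>L 'a"
  assumes T: "complex_linear_op T" and S: "complex_linear_op S"
    and \<Gamma>: "surrounding_contour \<Gamma> K U" "op_spectrum T - V \<subseteq> K" "U \<inter> op_spectrum T \<subseteq> K"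
    and V: "open V" "weak_extension V (V - op_spectrum T) (\<lambda>z. S o\<^sub>L resolvent T z)"
  shows "contour_sum_integral \<Gamma> (\<lambda>z. S o\<^sub>L resolvent T z) = (2 * complex_of_real pi * \<i>) *\<^sub>C S"
proof (rule contour_sum_integral_at_infinity[OF _ \<Gamma>(1), where U = "V \<union> - op_spectrum T"
      and Z = "- op_spectrum T" and b = "2 * norm T + 1" and B = "norm S * (2 * norm T)"])
  show "open (V \<union> - op_spectrum T)"
    by (intro open_Un V open_resolvent_set T)
  show "continuous_on (- op_spectrum T) (\<lambda>z. S o\<^sub>L resolvent T z)"
    by (intro compose.continuous_on continuous_on_const continuous_on_resolvent T)
  have "weak_extension (- op_spectrum T) (- op_spectrum T) (\<lambda>z. S o\<^sub>L resolvent T z)"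
    by (intro weak_extension_linear[OF weak_extension_resolvent[OF T], of "(o\<^sub>L) S"]
        compose.bounded_linear_right compose_scaleC S)
  then have "weak_extension (V \<union> - op_spectrum T) ((V - op_spectrum T) \<union> - op_spectrum T)
      (\<lambda>z. S o\<^sub>L resolvent T z)"
    using V open_resolvent_set[OF T] by (intro weak_extension_Un) auto
  then show "weak_extension (V \<union> - op_spectrum T) (- op_spectrum T) (\<lambda>z. S o\<^sub>L resolvent T z)"
    by (rule weak_extension_mono) auto
  fix z :: complex assume z: "2 * norm T + 1 \<le> norm z"
  then show "z \<in> - op_spectrum T"
    using resolvent_at_infinity(1)[OF T] by blast
  have "(S o\<^sub>L resolvent T z) - (1 / z) *\<^sub>C S = S o\<^sub>L (resolvent T z - (1 / z) *\<^sub>C id_blinfun)"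
    by (simp add: compose.diff_right compose_scaleC[OF S])
  also have "norm \<dots> \<le> norm S * norm (resolvent T z - (1 / z) *\<^sub>C id_blinfun)"
    by (rule norm_blinfun_compose)
  also have "\<dots> \<le> norm S * (2 * norm T / norm z ^ 2)"
    by (intro mult_left_mono resolvent_at_infinity[OF T z]) simp
  finally show "norm ((S o\<^sub>L resolvent T z) - (1 / z) *\<^sub>C S) \<le> norm S * (2 * norm T) / norm z ^ 2"
    by simp
qed (use \<Gamma> in auto)

lemma holomorphic_on_two_constants:
  assumes "open U" "open V" "\<And>z. z \<in> U \<Longrightarrow> \<phi> z = a" "\<And>z. z \<in> V \<Longrightarrow> \<phi> z = b"
  shows "\<phi> holomorphic_on U \<union> V"
  using assms
  by (intro holomorphic_on_Un) (auto intro!: holomorphic_transform[OF holomorphic_on_const])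

text \<open>The extension property expresses that \<open>S\<close> is the value of the functional calculus at the
  function that is \<open>1\<close> on \<open>U1\<close> and \<open>-1\<close> on \<open>U2\<close>.\<close>

locale spectral_splitting =
  fixes M S :: "'a::complex_banach \<Rightarrow>\<^sub>L 'a" and U1 U2 :: "complex set" and \<phi> :: "complex \<Rightarrow> complex"
  assumes M: "complex_linear_op M" and S: "complex_linear_op S"
    and U: "open U1" "open U2" "U1 \<inter> U2 = {}" "op_spectrum M \<subseteq> U1 \<union> U2"
    and phi: "\<And>z. z \<in> U1 \<Longrightarrow> \<phi> z = 1" "\<And>z. z \<in> U2 \<Longrightarrow> \<phi> z = -1"
    and ext: "weak_extension (U1 \<union> U2) (U1 \<union> U2 - op_spectrum M)
      (\<lambda>z. (\<phi> z *\<^sub>C id_blinfun - S) o\<^sub>L resolvent M z)"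
begin

lemma phi_holomorphic: "\<phi> holomorphic_on U1 \<union> U2"
  by (rule holomorphic_on_two_constants[OF U(1,2) phi])

lemma calculus_integral_eq:
  assumes \<Gamma>: "surrounding_contour \<Gamma> (op_spectrum M) (U1 \<union> U2)"
  shows "calculus_integral \<Gamma> \<phi> M = S"
proof -
  define Z where "Z = U1 \<union> U2 - op_spectrum M"
  have contR: "continuous_on Z (resolvent M)"
    by (rule continuous_on_subset[OF continuous_on_resolvent[OF M]]) (auto simp: Z_def)
  have "continuous_on Z \<phi>"
    by (rule continuous_on_subset[OF holomorphic_on_imp_continuous_on[OF phi_holomorphic]])
      (auto simp: Z_def)
  then have cont1: "continuous_on Z (\<lambda>z. \<phi> z *\<^sub>C resolvent M z)"
    by (intro scaleC.continuous_on contR)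
  have cont2: "continuous_on Z (\<lambda>z. S o\<^sub>L resolvent M z)"
    by (intro compose.continuous_on continuous_on_const contR)
  have "weak_extension (U1 \<union> U2) Z (\<lambda>z. \<phi> z *\<^sub>C resolvent M z - (S o\<^sub>L resolvent M z))"
    using ext by (rule weak_extension_mono) (auto simp: Z_def compose.diff_left scaleC_compose)
  then have "contour_sum_integral \<Gamma> (\<lambda>z. \<phi> z *\<^sub>C resolvent M z - (S o\<^sub>L resolvent M z)) = 0"
    using U continuous_on_diff[OF cont1 cont2] unfolding Z_def
    by (intro contour_sum_integral_zero[OF _ \<Gamma>]) auto
  then have "contour_sum_integral \<Gamma> (\<lambda>z. \<phi> z *\<^sub>C resolvent M z)
      = contour_sum_integral \<Gamma> (\<lambda>z. S o\<^sub>L resolvent M z)"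
    using contour_sum_integral_diff[OF \<Gamma> cont1[unfolded Z_def] cont2[unfolded Z_def]] by simp
  \<comment> \<open>Here the contour surrounds the whole spectrum, so the region of extension is
    taken to be empty.\<close>
  also have "\<dots> = (2 * complex_of_real pi * \<i>) *\<^sub>C S"
  proof (rule resolvent_integral_at_infinity[OF M S \<Gamma>, of "{}"])
    show "weak_extension {} ({} - op_spectrum M) (\<lambda>z. S o\<^sub>L resolvent M z)"
      unfolding weak_extension_def by (auto intro!: exI[of _ "\<lambda>_. 0"])
  qed auto
  finally show ?thesis
    by (simp add: calculus_integral_def scaleC_scaleC)
qed

text \<open>With \<open>P\<close> half of \<open>S + id_blinfun\<close>, the operator
  \<open>id_blinfun - P\<close> is half of \<phi>(z) - S on \<open>U1\<close>, and \<open>P\<close>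
  is minus half of it on \<open>U2\<close>: this is how \<open>ext\<close> serves both terms of the
  resolvent. \<open>K\<close> needs only to contain the part of the spectrum in \<open>U1\<close>,
  so that \<sigma>(A) qualifies by the inclusion of \<sigma>(M) in the union of \<sigma>(A) and
  \<sigma>(B).\<close>

lemma spectral_projection_eq:
  assumes \<Gamma>: "surrounding_contour \<Gamma> K U1"
    and K: "op_spectrum M - U2 \<subseteq> K" "op_spectrum M \<inter> U1 \<subseteq> K"
  shows "(1 / (2 * complex_of_real pi * \<i>)) *\<^sub>C contour_sum_integral \<Gamma> (resolvent M)
    = (1 / 2) *\<^sub>C (S + id_blinfun)"
proof -
  define P where "P = (1 / 2) *\<^sub>C (S + id_blinfun)"
  have P: "complex_linear_op P"
    unfolding P_def using S by (intro complex_linear_op_scaleC complex_linear_op_add complex_linear_op_id)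
  have id_half: "(1 / 2) *\<^sub>C id_blinfun + (1 / 2) *\<^sub>C id_blinfun = (id_blinfun :: 'a \<Rightarrow>\<^sub>L 'a)"
    by (simp flip: scaleC_add_left)
  have "id_blinfun - P = (1 / 2) *\<^sub>C id_blinfun + (1 / 2) *\<^sub>C id_blinfun - P"
    by (simp only: id_half)
  then have P1: "id_blinfun - P = (1 / 2) *\<^sub>C (1 *\<^sub>C id_blinfun - S)"
    by (simp add: P_def scaleC_add_right scaleC.diff_right)
  have P2: "P = (- (1 / 2)) *\<^sub>C ((-1) *\<^sub>C id_blinfun - S)"
    by (simp add: P_def scaleC_add_right scaleC.diff_right scaleC_scaleC scaleC.minus_left
        scaleC.minus_right add.commute)
  have ext': "weak_extension (U1 \<union> U2) (U1 \<union> U2 - op_spectrum M)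
      (\<lambda>z. c *\<^sub>C ((\<phi> z *\<^sub>C id_blinfun - S) o\<^sub>L resolvent M z))" for c
    by (intro weak_extension_linear[OF ext, of "(*\<^sub>C) c"] bounded_linear_scaleC)
      (simp add: scaleC_scaleC mult.commute)
  have contR: "continuous_on (U1 - K) (resolvent M)"
    using K(2) by (intro continuous_on_subset[OF continuous_on_resolvent[OF M]]) auto
  have cont2: "continuous_on (U1 - K) (\<lambda>z. P o\<^sub>L resolvent M z)"
    by (intro compose.continuous_on continuous_on_const contR)
  have "weak_extension U1 (U1 - K) (\<lambda>z. resolvent M z - (P o\<^sub>L resolvent M z))"
  proof (rule weak_extension_mono[OF ext'[of "1 / 2"]])
    fix z assume "z \<in> U1 - K"
    then have "resolvent M z - (P o\<^sub>L resolvent M z) = (id_blinfun - P) o\<^sub>L resolvent M z"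
      by (simp add: compose.diff_left)
    then show "resolvent M z - (P o\<^sub>L resolvent M z)
        = (1 / 2) *\<^sub>C ((\<phi> z *\<^sub>C id_blinfun - S) o\<^sub>L resolvent M z)"
      using \<open>z \<in> U1 - K\<close> by (simp only: P1 phi scaleC_compose DiffD1)
  qed (use K(2) in auto)
  then have "contour_sum_integral \<Gamma> (\<lambda>z. resolvent M z - (P o\<^sub>L resolvent M z)) = 0"
    by (intro contour_sum_integral_zero[OF U(1) \<Gamma>] continuous_on_diff contR cont2)
  then have "contour_sum_integral \<Gamma> (resolvent M) = contour_sum_integral \<Gamma> (\<lambda>z. P o\<^sub>L resolvent M z)"
    using contour_sum_integral_diff[OF \<Gamma> contR cont2] by simp
  also have "\<dots> = (2 * complex_of_real pi * \<i>) *\<^sub>C P"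
  proof (rule resolvent_integral_at_infinity[OF M P \<Gamma> K(1) _ U(2)])
    show "weak_extension U2 (U2 - op_spectrum M) (\<lambda>z. P o\<^sub>L resolvent M z)"
    proof (rule weak_extension_mono[OF ext'[of "- (1 / 2)"]])
      fix z assume z: "z \<in> U2 - op_spectrum M"
      have "P o\<^sub>L resolvent M z = ((- (1 / 2)) *\<^sub>C ((-1) *\<^sub>C id_blinfun - S)) o\<^sub>L resolvent M z"
        by (simp only: P2[symmetric])
      then show "P o\<^sub>L resolvent M z = (- (1 / 2)) *\<^sub>C ((\<phi> z *\<^sub>C id_blinfun - S) o\<^sub>L resolvent M z)"
        using z by (simp only: phi scaleC_compose DiffD1)
    qed auto
  qed (use K(2) in auto)
  finally show ?thesis
    by (simp add: P_def scaleC_scaleC)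
qed

end

theorem proposition5p2:
  fixes A :: "'x::complex_banach \<Rightarrow>\<^sub>L 'x"
    and B :: "'y::complex_banach \<Rightarrow>\<^sub>L 'y"
    and C :: "'y \<Rightarrow>\<^sub>L 'x"
    and M :: "('x \<times> 'y) \<Rightarrow>\<^sub>L ('x \<times> 'y)"
    and N :: "'x \<times> 'y \<Rightarrow> real"
    and U1 U2 :: "complex set"
    and \<phi> :: "complex \<Rightarrow> complex"
    and p :: "complex poly"
    and d :: nat
    and lam :: "nat \<Rightarrow> complex"
    and \<gamma>1 :: "(real \<Rightarrow> complex) list"
  assumes "complex_linear_op A" and "complex_linear_op B" and "complex_linear_op C"
    and "direct_sum_norm N"
    and "M = upper_triangular_op A C B"
    and "open U1" and "open U2" and "U1 \<inter> U2 = {}"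
    and "polynomial_hull (op_spectrum A) \<subseteq> U1"
    and "polynomial_hull (op_spectrum B) \<subseteq> U2"
    and "\<forall>z\<in>U1. \<phi> z = 1" and "\<forall>z\<in>U2. \<phi> z = -1"
    and "d \<ge> 1" and "degree p = d" and "lead_coeff p = 1"
    and "inj_on lam {1..d}" and "{z. poly p z = 0} = lam ` {1..d}"
    and "{z. cmod (poly p z) \<le> op_norm N (op_poly p M)} \<subseteq> U1 \<union> U2"
    and "surrounding_contour \<gamma>1 (op_spectrum A) U1"
  shows "let Q = (1 / (2 * complex_of_real pi * \<i>)) *\<^sub>C contour_sum_integral \<gamma>1 (resolvent M);
             coef = multicentric_deriv p d lam \<phi>;
             series_term = (\<lambda>j n. (coef n j / fact n) *\<^sub>C op_power (op_poly p M) n);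
             phiM = (\<Sum>j=1..d. op_poly (lagrange_poly d lam j) M o\<^sub>L (\<Sum>n. series_term j n))
         in Q = (1/2) *\<^sub>C (phiM + id_blinfun)
          \<and> (\<forall>\<Gamma>. surrounding_contour \<Gamma> (op_spectrum M) (U1 \<union> U2) \<longrightarrow>
                 calculus_integral \<Gamma> \<phi> M = phiM)
          \<and> (\<forall>j\<in>{1..d}. summable (series_term j))
          \<and> (\<exists>f. multicentric_components p d lam \<phi> f
                \<and> (\<forall>j\<in>{1..d}. \<forall>n. (deriv ^^ n) (f j) 0 = coef n j))"
proof -
  define T where "T = op_poly p M"
  define \<tau> where "\<tau> = op_norm N T"
  have hull: "op_spectrum A \<subseteq> U1" "op_spectrum B \<subseteq> U2"
    using assms(9,10) subset_polynomial_hull by blast+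
  have M: "complex_linear_op M"
    unfolding assms(5) by (rule complex_linear_upper_triangular_op[OF assms(1-3)])
  have specM: "op_spectrum M \<subseteq> op_spectrum A \<union> op_spectrum B"
    unfolding assms(5) using op_spectrum_upper_triangular by blast
  have "\<tau> \<ge> 0"
    unfolding \<tau>_def by (rule op_norm_bounds[OF assms(4)])
  have "open (U1 \<union> U2)"
    using assms(6,7) by auto
  moreover have "degree p \<ge> 1"
    using assms(13,14) by simp
  ultimately obtain \<rho> where rho: "\<tau> < \<rho>" "{z. cmod (poly p z) < \<rho>} \<subseteq> U1 \<union> U2"
    using poly_sublevel_margin assms(18) unfolding \<tau>_def T_def by blast
  have phi: "\<phi> z = 1" if "z \<in> U1" for z
    using assms(11) that by blast
  have phi': "\<phi> z = -1" if "z \<in> U2" for z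
    using assms(12) that by blast
  interpret multicentric_setup p d lam \<rho> \<phi>
  proof
    fix z assume "cmod (poly p z) < \<rho>"
    then consider "z \<in> U1" | "z \<in> U2"
      using rho(2) by blast
    then have "(\<forall>\<^sub>F u in nhds z. \<phi> u = \<phi> z) \<and> cmod (\<phi> z) \<le> 1"
    proof cases
      case 1
      then have "\<forall>\<^sub>F u in nhds z. u \<in> U1"
        using assms(6) by (intro eventually_nhds_in_open)
      then show ?thesis
        by (auto elim: eventually_mono simp: phi 1)
    next
      case 2
      then have "\<forall>\<^sub>F u in nhds z. u \<in> U2"
        using assms(7) by (intro eventually_nhds_in_open)
      then show ?thesis
        by (auto elim: eventually_mono simp: phi' 2)
    qed
    then show "\<forall>\<^sub>F u in nhds z. \<phi> u = \<phi> z" "cmod (\<phi> z) \<le> 1"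
      by blast+
  qed (use assms(13-17) rho(1) \<open>\<tau> \<ge> 0\<close> in auto)
  obtain f where f: "\<And>j. f j holomorphic_on ball 0 \<rho>"
    "\<And>z. z \<in> lemniscate \<Longrightarrow> \<phi> z = (\<Sum>j=1..d. poly (lagrange_poly d lam j) z * f j (poly p z))"
    using multicentric_representation by blast
  have deriv_f: "(deriv ^^ n) (f j) 0 = multicentric_deriv p d lam \<phi> n j" if "j \<in> {1..d}" for n j
    by (rule higher_deriv_multicentric[OF f that])
  \<comment> \<open>The constant \<open>4\<close> is the cost of passing from \<open>N\<close> to
    the product norm and back.\<close>
  interpret op: multicentric_operator p d lam \<rho> \<phi> M 4 \<tau> f
  proof
    show "norm (op_power (op_poly p M) n) \<le> 4 * \<tau> ^ n" for n
      unfolding \<tau>_def T_def by (rule norm_op_power_le_op_norm[OF assms(4)])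
  qed (use M rho(1) \<open>\<tau> \<ge> 0\<close> f in auto)
  interpret spectral_splitting M op.calculus_op U1 U2 \<phi>
  proof
    have "lemniscate \<subseteq> U1 \<union> U2"
      using rho(2) by (simp add: lemniscate_def)
    then have "weak_extension (U1 \<union> U2) (U1 \<union> U2 - op_spectrum M) op.remainder"
      using \<open>open (U1 \<union> U2)\<close> holomorphic_on_two_constants[OF assms(6,7) phi phi']
      by (intro op.weak_extension_remainder)
    then show "weak_extension (U1 \<union> U2) (U1 \<union> U2 - op_spectrum M)
        (\<lambda>z. (\<phi> z *\<^sub>C id_blinfun - op.calculus_op) o\<^sub>L resolvent M z)"
      by (rule weak_extension_mono) (simp_all add: op.remainder_def)
  qed (use M op.complex_linear_calculus_op assms(6-8) phi phi' specM hull in auto)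
  define coef where "coef = multicentric_deriv p d lam \<phi>"
  define series_term where "series_term j n = (coef n j / fact n) *\<^sub>C op_power (op_poly p M) n" for j n
  define phiM where "phiM = (\<Sum>j=1..d. op_poly (lagrange_poly d lam j) M o\<^sub>L (\<Sum>n. series_term j n))"
  have series_term: "series_term j = (\<lambda>n. op.coef j n *\<^sub>C op_power (op_poly p M) n)" if "j \<in> {1..d}" for j
    using deriv_f[OF that] by (simp add: series_term_def[abs_def] coef_def op.coef_def)
  have phiM: "phiM = op.calculus_op"
    unfolding phiM_def op.calculus_op_def op.component_op_def
    by (intro sum.cong refl) (simp only: series_term)
  have "(1 / (2 * complex_of_real pi * \<i>)) *\<^sub>C contour_sum_integral \<gamma>1 (resolvent M)
      = (1 / 2) *\<^sub>C (phiM + id_blinfun)"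
    unfolding phiM using assms(8,19) specM hull by (intro spectral_projection_eq) auto
  moreover have "\<forall>\<Gamma>. surrounding_contour \<Gamma> (op_spectrum M) (U1 \<union> U2) \<longrightarrow> calculus_integral \<Gamma> \<phi> M = phiM"
    unfolding phiM by (intro allI impI calculus_integral_eq)
  moreover have "\<forall>j\<in>{1..d}. summable (series_term j)"
    using op.summable_component by (simp add: series_term)
  moreover have "multicentric_components p d lam \<phi> f"
    unfolding multicentric_components_def
  proof (intro conjI ballI)
    show "f j analytic_on {0}" for j
      using f(1)[of j] rho(1) \<open>\<tau> \<ge> 0\<close> by (simp add: analytic_on_def) (intro exI[of _ \<rho>], simp)
    fix i assume "i \<in> {1..d}"
    then have "\<forall>\<^sub>F z in nhds (lam i). z \<in> lemniscate"
      using open_lemniscate by (intro eventually_nhds_in_open) auto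
    then show "\<forall>\<^sub>F z in nhds (lam i).
        \<phi> z = (\<Sum>j=1..d. poly (lagrange_poly d lam j) z * f j (poly p z))"
      by (rule eventually_mono) (rule f(2))
  qed
  moreover have "\<forall>j\<in>{1..d}. \<forall>n. (deriv ^^ n) (f j) 0 = coef n j"
    using deriv_f by (simp add: coef_def)
  ultimately show ?thesis
    unfolding Let_def phiM_def series_term_def[abs_def] coef_def by blast
qed

end
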